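(* Assume conditions $H_1$–$H_5$ listed in the context. Then for every $(t_0,x_0)\in\mathbb{R}^{1+n}$ and every measurable control $u:[t_0,+\infty)\to U$ there exists a unique solution $x:[t_0,+\infty)\to\mathbb{R}^n$ of $$\dot x(t)\in F(t,x(t),u(t))\quad\text{for a.e. } t\in[t_0,+\infty),\qquad x(t_0)=x_0 .$$
   Context: Data: a nonempty compact set $U\subset\mathbb{R}^m$, a compact set $A\subseteq\mathbb{R}^\nu$, a finite Radon measure $\mu$ on $A$, functions $g:\mathbb{R}^{1+n}\times U\to\mathbb{R}^n$, $k:\mathbb{R}^{1+n}\times U\times A\to\mathbb{R}^+=[0,\infty)$, $\varphi:\mathbb{R}^n\times A\to\mathbb{R}$. The symbol $\partial_x\varphi(x,\alpha)$ denotes the subdifferential of convex analysis of $\varphi(\cdot,\alpha)$ at $x$. Define the multifunctions $$F(t,x,u)=g(t,x,u)-\int_A k(t,x,u,\alpha)\,\partial_x\varphi(x,\alpha)\,\mu(d\alpha),\qquad \bar F(t,x)=\bigcup_{u\in U}F(t,x,u),$$ where the integral of a multifunction is the set of integrals of its selections: $\int_A k(t,x,u,\alpha)\partial_x\varphi(x,\alpha)\mu(d\alpha)=\{\int_A k(t,x,u,\alpha)\xi(\alpha)\mu(d\alpha):\ \xi\ \mu\text{-measurable selection of }\partial_x\varphi(x,\cdot)\}$. Conditions: $H_1$: $(t,x,u,\alpha)\mapsto k(t,x,u,\alpha)$, $(t,x,u)\mapsto g(t,x,u)$, $(x,\alpha)\mapsto\varphi(x,\alpha)$ are continuous. $H_2$: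 for any compact $I\subset\mathbb{R}$, $K\subset\mathbb{R}^n$ there is $L>0$ with $|g(t,x,u)-g(s,y,u)|\le L(|t-s|+|x-y|)$ and $|k(t,x,u,\alpha)-k(s,y,u,\alpha)|\le L(|t-s|+|x-y|)$ for all $(t,x),(s,y)\in I\times K$, $u\in U$, $\alpha\in A$. $H_3$: there are constants $C_1,C_2\ge0$ with $0\le k(t,x,u,\alpha)\le C_1+C_2|x|$ and $|g(t,x,u)|\le C_1+C_2|x|$ for all $(t,x,u,\alpha)\in\mathbb{R}\times\mathbb{R}^n\times U\times A$. $H_4$: for each $\alpha\in A$, $x\mapsto\varphi(x,\alpha)$ is convex and globally Lipschitz continuous with constant $L_\varphi(\alpha)$, where $L_\varphi(\cdot)$ is non-negative and $\mu$-integrable. $H_5$: $\bar F(t,x)$ is convex for each $(t,x)\in\mathbb{R}^{1+n}$. Solutions are (locally) absolutely continuous functions satisfying the inclusion almost everywhere. *)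

theory Defs
  imports "HOL-Analysis.Analysis"
begin

text \<open>Outer regularity is not listed: for a finite measure on a compact set it follows from
  inner regularity by taking complements.\<close>

definition finite_radon_measure_on :: "'a::euclidean_space set \<Rightarrow> 'a measure \<Rightarrow> bool" where
  "finite_radon_measure_on A \<mu> \<longleftrightarrow>
     sets \<mu> = sets (restrict_space borel A) \<and> finite_measure \<mu> \<and>
     (\<forall>B\<in>sets \<mu>. emeasure \<mu> B = (SUP K\<in>{K. K \<subseteq> B \<and> compact K}. emeasure \<mu> K))"

definition subdifferential :: "('a::real_inner \<Rightarrow> real) \<Rightarrow> 'a \<Rightarrow> 'a set" where
  "subdifferential f x = {p. \<forall>y. f x + p \<bullet> (y - x) \<le> f y}"

text \<open>The integral of a weighted multifunction as the set of integrals of its measurable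
  selections. The integrability clause only excludes the default value \<open>0\<close> that the Bochner
  integral assigns to a non-integrable function.\<close>

definition weighted_set_integral ::
    "'b measure \<Rightarrow> ('b \<Rightarrow> real) \<Rightarrow> ('b \<Rightarrow> 'a::euclidean_space set) \<Rightarrow> 'a set" where
  "weighted_set_integral M w G =
     {\<integral>\<alpha>. w \<alpha> *\<^sub>R \<xi> \<alpha> \<partial>M | \<xi>.
        \<xi> \<in> borel_measurable M \<and> (\<forall>\<alpha>\<in>space M. \<xi> \<alpha> \<in> G \<alpha>) \<and>
        integrable M (\<lambda>\<alpha>. w \<alpha> *\<^sub>R \<xi> \<alpha>)}"

text \<open>\<open>\<mu>\<close> is a Borel measure; measurability and integrability with respect to \<open>\<mu>\<close> refer to its
  completion.\<close>

definition F_map ::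
    "(real \<Rightarrow> 'a::euclidean_space \<Rightarrow> 'u \<Rightarrow> 'a) \<Rightarrow> (real \<Rightarrow> 'a \<Rightarrow> 'u \<Rightarrow> 'b \<Rightarrow> real) \<Rightarrow>
     ('a \<Rightarrow> 'b \<Rightarrow> real) \<Rightarrow> 'b measure \<Rightarrow> real \<Rightarrow> 'a \<Rightarrow> 'u \<Rightarrow> 'a set" where
  "F_map g k \<phi> \<mu> t x u =
     (\<lambda>v. g t x u - v) `
       weighted_set_integral (completion \<mu>) (k t x u) (\<lambda>\<alpha>. subdifferential (\<lambda>y. \<phi> y \<alpha>) x)"

definition F_bar ::
    "(real \<Rightarrow> 'a::euclidean_space \<Rightarrow> 'u \<Rightarrow> 'a) \<Rightarrow> (real \<Rightarrow> 'a \<Rightarrow> 'u \<Rightarrow> 'b \<Rightarrow> real) \<Rightarrow>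
     ('a \<Rightarrow> 'b \<Rightarrow> real) \<Rightarrow> 'b measure \<Rightarrow> 'u set \<Rightarrow> real \<Rightarrow> 'a \<Rightarrow> 'a set" where
  "F_bar g k \<phi> \<mu> U t x = (\<Union>u\<in>U. F_map g k \<phi> \<mu> t x u)"

text \<open>A division of some set is a finite family of non-overlapping compact intervals \<open>[a, b]\<close>,
  with \<open>a = Inf I\<close> and \<open>b = Sup I\<close>.\<close>

definition abs_continuous_on :: "real set \<Rightarrow> (real \<Rightarrow> 'a::real_normed_vector) \<Rightarrow> bool" where
  "abs_continuous_on S f \<longleftrightarrow>
     (\<forall>\<epsilon>>0. \<exists>\<delta>>0. \<forall>\<D>. \<D> division_of \<Union>\<D> \<and> \<Union>\<D> \<subseteq> S \<and> (\<Sum>I\<in>\<D>. Sup I - Inf I) < \<delta>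
        \<longrightarrow> (\<Sum>I\<in>\<D>. norm (f (Sup I) - f (Inf I))) < \<epsilon>)"

definition loc_abs_continuous_on :: "real set \<Rightarrow> (real \<Rightarrow> 'a::real_normed_vector) \<Rightarrow> bool" where
  "loc_abs_continuous_on S f \<longleftrightarrow> (\<forall>a b. {a..b} \<subseteq> S \<longrightarrow> abs_continuous_on {a..b} f)"

text \<open>Only the values of \<open>x\<close> on \<open>[t0, \<infinity>)\<close> matter.\<close>

definition solves_inclusion ::
    "(real \<Rightarrow> 'a::euclidean_space \<Rightarrow> 'a set) \<Rightarrow> real \<Rightarrow> 'a \<Rightarrow> (real \<Rightarrow> 'a) \<Rightarrow> bool" where
  "solves_inclusion \<Phi> t0 x0 x \<longleftrightarrow>
     loc_abs_continuous_on {t0..} x \<and> x t0 = x0 \<and>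
     (AE t in lebesgue_on {t0..}.
        \<exists>v. (x has_vector_derivative v) (at t within {t0..}) \<and> v \<in> \<Phi> t (x t))"

end

theory Submission
  imports Defs
begin

text \<open>Uniqueness rests on monotonicity of the subdifferential, which makes the right-hand side
  one-sided Lipschitz, and Gronwall's inequality. For existence, Euler polygons that use an arbitrary
  measurable selection with frozen state form a Cauchy sequence: the same one-sided estimate gives
  \<open>\<bar>x\<^sub>h - x\<^sub>k\<bar>\<^sup>2 \<le> K (h + k)\<close> on bounded intervals. Their velocities converge only weakly. So the
  set \<open>F t x u\<close> is first described by linear inequalities, namely as the set of all \<open>v\<close> with
  \<open>(g t x u - v) \<bullet> (y - x) \<le> \<integral> k t x u \<alpha> (\<phi> y \<alpha> - \<phi> x \<alpha>) \<mu>(d\<alpha>)\<close> for all \<open>y\<close>; here the subdifferential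
  of an integral is identified with the integral of the subdifferentials. Tested with a fixed \<open>y\<close>
  and integrated in time, these inequalities pass to the limit.\<close>

section \<open>Absolutely continuous functions of a real variable\<close>

text \<open>The weight depends on the state, so the right-hand side is not a perturbation of one
  fixed subdifferential. The inequalities therefore freeze the weight at the base point x: g - v is
  a subgradient at x of the convex function that maps y to the integral of k(t,x,u,\<alpha>)
  \<phi>(y,\<alpha>). Moving the weight from x to y costs an error of second order in |x - y|, which
  Gronwall's inequality absorbs.

  A subdifferential jumps, so a selection is in general not continuous in the state, and neither a
  fixed-point iteration nor a pointwise limit of selected velocities is at hand. Half-spaces, in
  contrast, are stable under weak limits. The price is the converse inclusion, from the inequalities
  back to one measurable \<xi>.\<close>

lemma indefinite_integral_AE_vector_derivative:
  fixes f :: "real \<Rightarrow> 'b::euclidean_space"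
  assumes f: "\<And>a b. f integrable_on {a..b}"
  obtains N where "negligible N"
    "\<And>a t. t \<notin> N \<Longrightarrow> a < t \<Longrightarrow> ((\<lambda>s. integral {a..s} f) has_vector_derivative f t) (at t)"
proof -
  obtain N1 where N1: "negligible N1"
    "\<And>x e. x \<notin> N1 \<Longrightarrow> 0 < e \<Longrightarrow> \<exists>d>0. \<forall>h. 0 < h \<and> h < d \<longrightarrow>
       norm (integral (cbox x (x + h *\<^sub>R One)) f /\<^sub>R h ^ DIM(real) - f x) < e"
    using integrable_ccontinuous_explicit[of f] f by (metis box_real(2))
  \<comment> \<open>The averages above are taken over intervals to the right of x only. The left
    derivative comes from the reflected function, at the price of the reflected null set.\<close>
  have f': "(\<lambda>t. f (- t)) integrable_on cbox a b" for a b
    using f[of "-b" "-a"] Henstock_Kurzweil_Integration.integrable_reflect_real[where f=f and a="-b" and b="-a"] by simp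
  obtain N2 where N2: "negligible N2"
    "\<And>x e. x \<notin> N2 \<Longrightarrow> 0 < e \<Longrightarrow> \<exists>d>0. \<forall>h. 0 < h \<and> h < d \<longrightarrow>
       norm (integral (cbox x (x + h *\<^sub>R One)) (\<lambda>t. f (- t)) /\<^sub>R h ^ DIM(real) - f (- x)) < e"
    using integrable_ccontinuous_explicit[of "\<lambda>t. f (- t)"] f' by metis
  have refl: "integral {-x..h-x} (\<lambda>t. f (- t)) = integral {x-h..x} f" for x h
    using Henstock_Kurzweil_Integration.integral_reflect_real[of x "x-h" f] by simp
  have neg: "negligible (N1 \<union> uminus ` N2)"
    using N1(1) N2(1) by (intro negligible_Un negligible_differentiable_image_negligible)
      (auto simp: differentiable_on_def)
  show thesis
  proof (rule that[OF neg])
    fix a t :: real assume t: "t \<notin> N1 \<union> uminus ` N2" and "a < t"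
    have t2: "- t \<notin> N2" using t by (metis UnI2 image_eqI minus_minus)
    show "((\<lambda>s. integral {a..s} f) has_vector_derivative f t) (at t)"
      unfolding has_vector_derivative_def has_derivative_within_alt
    proof (intro conjI allI impI)
      show "bounded_linear (\<lambda>x. x *\<^sub>R f t)" by (rule bounded_linear_scaleR_left)
      fix e :: real assume "0 < e"
      obtain d1 where d1: "d1 > 0" "\<And>h. 0 < h \<Longrightarrow> h < d1 \<Longrightarrow>
          norm (integral {t..t+h} f /\<^sub>R h - f t) < e"
        using N1(2)[of t e] t \<open>0 < e\<close> by auto
      obtain d2 where d2: "d2 > 0" "\<And>h. 0 < h \<Longrightarrow> h < d2 \<Longrightarrow>
          norm (integral {t-h..t} f /\<^sub>R h - f t) < e"
        using N2(2)[OF t2 \<open>0 < e\<close>] by (auto simp: refl)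
      have scale: "norm (I - h *\<^sub>R v) \<le> e * h" if "norm (I /\<^sub>R h - v) < e" "h > 0" for I v :: 'b and h
      proof -
        have "I - h *\<^sub>R v = h *\<^sub>R (I /\<^sub>R h - v)" using that by (simp add: scaleR_diff_right)
        then show ?thesis using that by (simp add: mult.commute)
      qed
      show "\<exists>d>0. \<forall>y\<in>UNIV. norm (y - t) < d \<longrightarrow>
          norm (integral {a..y} f - integral {a..t} f - (y - t) *\<^sub>R f t) \<le> e * norm (y - t)"
      proof (intro exI[of _ "Min {d1, d2, t - a}"] conjI ballI impI)
        show "0 < Min {d1, d2, t - a}" using d1 d2 \<open>a < t\<close> by simp
        fix y assume y: "norm (y - t) < Min {d1, d2, t - a}"
        consider "y = t" | "y > t" | "y < t" by linarith
        then show "norm (integral {a..y} f - integral {a..t} f - (y - t) *\<^sub>R f t) \<le> e * norm (y - t)"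
        proof cases
          case 2
          have "integral {a..t} f + integral {t..y} f = integral {a..y} f"
            using 2 \<open>a < t\<close> f by (intro Henstock_Kurzweil_Integration.integral_combine) auto
          then have "integral {a..y} f - integral {a..t} f = integral {t..y} f" by (simp add: algebra_simps)
          then show ?thesis using scale[OF d1(2)[of "y - t"]] 2 y by simp
        next
          case 3
          have "integral {a..y} f + integral {y..t} f = integral {a..t} f"
            using 3 y f by (intro Henstock_Kurzweil_Integration.integral_combine) auto
          then have "integral {a..y} f - integral {a..t} f = - integral {y..t} f" by (simp add: algebra_simps)
          then have "integral {a..y} f - integral {a..t} f - (y - t) *\<^sub>R f t
              = - (integral {y..t} f - (t - y) *\<^sub>R f t)" by (simp add: algebra_simps)
          then have "norm (integral {a..y} f - integral {a..t} f - (y - t) *\<^sub>R f t)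
              = norm (integral {y..t} f - (t - y) *\<^sub>R f t)" by (simp only: norm_minus_cancel)
          also have "\<dots> \<le> e * (t - y)"
            using 3 y d2(2)[of "t - y"] by (intro scale) auto
          finally show ?thesis using 3 by simp
        qed simp
      qed
    qed
  qed
qed

section \<open>Absolute continuity tested on divisions\<close>

lemma division_real_memberD:
  fixes \<D> :: "real set set"
  assumes "\<D> division_of S" "I \<in> \<D>"
  shows "Inf I \<in> I" "Sup I \<in> I" "Inf I \<le> Sup I" "I \<subseteq> S"
proof -
  obtain a b where ab: "I = {a..b}" using division_ofD(4)[OF assms] by auto
  have "a \<le> b" using division_ofD(3)[OF assms] ab by auto
  then show "Inf I \<in> I" "Sup I \<in> I" "Inf I \<le> Sup I" "I \<subseteq> S"
    using ab division_ofD(2)[OF assms] by auto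
qed

text \<open>The summand \<bar>s - r\<bar> is absolutely continuous by itself. Admitting it covers
  products with Lipschitz factors, added linear terms and, with \<open>z\<close> constant, all
  Lipschitz functions.\<close>

lemma abs_continuous_on_transfer:
  fixes z :: "real \<Rightarrow> 'a::real_normed_vector" and f :: "real \<Rightarrow> 'b::real_normed_vector"
  assumes z: "abs_continuous_on S z"
    and f: "\<And>r s. r \<in> S \<Longrightarrow> s \<in> S \<Longrightarrow> norm (f s - f r) \<le> K * (norm (z s - z r) + \<bar>s - r\<bar>)"
  shows "abs_continuous_on S f"
  unfolding abs_continuous_on_def
proof (intro allI impI)
  fix e :: real assume "e > 0"
  define K' where "K' = \<bar>K\<bar> + 1"
  have K': "K' > 0" "K \<le> K'" by (auto simp: K'_def)
  obtain d where d: "d > 0" "\<And>\<D>. \<D> division_of \<Union>\<D> \<Longrightarrow> \<Union>\<D> \<subseteq> S \<Longrightarrow> (\<Sum>I\<in>\<D>. Sup I - Inf I) < d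
     \<Longrightarrow> (\<Sum>I\<in>\<D>. norm (z (Sup I) - z (Inf I))) < e / (2 * K')"
    using z[unfolded abs_continuous_on_def, rule_format, of "e / (2 * K')"] K' \<open>e > 0\<close> by auto
  show "\<exists>\<delta>>0. \<forall>\<D>. \<D> division_of \<Union>\<D> \<and> \<Union>\<D> \<subseteq> S \<and> (\<Sum>I\<in>\<D>. Sup I - Inf I) < \<delta>
        \<longrightarrow> (\<Sum>I\<in>\<D>. norm (f (Sup I) - f (Inf I))) < e"
  proof (intro exI[of _ "min d (e / (2 * K'))"] conjI allI impI; (elim conjE)?)
    show "0 < min d (e / (2 * K'))" using d K' \<open>e > 0\<close> by simp
    fix \<D> :: "real set set"
    assume D: "\<D> division_of \<Union>\<D>" "\<Union>\<D> \<subseteq> S" "(\<Sum>I\<in>\<D>. Sup I - Inf I) < min d (e / (2 * K'))"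
    have "(\<Sum>I\<in>\<D>. norm (f (Sup I) - f (Inf I)))
        \<le> (\<Sum>I\<in>\<D>. K' * (norm (z (Sup I) - z (Inf I)) + (Sup I - Inf I)))"
    proof (rule sum_mono)
      fix I assume I: "I \<in> \<D>"
      note DI = division_real_memberD[OF D(1) I]
      have "norm (f (Sup I) - f (Inf I)) \<le> K * (norm (z (Sup I) - z (Inf I)) + \<bar>Sup I - Inf I\<bar>)"
        using DI D(2) by (intro f) auto
      also have "\<dots> \<le> K' * (norm (z (Sup I) - z (Inf I)) + \<bar>Sup I - Inf I\<bar>)"
        using K' by (intro mult_right_mono) auto
      finally show "norm (f (Sup I) - f (Inf I)) \<le> K' * (norm (z (Sup I) - z (Inf I)) + (Sup I - Inf I))"
        using DI by simp
    qed
    also have "\<dots> = K' * ((\<Sum>I\<in>\<D>. norm (z (Sup I) - z (Inf I))) + (\<Sum>I\<in>\<D>. Sup I - Inf I))"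
      by (simp add: sum_distrib_left[symmetric] sum.distrib)
    also have "\<dots> < K' * (e / (2 * K') + e / (2 * K'))"
      using D d(2)[of \<D>] K' by (intro mult_strict_left_mono add_strict_mono) auto
    also have "\<dots> = e" using K' by (simp add: field_simps)
    finally show "(\<Sum>I\<in>\<D>. norm (f (Sup I) - f (Inf I))) < e" .
  qed
qed

lemma lipschitz_imp_abs_continuous_on:
  fixes f :: "real \<Rightarrow> 'a::real_normed_vector"
  assumes "\<And>r s. r \<in> S \<Longrightarrow> s \<in> S \<Longrightarrow> norm (f s - f r) \<le> K * \<bar>s - r\<bar>"
  shows "abs_continuous_on S f"
proof (rule abs_continuous_on_transfer[where z="\<lambda>_. 0::real" and K=K])
  show "abs_continuous_on S (\<lambda>_. 0::real)"
    unfolding abs_continuous_on_def using zero_less_one by (auto intro!: exI[of _ 1])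
qed (use assms in simp)

lemma abs_continuous_on_subset:
  "abs_continuous_on S f \<Longrightarrow> T \<subseteq> S \<Longrightarrow> abs_continuous_on T f"
  unfolding abs_continuous_on_def by (meson subset_trans)

lemma abs_continuous_on_imp_continuous_on:
  fixes f :: "real \<Rightarrow> 'a::real_normed_vector"
  assumes f: "abs_continuous_on {a..b} f"
  shows "continuous_on {a..b} f"
  unfolding continuous_on_iff
proof (intro ballI allI impI)
  fix x e :: real assume x: "x \<in> {a..b}" and "e > 0"
  obtain d where d: "d > 0" "\<And>\<D>. \<D> division_of \<Union>\<D> \<Longrightarrow> \<Union>\<D> \<subseteq> {a..b} \<Longrightarrow> (\<Sum>I\<in>\<D>. Sup I - Inf I) < d
     \<Longrightarrow> (\<Sum>I\<in>\<D>. norm (f (Sup I) - f (Inf I))) < e"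
    using f[unfolded abs_continuous_on_def, rule_format, OF \<open>e > 0\<close>] by auto
  have *: "norm (f s - f r) < e" if "r \<le> s" "r \<in> {a..b}" "s \<in> {a..b}" "s - r < d" for r s
    using d(2)[of "{{r..s}}"] that division_of_self[of r s] by auto
  show "\<exists>d>0. \<forall>x'\<in>{a..b}. dist x' x < d \<longrightarrow> dist (f x') (f x) < e"
  proof (intro exI[of _ d] conjI ballI impI d(1))
    fix y assume "y \<in> {a..b}" "dist y x < d"
    then show "dist (f y) (f x) < e"
      using *[of x y] *[of y x] x by (cases "x \<le> y") (auto simp: dist_norm norm_minus_commute)
  qed
qed

section \<open>Monotonicity from the sign of the derivative, and Gronwall's inequality\<close>

lemma division_total_length_le:
  fixes \<D> :: "real set set"
  assumes D: "\<D> division_of \<Union>\<D>" and sub: "\<Union>\<D> \<subseteq> T" and T: "T \<in> lmeasurable"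
  shows "(\<Sum>I\<in>\<D>. Sup I - Inf I) \<le> measure lebesgue T"
proof -
  have len: "Sup I - Inf I = measure lborel I" if "I \<in> \<D>" for I
  proof -
    obtain a b where "I = {a..b}" using division_ofD(4)[OF D \<open>I \<in> \<D>\<close>] by auto
    then show ?thesis using division_ofD(3)[OF D that] by auto
  qed
  \<comment> \<open>Members of a division may share endpoints, so their lengths are added through
    the integral of 1 rather than through additivity on disjoint sets.\<close>
  have "((\<lambda>x. 1::real) has_integral (\<Sum>I\<in>\<D>. measure lborel I)) (\<Union>\<D>)"
  proof (rule has_integral_combine_division[OF D])
    fix I assume "I \<in> \<D>"
    then obtain a b where "I = cbox a b" using division_ofD(4)[OF D] by blast
    then show "((\<lambda>x. 1::real) has_integral measure lborel I) I"
      using has_integral_const_real[of "1::real" a b] by (simp split: if_splits)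
  qed
  moreover have "\<Union>\<D> \<in> lmeasurable"
    using division_ofD(1)[OF D] division_ofD(4)[OF D] by (intro fmeasurable.finite_Union) auto
  ultimately have "(\<Sum>I\<in>\<D>. measure lborel I) = measure lebesgue (\<Union>\<D>)"
    by (simp add: lmeasure_integral integral_unique)
  also have "\<dots> \<le> measure lebesgue T"
    using sub T \<open>\<Union>\<D> \<in> lmeasurable\<close> by (intro measure_mono_fmeasurable) auto
  finally show ?thesis using len by simp
qed

text \<open>A fine tagged division does the work of integrating the derivative. Over an interval
  tagged outside \<open>E\<close> the function rises by at most \<open>e\<close> times its length.
  The intervals tagged in \<open>E\<close> lie in an open set of measure below \<open>d\<close>, so
  absolute continuity bounds their total contribution by \<open>e\<close>. The choice of
  \<open>e\<close> makes both parts add up to \<open>e0\<close>.\<close>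

lemma abs_continuous_on_antimono:
  fixes f :: "real \<Rightarrow> real"
  assumes "a \<le> b" and ac: "abs_continuous_on {a..b} f" and E: "negligible E"
    and der: "\<And>t. t \<in> {a..b} - E \<Longrightarrow> \<exists>D\<le>0. (f has_vector_derivative D) (at t within {a..b})"
  shows "f b \<le> f a"
proof (rule field_le_epsilon)
  fix e0 :: real assume "e0 > 0"
  define e where "e = e0 / (b - a + 1)"
  have e: "e > 0" using \<open>e0 > 0\<close> \<open>a \<le> b\<close> by (simp add: e_def)
  obtain d where d: "d > 0" "\<And>\<D>. \<D> division_of \<Union>\<D> \<Longrightarrow> \<Union>\<D> \<subseteq> {a..b} \<Longrightarrow> (\<Sum>I\<in>\<D>. Sup I - Inf I) < d
     \<Longrightarrow> (\<Sum>I\<in>\<D>. norm (f (Sup I) - f (Inf I))) < e"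
    using ac[unfolded abs_continuous_on_def, rule_format, OF e] by auto
  obtain T where T: "open T" "E \<subseteq> T" "T - E \<in> lmeasurable" "emeasure lebesgue (T - E) < ennreal d"
    using sets_lebesgue_outer_open[OF negligible_imp_sets[OF E] d(1)] by metis
  have E0: "E \<in> lmeasurable" "measure lebesgue E = 0"
    using E by (auto simp: negligible_imp_measurable negligible_imp_measure0)
  have T1: "T \<in> lmeasurable"
    using T E0 fmeasurable.Un[of "T - E" lebesgue E] by (metis Diff_partition Un_commute)
  have "measure lebesgue T \<le> measure lebesgue (T - E) + measure lebesgue E"
    using T E0 measure_Un_le[of "T - E" lebesgue E] fmeasurableD
    by (metis Diff_partition Un_commute)
  also have "\<dots> < d" using T E0 d(1)
    by (simp add: emeasure_eq_measure2 ennreal_less_iff)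
  finally have Td: "measure lebesgue T < d" .
  \<comment> \<open>The tag of an interval need not be one of its endpoints, so the increment is
    estimated from t to both sides; the derivative terms add up to \<open>(s - c) * D\<close>, which
    is nonpositive.\<close>
  have "\<exists>r>0. (t \<in> E \<longrightarrow> ball t r \<subseteq> T) \<and> (t \<in> {a..b} - E \<longrightarrow> (\<forall>c\<in>{a..b}. \<forall>s\<in>{a..b}.
      c \<le> t \<and> t \<le> s \<and> \<bar>c - t\<bar> < r \<and> \<bar>s - t\<bar> < r \<longrightarrow> f s - f c \<le> e * (s - c)))" for t
  proof (cases "t \<in> {a..b} - E")
    case True
    then obtain D where "D \<le> 0" "(f has_vector_derivative D) (at t within {a..b})" using der by blast
    then obtain r where r: "r > 0" "\<And>y. y \<in> {a..b} \<Longrightarrow> \<bar>y - t\<bar> < r \<Longrightarrow>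
         \<bar>f y - f t - (y - t) * D\<bar> \<le> e * \<bar>y - t\<bar>"
      using e unfolding has_vector_derivative_def has_derivative_within_alt by (auto; blast)
    have "f s - f c \<le> e * (s - c)" if "c \<in> {a..b}" "s \<in> {a..b}" "c \<le> t" "t \<le> s" "\<bar>c - t\<bar> < r" "\<bar>s - t\<bar> < r" for c s
    proof -
      have 1: "f s - f t - (s - t) * D \<le> e * (s - t)" using r(2)[of s] that by auto
      have 2: "- (f c - f t - (c - t) * D) \<le> e * (t - c)" using r(2)[of c] that by auto
      have "(s - c) * D \<le> 0" using that \<open>D \<le> 0\<close> by (simp add: mult_nonneg_nonpos)
      then show ?thesis using 1 2 by (simp add: algebra_simps)
    qed
    then show ?thesis using r True by blast
  next
    case False
    have "\<exists>r>0. t \<in> E \<longrightarrow> ball t r \<subseteq> T"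
    proof (cases "t \<in> E")
      case True
      then show ?thesis using T open_contains_ball[of T] by blast
    qed (use zero_less_one in blast)
    then show ?thesis using False by blast
  qed
  then obtain r where r: "\<And>t. r t > 0" "\<And>t. t \<in> E \<Longrightarrow> ball t (r t) \<subseteq> T"
    "\<And>t c s. t \<in> {a..b} - E \<Longrightarrow> c \<in> {a..b} \<Longrightarrow> s \<in> {a..b} \<Longrightarrow> c \<le> t \<Longrightarrow> t \<le> s \<Longrightarrow> \<bar>c - t\<bar> < r t \<Longrightarrow>
       \<bar>s - t\<bar> < r t \<Longrightarrow> f s - f c \<le> e * (s - c)"
    by metis
  have "gauge (\<lambda>t. ball t (r t))" using r(1) by (auto simp: gauge_def)
  then obtain p where p: "p tagged_division_of {a..b}" "(\<lambda>t. ball t (r t)) fine p"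
    by (rule fine_division_exists_real)
  note fin = tagged_division_of_finite[OF p(1)]
  have pK: "Inf K \<in> K \<and> Sup K \<in> K \<and> Inf K \<le> t \<and> t \<le> Sup K \<and> Inf K \<in> {a..b} \<and> Sup K \<in> {a..b} \<and>
      t \<in> {a..b} \<and> K \<subseteq> {a..b} \<and> K \<subseteq> ball t (r t)" if "(t, K) \<in> p" for t K
  proof -
    have 1: "t \<in> K" "K \<subseteq> {a..b}" "\<exists>c d. K = cbox c d" using tagged_division_ofD(2-4)[OF p(1) that] by auto
    moreover have "K \<subseteq> ball t (r t)" using p(2) that by (auto simp: fine_def)
    ultimately show ?thesis by auto
  qed
  define q where "q = {(t, K) \<in> p. t \<in> E}"
  have qp: "q \<subseteq> p" by (auto simp: q_def)
  have q: "q tagged_division_of \<Union>(snd ` q)"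
  proof -
    have "p tagged_partial_division_of {a..b}" using p(1) by (simp add: tagged_division_of_def)
    from tagged_partial_division_of_Union_self[OF tagged_partial_division_subset[OF this qp]]
    show ?thesis .
  qed
  have Dq: "snd ` q division_of \<Union>(snd ` q)" using division_of_tagged_division[OF q] .
  have sq: "(\<Sum>(t,K)\<in>q. f (Sup K) - f (Inf K)) = (\<Sum>K\<in>snd ` q. f (Sup K) - f (Inf K))"
  proof -
    \<comment> \<open>Different tags may carry the same one-point interval, where the increment
      vanishes. The value at the empty set is fixed to 0 because \<open>Inf\<close> and
      \<open>Sup\<close> say nothing there and the summation lemma asks about every box with empty
      interior.\<close>
    define h where "h K = (if K = {} then 0 else f (Sup K) - f (Inf K))" for K
    have *: "(\<Sum>(t,K)\<in>q. h K) = (\<Sum>K\<in>snd ` q. h K)"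
    proof (rule sum.over_tagged_division_lemma[OF q])
      fix u v :: real assume "box u v = {}"
      then show "h (cbox u v) = 0"
        by (cases "u = v") (auto simp: h_def)
    qed
    have h: "h K = f (Sup K) - f (Inf K)" if "(t, K) \<in> q" for t K
      using pK[of t K] qp that by (auto simp: h_def)
    note *
    moreover have "(\<Sum>(t,K)\<in>q. f (Sup K) - f (Inf K)) = (\<Sum>(t,K)\<in>q. h K)"
      using h by (intro sum.cong) auto
    moreover have "(\<Sum>K\<in>snd ` q. f (Sup K) - f (Inf K)) = (\<Sum>K\<in>snd ` q. h K)"
      using h by (intro sum.cong) auto
    ultimately show ?thesis by simp
  qed
  also have "\<dots> \<le> (\<Sum>K\<in>snd ` q. norm (f (Sup K) - f (Inf K)))" by (intro sum_mono) simp
  also have "\<dots> \<le> e"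
  proof (rule less_imp_le, rule d(2)[OF Dq])
    show "\<Union>(snd ` q) \<subseteq> {a..b}" using pK qp by fastforce
    have "\<Union>(snd ` q) \<subseteq> T"
    proof clarify
      fix x t K assume "(t, K) \<in> q" "x \<in> snd (t, K)"
      then show "x \<in> T" using pK[of t K] r(2)[of t] by (auto simp: q_def)
    qed
    from division_total_length_le[OF Dq this T1]
    show "(\<Sum>I\<in>snd ` q. Sup I - Inf I) < d" using Td by linarith
  qed
  finally have q_le: "(\<Sum>(t,K)\<in>q. f (Sup K) - f (Inf K)) \<le> e" .
  have "(\<Sum>(t,K)\<in>p - q. f (Sup K) - f (Inf K)) \<le> (\<Sum>(t,K)\<in>p - q. e * (Sup K - Inf K))"
  proof (rule sum_mono, clarify)
    fix t K assume "(t, K) \<in> p" "(t, K) \<notin> q"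
    then show "f (Sup K) - f (Inf K) \<le> e * (Sup K - Inf K)"
      using pK[of t K] by (intro r(3)[of t]) (auto simp: q_def dist_real_def subset_iff)
  qed
  also have "\<dots> \<le> (\<Sum>(t,K)\<in>p. e * (Sup K - Inf K))"
    using fin pK e by (intro sum_mono2) fastforce+
  also have "\<dots> = e * (b - a)"
    using additive_tagged_division_1[OF \<open>a \<le> b\<close> p(1), of "\<lambda>x. x"]
    by (simp add: sum_distrib_left[symmetric] split_def)
  finally have "(\<Sum>(t,K)\<in>p - q. f (Sup K) - f (Inf K)) \<le> e * (b - a)" .
  then have "f b - f a \<le> e * (b - a) + e"
    using q_le additive_tagged_division_1[OF \<open>a \<le> b\<close> p(1), of f]
      sum.subset_diff[OF qp fin, of "\<lambda>(t,K). f (Sup K) - f (Inf K)"] by linarith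
  also have "\<dots> = e * (b - a + 1)" by (simp add: algebra_simps)
  also have "\<dots> = e0" using \<open>a \<le> b\<close> by (simp add: e_def)
  finally show "f b \<le> f a + e0" by simp
qed

text \<open>With the integrating factor \<open>w\<close>, the derivative of \<open>h\<close> is at
  most \<open>w t * c - c\<close>, which is nonpositive because \<open>w\<close> is at most 1.
  Dividing by \<open>w b\<close> at the end produces the exponential. The case C = 0 serves for
  functions that decrease up to a small error.\<close>

lemma abs_continuous_gronwall:
  fixes f :: "real \<Rightarrow> real"
  assumes "a \<le> b" and ac: "abs_continuous_on {a..b} f" and E: "negligible E"
    and der: "\<And>t. t \<in> {a..b} - E \<Longrightarrow>
      \<exists>D\<le>C * f t + c. (f has_vector_derivative D) (at t within {a..b})"
    and "f a \<le> 0" "0 \<le> C" "0 \<le> c"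
  shows "f b \<le> c * (b - a) * exp (C * (b - a))"
proof -
  define w where "w t = exp (- (C * (t - a)))" for t
  define h where "h t = w t * f t - c * (t - a)" for t
  have wd: "(w has_vector_derivative (- C * w t)) (at t within S)" for t S
    unfolding w_def has_real_derivative_iff_has_vector_derivative[symmetric]
    by (auto intro!: derivative_eq_intros)
  have w1: "0 < w t" "w t \<le> 1" if "t \<in> {a..b}" for t
    using that \<open>0 \<le> C\<close> by (auto simp: w_def)
  have wlip: "\<bar>w s - w r\<bar> \<le> C * \<bar>s - r\<bar>" if "r \<in> {a..b}" "s \<in> {a..b}" for r s
  proof -
    have "norm (w s - w r) \<le> C * norm (s - r)"
    proof (rule field_differentiable_bound[of "{a..b}" w "\<lambda>t. - C * w t"])
      show "(w has_field_derivative - C * w z) (at z within {a..b})" for z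
        using wd has_real_derivative_iff_has_vector_derivative by blast
      show "norm (- C * w z) \<le> C" if "z \<in> {a..b}" for z
        using w1[OF that] \<open>0 \<le> C\<close> by (simp add: abs_mult mult_left_le)
    qed (use that in auto)
    then show ?thesis by simp
  qed
  have "compact (f ` {a..b})"
    using abs_continuous_on_imp_continuous_on[OF ac] by (intro compact_continuous_image) auto
  then have "bounded (f ` {a..b})" by (rule compact_imp_bounded)
  then obtain B where "\<forall>y\<in>f ` {a..b}. norm y \<le> B" unfolding bounded_iff ..
  then have B: "\<bar>f t\<bar> \<le> B" if "t \<in> {a..b}" for t using that by simp
  have B0: "0 \<le> B" using B[of a] \<open>a \<le> b\<close> by auto
  have "h b \<le> h a"
  proof (rule abs_continuous_on_antimono[OF \<open>a \<le> b\<close> _ E])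
    show "abs_continuous_on {a..b} h"
    \<comment> \<open>The constant collects the factor w \<le> 1 in front of the increment of f, the
      Lipschitz constant C of w times the bound B of f, and the linear term.\<close>
    proof (rule abs_continuous_on_transfer[OF ac, where K = "1 + C * B + c"])
      fix r s assume rs: "r \<in> {a..b}" "s \<in> {a..b}"
      have "h s - h r = w s * (f s - f r) + (w s - w r) * f r - c * (s - r)"
        by (simp add: h_def algebra_simps)
      then have "\<bar>h s - h r\<bar> \<le> \<bar>w s * (f s - f r)\<bar> + \<bar>(w s - w r) * f r\<bar> + \<bar>c * (s - r)\<bar>"
        by linarith
      moreover have "\<bar>w s * (f s - f r)\<bar> \<le> 1 * \<bar>f s - f r\<bar>"
        unfolding abs_mult using w1[of s] rs by (intro mult_right_mono) auto
      moreover have "\<bar>(w s - w r) * f r\<bar> \<le> (C * \<bar>s - r\<bar>) * B"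
        unfolding abs_mult using wlip[of r s] B[of r] rs by (intro mult_mono) auto
      moreover have "\<bar>c * (s - r)\<bar> = c * \<bar>s - r\<bar>" using \<open>0 \<le> c\<close> by (simp add: abs_mult)
      moreover have "0 \<le> C * B * \<bar>f s - f r\<bar>" "0 \<le> c * \<bar>f s - f r\<bar>" using \<open>0 \<le> C\<close> \<open>0 \<le> c\<close> B0 by auto
      moreover have "(1 + C * B + c) * (norm (f s - f r) + \<bar>s - r\<bar>) = \<bar>f s - f r\<bar> + \<bar>s - r\<bar>
          + C * B * \<bar>f s - f r\<bar> + (C * \<bar>s - r\<bar>) * B + c * \<bar>f s - f r\<bar> + c * \<bar>s - r\<bar>"
        by (simp add: algebra_simps)
      ultimately show "norm (h s - h r) \<le> (1 + C * B + c) * (norm (f s - f r) + \<bar>s - r\<bar>)"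
        using abs_ge_zero[of "s - r"] unfolding real_norm_def by linarith
    qed
    fix t assume t: "t \<in> {a..b} - E"
    then obtain D where D: "D \<le> C * f t + c" "(f has_vector_derivative D) (at t within {a..b})"
      using der by blast
    have "(h has_vector_derivative (w t * D + (- C * w t) * f t - c)) (at t within {a..b})"
      unfolding h_def using D(2) wd[of t "{a..b}"]
      unfolding has_real_derivative_iff_has_vector_derivative[symmetric]
      by (auto intro!: derivative_eq_intros)
    moreover have "w t * D + (- C * w t) * f t - c \<le> 0"
    proof -
      have "w t * D \<le> w t * (C * f t + c)" using w1[of t] t D(1) by (intro mult_left_mono) auto
      moreover have "w t * c \<le> c" using w1[of t] t \<open>0 \<le> c\<close> by (simp add: mult_left_le_one_le)
      ultimately show ?thesis by (simp add: algebra_simps)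
    qed
    ultimately show "\<exists>D\<le>0. (h has_vector_derivative D) (at t within {a..b})" by blast
  qed
  then have "w b * f b \<le> c * (b - a)" using \<open>f a \<le> 0\<close> by (simp add: h_def w_def)
  then have "exp (C * (b - a)) * (w b * f b) \<le> exp (C * (b - a)) * (c * (b - a))"
    by (intro mult_left_mono) auto
  moreover have "exp (C * (b - a)) * (w b * f b) = f b" by (simp add: w_def exp_minus)
  ultimately show ?thesis by (metis mult.commute)
qed

text \<open>The measures generated by \<open>M t + f t\<close> and \<open>M t - f t\<close> add up to a multiple of Lebesgue
  measure, which makes the first one absolutely continuous.\<close>

lemma lipschitz_real_density:
  fixes f :: "real \<Rightarrow> real"
  assumes "M > 0" and lip: "\<And>s t. \<bar>f s - f t\<bar> \<le> M * \<bar>s - t\<bar>"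
  obtains v where "\<And>a b. a \<le> b \<Longrightarrow> (v has_integral (f b - f a)) {a..b}"
proof -
  define F where "F t = f t + M * t" for t
  define G where "G t = M * t - f t" for t
  have mono: "F s \<le> F t" "G s \<le> G t" if "s \<le> t" for s t
    using lip[of s t] that by (auto simp: F_def G_def abs_if algebra_simps split: if_splits)
  have "continuous_on UNIV f"
    unfolding continuous_on_iff
  proof (intro ballI allI impI)
    fix x e :: real assume "e > 0"
    show "\<exists>d>0. \<forall>y\<in>UNIV. dist y x < d \<longrightarrow> dist (f y) (f x) < e"
    proof (intro exI[of _ "e / M"] conjI ballI impI)
      fix y assume "dist y x < e / M"
      then have "M * \<bar>y - x\<bar> < e" using \<open>M > 0\<close> by (simp add: dist_real_def field_simps)
      then show "dist (f y) (f x) < e" using lip[of y x] by (simp add: dist_real_def)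
    qed (use \<open>e > 0\<close> \<open>M > 0\<close> in auto)
  qed
  then have cf: "continuous (at_right t) f" for t
    by (simp add: continuous_on_eq_continuous_at continuous_at_imp_continuous_at_within)
  have cont: "continuous (at_right t) F" "continuous (at_right t) G" for t
    unfolding F_def G_def by (rule cf continuous_intros)+
  define \<mu> where "\<mu> = interval_measure F"
  define \<nu> where "\<nu> = interval_measure G"
  have muI: "emeasure \<mu> {a<..b} = ennreal (F b - F a)" "emeasure \<nu> {a<..b} = ennreal (G b - G a)"
    if "a \<le> b" for a b
    unfolding \<mu>_def \<nu>_def using that mono cont by (auto intro!: emeasure_interval_measure_Ioc)
  have sets[simp, measurable_cong]: "sets \<mu> = sets borel" "sets \<nu> = sets borel"
    by (auto simp: \<mu>_def \<nu>_def)
  have sp[simp]: "space \<mu> = UNIV" by (simp add: \<mu>_def)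
  define s where "s = measure_of UNIV (sets borel) (\<lambda>A. emeasure \<mu> A + emeasure \<nu> A)"
  have s_sets: "sets s = sets borel" 
    unfolding s_def using sets.sigma_sets_eq[of "borel :: real measure"] by (simp add: sets_measure_of_conv)
  have s_em: "emeasure s A = emeasure \<mu> A + emeasure \<nu> A" if "A \<in> sets borel" for A
    unfolding s_def
  proof (rule emeasure_measure_of_sigma)
    show "sigma_algebra UNIV (sets (borel :: real measure))"
      using sets.sigma_algebra_axioms[of "borel :: real measure"] by simp
    show "positive (sets borel) (\<lambda>A. emeasure \<mu> A + emeasure \<nu> A)" by (simp add: positive_def)
    show "countably_additive (sets borel) (\<lambda>A. emeasure \<mu> A + emeasure \<nu> A)"
      unfolding countably_additive_def
      by (auto simp: suminf_add[symmetric] suminf_emeasure)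
  qed (use that in auto)
  \<comment> \<open>Half-open intervals generate the Borel sets, and on them f cancels: the
    increments of \<open>F\<close> and \<open>G\<close> add up to
    \<open>2 * M * (b - a)\<close>.\<close>
  have s_eq: "s = density lborel (\<lambda>_. ennreal (2 * M))"
  proof (rule measure_eqI_generator_eq[where \<Omega>=UNIV and A="\<lambda>n. {- real n <.. real n}"])
    show "Int_stable (range (\<lambda>(a::real, b). {a<..b}))"
      by (auto simp: Int_stable_def)
    show "sets s = sigma_sets UNIV (range (\<lambda>(a::real, b). {a<..b}))"
      by (simp add: s_sets borel_sigma_sets_Ioc)
    show "sets (density lborel (\<lambda>_. ennreal (2 * M))) = sigma_sets UNIV (range (\<lambda>(a::real, b). {a<..b}))"
      by (simp add: borel_sigma_sets_Ioc)
    show "(\<Union>n. {- real n<..real n}) = UNIV"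
    proof -
      have "\<exists>n::nat. - real n < x \<and> x \<le> real n" for x
      proof -
        obtain n :: nat where "\<bar>x\<bar> < n" using reals_Archimedean2 by blast
        then show ?thesis by (intro exI[of _ n]) auto
      qed
      then show ?thesis by auto
    qed
    show "emeasure s {- real i<..real i} \<noteq> \<infinity>" for i
      by (simp add: s_em muI ennreal_plus[symmetric] del: ennreal_plus)
    fix X assume "X \<in> range (\<lambda>(a::real, b). {a<..b})"
    then obtain a b where X: "X = {a<..b}" by auto
    show "emeasure s X = emeasure (density lborel (\<lambda>_. ennreal (2 * M))) X"
    proof (cases "a \<le> b")
      case True
      then show ?thesis using mono[OF True] \<open>M > 0\<close>
        by (simp add: X s_em muI emeasure_density_const ennreal_plus[symmetric] ennreal_mult[symmetric]
            F_def G_def algebra_simps del: ennreal_plus)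
    qed (simp add: X)
  qed auto
  have "absolutely_continuous lborel \<mu>"
    unfolding absolutely_continuous_def
  proof
    fix A assume "A \<in> null_sets (lborel :: real measure)"
    then have A: "A \<in> sets borel" "emeasure lborel A = 0" by auto
    have "emeasure s A = 0" using A by (simp add: s_eq emeasure_density_const)
    then show "A \<in> null_sets \<mu>" using A by (auto simp: s_em)
  qed
  then obtain D where D: "D \<in> borel_measurable lborel" "density lborel D = \<mu>"
    using sigma_finite_measure.Radon_Nikodym[OF lborel.sigma_finite_measure_axioms, of \<mu>] by auto
  have "((\<lambda>t. enn2real (D t)) has_integral (F b - F a)) {a..b}" if "a \<le> b" for a b
  proof -
    have nn: "(\<integral>\<^sup>+ t. D t * indicator {a<..b} t \<partial>lborel) = ennreal (F b - F a)"
      unfolding muI(1)[OF that, symmetric] D(2)[symmetric]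
      using D(1) by (intro emeasure_density[symmetric]) auto
    \<comment> \<open>\<open>enn2real\<close> sends infinity to 0. Nothing is lost, since the finite
      mass of the interval keeps the density finite almost everywhere on it.\<close>
    then have "AE t in lborel. D t * indicator {a<..b} t \<noteq> \<infinity>"
      using D(1) by (intro nn_integral_noteq_infinite) auto
    then have nn': "(\<integral>\<^sup>+ t. ennreal (enn2real (D t) * indicator {a<..b} t) \<partial>lborel)
        = (\<integral>\<^sup>+ t. D t * indicator {a<..b} t \<partial>lborel)"
      by (intro nn_integral_cong_AE) (auto split: split_indicator elim!: eventually_mono simp: less_top)
    have ind: "(\<lambda>t. enn2real (D t) * indicator {a<..b} t) = (\<lambda>t. if t \<in> {a<..b} then enn2real (D t) else 0)"
      by (auto simp: indicator_def)
    have "((\<lambda>t. enn2real (D t) * indicator {a<..b} t) has_integral (F b - F a)) UNIV"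
      using nn nn' D(1) mono(1)[OF that] by (intro nn_integral_has_integral) auto
    then have "((\<lambda>t. enn2real (D t)) has_integral (F b - F a)) {a<..b}"
      unfolding ind has_integral_restrict_UNIV .
    then show ?thesis
      by (subst (asm) has_integral_spike_set_eq[where T = "{a..b}"]) (auto intro: negligible_subset[of "{a}"])
  qed
  moreover have "((\<lambda>_. M) has_integral (M * b - M * a)) {a..b}" if "a \<le> b" for a b
    using has_integral_const_real[of M a b] that by (simp add: algebra_simps)
  ultimately have "((\<lambda>t. enn2real (D t) - M) has_integral (F b - F a - (M * b - M * a))) {a..b}" if "a \<le> b" for a b
    using that by (intro has_integral_diff) auto
  then show thesis
    by (intro that[of "\<lambda>t. enn2real (D t) - M"]) (simp add: F_def algebra_simps)
qed

text \<open>Each coordinate is an indefinite integral of a density, so the differentiation theorem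
  for integrals applies to the vector of densities.\<close>

lemma lipschitz_AE_differentiable:
  fixes x :: "real \<Rightarrow> 'a::euclidean_space"
  assumes "M > 0" and lip: "\<And>s t. norm (x s - x t) \<le> M * \<bar>s - t\<bar>"
  obtains N where "negligible N" "\<And>t. t \<notin> N \<Longrightarrow> \<exists>v. (x has_vector_derivative v) (at t)"
proof -
  have "\<forall>i\<in>Basis. \<exists>v. \<forall>a b. a \<le> b \<longrightarrow> (v has_integral (x b \<bullet> i - x a \<bullet> i)) {a..b}"
  proof
    fix i :: 'a assume i: "i \<in> Basis"
    have "\<bar>x s \<bullet> i - x t \<bullet> i\<bar> \<le> M * \<bar>s - t\<bar>" for s t
      using lip[of s t] Basis_le_norm[OF i, of "x s - x t"] by (simp add: inner_diff_left)
    from lipschitz_real_density[of M "\<lambda>t. x t \<bullet> i", OF \<open>M > 0\<close> this]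
    show "\<exists>v. \<forall>a b. a \<le> b \<longrightarrow> (v has_integral (x b \<bullet> i - x a \<bullet> i)) {a..b}" by metis
  qed
  then obtain v where v: "\<And>i a b. i \<in> Basis \<Longrightarrow> a \<le> b \<Longrightarrow> (v i has_integral (x b \<bullet> i - x a \<bullet> i)) {a..b}"
    by metis
  define V where "V t = (\<Sum>i\<in>Basis. v i t *\<^sub>R i)" for t
  have V: "(V has_integral (x b - x a)) {a..b}" if "a \<le> b" for a b
    using v[OF _ that] unfolding V_def by (subst has_integral_componentwise_iff) (auto simp: inner_diff_left)
  have "V integrable_on {a..b}" for a b
    using V[of a b] by (cases "a \<le> b") (auto simp: integrable_on_def)
  from indefinite_integral_AE_vector_derivative[OF this]
  obtain N where N: "negligible N"
    "\<And>a t. t \<notin> N \<Longrightarrow> a < t \<Longrightarrow> ((\<lambda>s. integral {a..s} V) has_vector_derivative V t) (at t)" by metis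
  show thesis
  proof (rule that[OF N(1)])
    fix t assume "t \<notin> N"
    \<comment> \<open>The base point moves with t. This is legitimate because the null set
      \<open>N\<close> was obtained for all base points at once.\<close>
    then have "((\<lambda>s. integral {t-1..s} V + x (t-1)) has_vector_derivative V t) (at t)"
      using N(2)[of t "t-1"] by (auto intro!: derivative_eq_intros)
    then have "(x has_vector_derivative V t) (at t)"
    proof (rule has_vector_derivative_transform_within_open[where S="{t-1<..}"])
      show "integral {t-1..s} V + x (t-1) = x s" if "s \<in> {t-1<..}" for s
        using integral_unique[OF V[of "t-1" s]] that by simp
    qed auto
    then show "\<exists>v. (x has_vector_derivative v) (at t)" ..
  qed
qed

section \<open>Directional derivatives and subdifferentials of integrals\<close>

text \<open>For convex f the quotients increase with h, so this infimum is the one-sided limit as h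
  decreases to 0. As an infimum it is bounded by every single quotient, in particular by the one
  with h = 1, which yields subgradient inequalities.\<close>

definition dir_deriv :: "('a::real_normed_vector \<Rightarrow> real) \<Rightarrow> 'a \<Rightarrow> 'a \<Rightarrow> real" where
  "dir_deriv f x d = (INF h\<in>{0<..}. (f (x + h *\<^sub>R d) - f x) / h)"

text \<open>The last clause forces q 0 = 0 and, together with subadditivity, makes q Lipschitz with
  constant l. A sublinear function can therefore be differentiated directionally again, and the
  derivative stays in the class with the same l.\<close>

definition sublinear_bounded :: "real \<Rightarrow> ('a::real_normed_vector \<Rightarrow> real) \<Rightarrow> bool" where
  "sublinear_bounded l q \<longleftrightarrow> 0 \<le> l \<and> (\<forall>x y. q (x + y) \<le> q x + q y) \<and>
     (\<forall>c x. 0 < c \<longrightarrow> q (c *\<^sub>R x) = c * q x) \<and> (\<forall>x. \<bar>q x\<bar> \<le> l * norm x)"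

context
  fixes f :: "'a::real_normed_vector \<Rightarrow> real" and l :: real
  assumes cvx: "convex_on UNIV f" and lip: "lipschitz_on l UNIV f"
begin

lemma diff_quot_mono:
  assumes "0 < h" "h \<le> k"
  shows "(f (x + h *\<^sub>R d) - f x) / h \<le> (f (x + k *\<^sub>R d) - f x) / k"
proof -
  have "k > 0" using assms by simp
  then have "x + h *\<^sub>R d = (1 - h / k) *\<^sub>R x + (h / k) *\<^sub>R (x + k *\<^sub>R d)"
    by (simp add: algebra_simps)
  moreover have "f ((1 - h / k) *\<^sub>R x + (h / k) *\<^sub>R (x + k *\<^sub>R d)) \<le> (1 - h / k) * f x + (h / k) * f (x + k *\<^sub>R d)"
    using assms by (intro convex_onD[OF cvx]) auto
  ultimately have "f (x + h *\<^sub>R d) - f x \<le> (h / k) * (f (x + k *\<^sub>R d) - f x)"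
    by (simp only: left_diff_distrib right_diff_distrib)
  then show ?thesis using assms by (simp add: field_simps)
qed

lemma diff_quot_bound:
  assumes "0 < h" shows "\<bar>(f (x + h *\<^sub>R d) - f x) / h\<bar> \<le> l * norm d"
proof -
  have "\<bar>f (x + h *\<^sub>R d) - f x\<bar> \<le> l * (h * norm d)"
    using lipschitz_onD[OF lip, of "x + h *\<^sub>R d" x] assms by (simp add: dist_norm)
  then show ?thesis using assms by (simp add: abs_divide field_simps)
qed

lemma bdd_below_diff_quot: "bdd_below ((\<lambda>h. (f (x + h *\<^sub>R d) - f x) / h) ` {0<..})"
proof (rule bdd_belowI2)
  fix h :: real assume "h \<in> {0<..}"
  then have "0 < h" by simp
  from diff_quot_bound[OF this, of x d] show "- (l * norm d) \<le> (f (x + h *\<^sub>R d) - f x) / h"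
    unfolding abs_le_iff by linarith
qed

lemma dir_deriv_le_quot:
  assumes "0 < h" shows "dir_deriv f x d \<le> (f (x + h *\<^sub>R d) - f x) / h"
  unfolding dir_deriv_def using assms by (intro cINF_lower bdd_below_diff_quot) auto

lemma dir_deriv_tendsto:
  "((\<lambda>h. (f (x + h *\<^sub>R d) - f x) / h) \<longlongrightarrow> dir_deriv f x d) (at_right 0)"
proof (rule order_tendstoI)
  fix a assume "a < dir_deriv f x d"
  then show "\<forall>\<^sub>F h in at_right 0. a < (f (x + h *\<^sub>R d) - f x) / h"
    unfolding eventually_at_filter
    by (intro always_eventually allI impI less_le_trans[OF _ dir_deriv_le_quot]) auto
next
  fix a assume "dir_deriv f x d < a"
  then obtain k where k: "0 < k" "(f (x + k *\<^sub>R d) - f x) / k < a"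
    unfolding dir_deriv_def by (subst (asm) cINF_less_iff[OF _ bdd_below_diff_quot]) auto
  have "(f (x + h *\<^sub>R d) - f x) / h < a" if "0 < h" "h < k" for h
    using diff_quot_mono[of h k x d] that k by linarith
  then show "\<forall>\<^sub>F h in at_right 0. (f (x + h *\<^sub>R d) - f x) / h < a"
    unfolding eventually_at_right_field using k(1) by blast
qed

text \<open>The sequential form is what measurability in a parameter and dominated convergence
  require.\<close>

lemma dir_deriv_LIMSEQ:
  "(\<lambda>n. (f (x + inverse (Suc n) *\<^sub>R d) - f x) / inverse (Suc n)) \<longlonglongrightarrow> dir_deriv f x d"
proof (rule filterlim_compose[OF dir_deriv_tendsto])
  show "LIM n sequentially. inverse (real (Suc n)) :> at_right 0"
    unfolding filterlim_at using LIMSEQ_inverse_real_of_nat by auto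
qed

lemma dir_deriv_sublinear: "sublinear_bounded l (dir_deriv f x)"
  unfolding sublinear_bounded_def
proof (intro conjI allI impI)
  show "0 \<le> l" using lip by (rule lipschitz_on_nonneg)
  fix d e :: 'a
  \<comment> \<open>Doubled steps prepare subadditivity: x + h (d + e) is the midpoint of x + 2h d
    and x + 2h e.\<close>
  have lim2: "((\<lambda>h. (f (x + (2 * h) *\<^sub>R d) - f x) / (2 * h)) \<longlongrightarrow> dir_deriv f x d) (at_right 0)" for d
  proof (rule filterlim_compose[OF dir_deriv_tendsto])
    show "LIM h at_right (0::real). 2 * h :> at_right 0"
      unfolding filterlim_at
      by (auto intro!: tendsto_eq_intros simp: eventually_at_filter)
  qed
  show "dir_deriv f x (d + e) \<le> dir_deriv f x d + dir_deriv f x e"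
  proof (rule tendsto_le[OF _ tendsto_add[OF lim2[of d] lim2[of e]] dir_deriv_tendsto])
    show "\<forall>\<^sub>F h in at_right 0. (f (x + h *\<^sub>R (d + e)) - f x) / h
        \<le> (f (x + (2 * h) *\<^sub>R d) - f x) / (2 * h) + (f (x + (2 * h) *\<^sub>R e) - f x) / (2 * h)"
      unfolding eventually_at_filter
    proof (rule always_eventually, intro allI impI)
      fix h :: real assume "h \<noteq> 0" "h \<in> {0<..}"
      then have "h > 0" by simp
      have "x + h *\<^sub>R (d + e) = (1 - 1/2) *\<^sub>R (x + (2 * h) *\<^sub>R d) + (1/2) *\<^sub>R (x + (2 * h) *\<^sub>R e)"
        by (simp add: algebra_simps) (simp add: scaleR_add_left[symmetric])
      moreover have "f ((1 - 1/2) *\<^sub>R (x + (2 * h) *\<^sub>R d) + (1/2) *\<^sub>R (x + (2 * h) *\<^sub>R e))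
          \<le> (1 - 1/2) * f (x + (2 * h) *\<^sub>R d) + (1/2) * f (x + (2 * h) *\<^sub>R e)"
        by (intro convex_onD[OF cvx]) auto
      ultimately have "f (x + h *\<^sub>R (d + e)) - f x
          \<le> (f (x + (2 * h) *\<^sub>R d) - f x) / 2 + (f (x + (2 * h) *\<^sub>R e) - f x) / 2"
        by (simp add: field_simps)
      then have "(f (x + h *\<^sub>R (d + e)) - f x) / h
          \<le> ((f (x + (2 * h) *\<^sub>R d) - f x) / 2 + (f (x + (2 * h) *\<^sub>R e) - f x) / 2) / h"
        using \<open>h > 0\<close> by (intro divide_right_mono) auto
      then show "(f (x + h *\<^sub>R (d + e)) - f x) / h
        \<le> (f (x + (2 * h) *\<^sub>R d) - f x) / (2 * h) + (f (x + (2 * h) *\<^sub>R e) - f x) / (2 * h)"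
        by (simp add: add_divide_distrib)
    qed
  qed simp
  show "\<bar>dir_deriv f x d\<bar> \<le> l * norm d"
  proof (rule tendsto_upperbound[OF tendsto_rabs[OF dir_deriv_LIMSEQ]])
    show "\<forall>\<^sub>F n in sequentially. \<bar>(f (x + inverse (Suc n) *\<^sub>R d) - f x) / inverse (Suc n)\<bar> \<le> l * norm d"
      by (intro always_eventually allI diff_quot_bound) auto
  qed simp
  fix c :: real assume "0 < c"
  have "((\<lambda>h. c * ((f (x + (c * h) *\<^sub>R d) - f x) / (c * h))) \<longlongrightarrow> c * dir_deriv f x d) (at_right 0)"
  proof (intro tendsto_mult_left filterlim_compose[OF dir_deriv_tendsto])
    show "LIM h at_right (0::real). c * h :> at_right 0"
      unfolding filterlim_at using \<open>0 < c\<close>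
      by (auto intro!: tendsto_eq_intros simp: eventually_at_filter)
  qed
  then have "((\<lambda>h. (f (x + h *\<^sub>R (c *\<^sub>R d)) - f x) / h) \<longlongrightarrow> c * dir_deriv f x d) (at_right 0)"
    using \<open>0 < c\<close> by (simp add: mult.commute)
  then show "dir_deriv f x (c *\<^sub>R d) = c * dir_deriv f x d"
    by (rule tendsto_unique[OF trivial_limit_at_right_real dir_deriv_tendsto])
qed

end

section \<open>Sublinear functions and the directions along which they are linear\<close>

lemma sublinear_boundedD:
  assumes "sublinear_bounded l q"
  shows "0 \<le> l" "q (x + y) \<le> q x + q y" "0 < c \<Longrightarrow> q (c *\<^sub>R x) = c * q x" "\<bar>q x\<bar> \<le> l * norm x"
    "q 0 = 0"
proof -
  show "0 \<le> l" "q (x + y) \<le> q x + q y" "0 < c \<Longrightarrow> q (c *\<^sub>R x) = c * q x" "\<bar>q x\<bar> \<le> l * norm x"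
    using assms by (auto simp: sublinear_bounded_def)
  have "\<bar>q 0\<bar> \<le> l * norm (0::'a)" using assms unfolding sublinear_bounded_def by blast
  then show "q 0 = 0" by simp
qed

lemma sublinear_bounded_convex:
  assumes q: "sublinear_bounded l q"
  shows "convex_on UNIV q"
proof (rule convex_onI)
  fix t :: real and x y assume "0 < t" "t < 1"
  then show "q ((1 - t) *\<^sub>R x + t *\<^sub>R y) \<le> (1 - t) * q x + t * q y"
    using sublinear_boundedD(2)[OF q, of "(1 - t) *\<^sub>R x" "t *\<^sub>R y"] sublinear_boundedD(3)[OF q] by simp
qed auto

lemma sublinear_bounded_lipschitz:
  assumes q: "sublinear_bounded l q"
  shows "lipschitz_on l UNIV q"
proof (rule lipschitz_onI)
  fix x y
  have "q x - q y \<le> l * norm (x - y)" for x y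
    using sublinear_boundedD(2)[OF q, of "x - y" y] sublinear_boundedD(4)[OF q, of "x - y"] by simp
  from this[of x y] this[of y x] show "dist (q x) (q y) \<le> l * dist x y"
    by (simp add: dist_norm norm_minus_commute abs_le_iff)
qed (rule sublinear_boundedD(1)[OF q])

context
  fixes q :: "'a::real_normed_vector \<Rightarrow> real" and l :: real
  assumes q: "sublinear_bounded l q"
begin

lemmas sublinear_convex_lipschitz = sublinear_bounded_convex[OF q] sublinear_bounded_lipschitz[OF q]
lemmas sublinear_dir_deriv_sublinear = dir_deriv_sublinear[OF sublinear_convex_lipschitz]

lemma sublinear_neg_ge: "- q d \<le> q (- d)"
  using sublinear_boundedD(2)[OF q, of d "-d"] sublinear_boundedD(5)[OF q] by simp

lemma sublinear_dir_deriv_le: "dir_deriv q p d \<le> q d"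
  using dir_deriv_le_quot[OF sublinear_convex_lipschitz, of 1 p d] sublinear_boundedD(2)[OF q, of p d] by simp

text \<open>Linearity along d survives differentiation at any p: the derivative lies below q in both
  directions d and - d, and subadditivity leaves no room below these two values.\<close>

lemma sublinear_dir_deriv_neg:
  assumes "q (- d) = - q d" shows "dir_deriv q p d = q d" "dir_deriv q p (- d) = - q d"
proof -
  have "- dir_deriv q p d \<le> dir_deriv q p (- d)"
    using sublinear_boundedD(2)[OF sublinear_dir_deriv_sublinear, of p d "-d"] sublinear_boundedD(5)[OF sublinear_dir_deriv_sublinear] by simp
  then show "dir_deriv q p d = q d" "dir_deriv q p (- d) = - q d"
    using sublinear_dir_deriv_le[of p d] sublinear_dir_deriv_le[of p "-d"] assms by linarith+
qed

text \<open>Differentiating at p creates linearity along p itself. By homogeneity the quotient with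
  step 1/2 in direction - p is exactly - q p. This new direction is the gain in each round of the
  constructions below.\<close>

lemma sublinear_dir_deriv_self: "dir_deriv q p p = q p" "dir_deriv q p (- p) = - q p"
proof -
  have 1: "dir_deriv q p (- p) \<le> - q p"
  proof -
    have "(1 - 1/2 :: real) *\<^sub>R p = 1 *\<^sub>R p - (1/2) *\<^sub>R p" by (rule scaleR_left_diff_distrib)
    then have "p - (1/2) *\<^sub>R p = (1/2) *\<^sub>R p" by simp
    then show ?thesis
      using dir_deriv_le_quot[OF sublinear_convex_lipschitz, of "1/2" p "-p"] sublinear_boundedD(3)[OF q, of "1/2" p] by simp
  qed
  have 2: "- dir_deriv q p p \<le> dir_deriv q p (- p)"
    using sublinear_boundedD(2)[OF sublinear_dir_deriv_sublinear, of p p "-p"] sublinear_boundedD(5)[OF sublinear_dir_deriv_sublinear] by simp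
  show "dir_deriv q p p = q p" "dir_deriv q p (- p) = - q p"
    using 1 2 sublinear_dir_deriv_le[of p p] by linarith+
qed

lemma sublinear_scale_of_neg:
  assumes "q (- d) = - q d" shows "q (c *\<^sub>R d) = c * q d"
proof -
  consider "c > 0" | "c = 0" | "c < 0" by linarith
  then show ?thesis
  proof cases
    case 3
    then show ?thesis using sublinear_boundedD(3)[OF q, of "-c" "-d"] assms by simp
  qed (use sublinear_boundedD[OF q] in auto)
qed

lemma subspace_lineality: "subspace {d. q (- d) = - q d}"
proof (rule subspaceI)
  fix x y assume "x \<in> {d. q (- d) = - q d}" "y \<in> {d. q (- d) = - q d}"
  then have "q (- (x + y)) \<le> - q (x + y)"
    using sublinear_boundedD(2)[OF q, of "-x" "-y"] sublinear_boundedD(2)[OF q, of x y]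
      sublinear_boundedD(2)[OF q, of "x + y" "- y"] sublinear_boundedD(2)[OF q, of "-x" "-y"]
      sublinear_boundedD(2)[OF q, of "x + y" "- x"] by simp
  then show "x + y \<in> {d. q (- d) = - q d}" using sublinear_neg_ge[of "x + y"] by simp
next
  fix c x assume "x \<in> {d. q (- d) = - q d}"
  then show "c *\<^sub>R x \<in> {d. q (- d) = - q d}"
    using sublinear_scale_of_neg[of x c] sublinear_scale_of_neg[of x "-c"] by simp
qed (use sublinear_boundedD[OF q] in auto)

end

section \<open>Measurable families of sublinear functions and their linear minorants\<close>

definition sublinear_family :: "'b measure \<Rightarrow> ('b \<Rightarrow> real) \<Rightarrow> ('b \<Rightarrow> 'a::real_normed_vector \<Rightarrow> real) \<Rightarrow> bool" where
  "sublinear_family M l q \<longleftrightarrow> (\<forall>\<alpha>\<in>space M. sublinear_bounded (l \<alpha>) (q \<alpha>)) \<and>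
     (\<forall>d. (\<lambda>\<alpha>. q \<alpha> d) \<in> borel_measurable M)"

text \<open>The intersection of the lineality spaces of all members. It is a subspace, and its
  dimension measures progress in the disintegration argument.\<close>

definition lineality :: "'b measure \<Rightarrow> ('b \<Rightarrow> 'a::real_normed_vector \<Rightarrow> real) \<Rightarrow> 'a set" where
  "lineality M q = {d. \<forall>\<alpha>\<in>space M. q \<alpha> (- d) = - q \<alpha> d}"

text \<open>When \<open>q\<close> consists of directional derivatives of convex functions at a
  point, its linear minorants are subgradients there. The inequality is imposed at every point of
  the space, because \<open>weighted_set_integral\<close> asks for selections everywhere and not
  just almost everywhere.\<close>

definition measurable_minorants ::
    "'b measure \<Rightarrow> ('b \<Rightarrow> 'a::euclidean_space \<Rightarrow> real) \<Rightarrow> ('b \<Rightarrow> 'a) set" where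
  "measurable_minorants M q = {\<xi> \<in> borel_measurable M. \<forall>\<alpha>\<in>space M. \<forall>d. \<xi> \<alpha> \<bullet> d \<le> q \<alpha> d}"

lemma sublinear_familyD:
  assumes "sublinear_family M l q"
  shows "\<alpha> \<in> space M \<Longrightarrow> sublinear_bounded (l \<alpha>) (q \<alpha>)" "(\<lambda>\<alpha>. q \<alpha> d) \<in> borel_measurable M"
  using assms by (auto simp: sublinear_family_def)

lemma sublinear_family_dir_deriv_convex:
  assumes "\<And>\<alpha>. \<alpha> \<in> space M \<Longrightarrow> convex_on UNIV (f \<alpha>)"
    "\<And>\<alpha>. \<alpha> \<in> space M \<Longrightarrow> lipschitz_on (l \<alpha>) UNIV (f \<alpha>)"
    "\<And>y. (\<lambda>\<alpha>. f \<alpha> y) \<in> borel_measurable M"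
  shows "sublinear_family M l (\<lambda>\<alpha>. dir_deriv (f \<alpha>) x)"
  unfolding sublinear_family_def
proof (intro conjI ballI allI)
  fix d
  show "(\<lambda>\<alpha>. dir_deriv (f \<alpha>) x d) \<in> borel_measurable M"
  proof (rule borel_measurable_LIMSEQ_real[OF dir_deriv_LIMSEQ])
    show "(\<lambda>\<alpha>. (f \<alpha> (x + inverse (Suc n) *\<^sub>R d) - f \<alpha> x) / inverse (Suc n)) \<in> borel_measurable M" for n
      using assms(3) by (intro borel_measurable_divide borel_measurable_diff) auto
  qed (use assms in auto)
qed (use assms in \<open>auto intro: dir_deriv_sublinear\<close>)

context
  fixes M :: "'b measure" and l :: "'b \<Rightarrow> real" and q :: "'b \<Rightarrow> 'a::euclidean_space \<Rightarrow> real"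
  assumes q: "sublinear_family M l q"
begin

lemma sublinear_family_dir_deriv: "sublinear_family M l (\<lambda>\<alpha>. dir_deriv (q \<alpha>) p)"
  by (rule sublinear_family_dir_deriv_convex)
    (use sublinear_familyD[OF q] in \<open>auto intro: sublinear_bounded_convex sublinear_bounded_lipschitz\<close>)

lemma subspace_family_lineality: "subspace (lineality M q)"
proof -
  have "lineality M q = (\<Inter>\<alpha>\<in>space M. {d. q \<alpha> (- d) = - q \<alpha> d})" by (auto simp: lineality_def)
  moreover have "subspace (\<Inter>\<alpha>\<in>space M. {d. q \<alpha> (- d) = - q \<alpha> d})"
    using subspace_lineality[OF sublinear_familyD(1)[OF q]] by (intro subspace_Inter) auto
  ultimately show ?thesis by simp
qed

lemma lineality_dir_deriv: "insert p (lineality M q) \<subseteq> lineality M (\<lambda>\<alpha>. dir_deriv (q \<alpha>) p)"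
  using sublinear_dir_deriv_neg[OF sublinear_familyD(1)[OF q]]
    sublinear_dir_deriv_self[OF sublinear_familyD(1)[OF q]]
  by (auto simp: lineality_def)

end

text \<open>Passing to directional derivatives along a basis one vector after the other turns a
  sublinear function into a linear one below it; measurability in the parameter survives.\<close>

lemma measurable_minorants_nonempty:
  fixes q :: "'b \<Rightarrow> 'a::euclidean_space \<Rightarrow> real"
  assumes q: "sublinear_family M l q"
  shows "measurable_minorants M q \<noteq> {}"
proof -
  have "\<exists>q'. sublinear_family M l q' \<and> (\<forall>\<alpha>\<in>space M. \<forall>d. q' \<alpha> d \<le> q \<alpha> d) \<and> B \<subseteq> lineality M q'"
    if "finite B" for B
    using that
  proof (induction B)
    case empty
    then show ?case using q by auto
  next
    case (insert b B)
    then obtain q' where q': "sublinear_family M l q'" "\<forall>\<alpha>\<in>space M. \<forall>d. q' \<alpha> d \<le> q \<alpha> d"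
      "B \<subseteq> lineality M q'" by blast
    show ?case
    proof (intro exI conjI ballI allI)
      show "sublinear_family M l (\<lambda>\<alpha>. dir_deriv (q' \<alpha>) b)" by (rule sublinear_family_dir_deriv[OF q'(1)])
      show "insert b B \<subseteq> lineality M (\<lambda>\<alpha>. dir_deriv (q' \<alpha>) b)"
        using lineality_dir_deriv[OF q'(1), of b] q'(3) by blast
      show "dir_deriv (q' \<alpha>) b d \<le> q \<alpha> d" if "\<alpha> \<in> space M" for \<alpha> d
        using sublinear_dir_deriv_le[OF sublinear_familyD(1)[OF q'(1) that], of b d] q'(2) that
        by (meson order_trans)
    qed
  qed
  from this[OF finite_Basis] obtain q' where q': "sublinear_family M l q'"
    "\<forall>\<alpha>\<in>space M. \<forall>d. q' \<alpha> d \<le> q \<alpha> d" "Basis \<subseteq> lineality M q'" by blast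
  define \<xi> where "\<xi> \<alpha> = (\<Sum>b\<in>Basis. q' \<alpha> b *\<^sub>R b)" for \<alpha>
  have "\<xi> \<alpha> \<bullet> d \<le> q \<alpha> d" if \<alpha>: "\<alpha> \<in> space M" for \<alpha> d
  proof -
    note s = sublinear_familyD(1)[OF q'(1) \<alpha>]
    have sum_le: "q' \<alpha> (\<Sum>b\<in>B. c b *\<^sub>R b) \<le> (\<Sum>b\<in>B. c b * q' \<alpha> b)" if "finite B" "B \<subseteq> Basis" for B c
      using that
    proof (induction B)
      case (insert b B)
      have "q' \<alpha> (- b) = - q' \<alpha> b" using q'(3) insert.prems \<alpha> by (auto simp: lineality_def)
      from sublinear_scale_of_neg[OF s this, of "c b"] sublinear_boundedD(2)[OF s, of "c b *\<^sub>R b" "\<Sum>b\<in>B. c b *\<^sub>R b"]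
      show ?case using insert by simp
    qed (use sublinear_boundedD(5)[OF s] in simp)
    \<comment> \<open>Subadditivity only gives upper bounds on sums. Applied to - d, it turns into
      the lower bound that \<open>q' \<alpha> d\<close> needs.\<close>
    have "- d = (\<Sum>b\<in>Basis. (- (d \<bullet> b)) *\<^sub>R b)"
      by (simp add: sum_negf euclidean_representation)
    then have "q' \<alpha> (- d) \<le> (\<Sum>b\<in>Basis. (- (d \<bullet> b)) * q' \<alpha> b)"
      using sum_le[OF finite_Basis order_refl, of "\<lambda>b. - (d \<bullet> b)"] by simp
    then have "(\<Sum>b\<in>Basis. (d \<bullet> b) * q' \<alpha> b) \<le> q' \<alpha> d"
      using sublinear_neg_ge[OF s, of "-d"] by (simp add: sum_negf)
    moreover have "\<xi> \<alpha> \<bullet> d = (\<Sum>b\<in>Basis. (d \<bullet> b) * q' \<alpha> b)"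
      unfolding \<xi>_def inner_sum_left inner_scaleR_left
      by (intro sum.cong refl) (simp only: inner_commute mult.commute)
    ultimately show ?thesis using q'(2) \<alpha> by (metis order_trans)
  qed
  moreover have "\<xi> \<in> borel_measurable M"
    unfolding \<xi>_def using sublinear_familyD(2)[OF q'(1)] by measurable
  ultimately have "\<xi> \<in> measurable_minorants M q" by (simp add: measurable_minorants_def)
  then show ?thesis by blast
qed

text \<open>The minorant is tested with itself as direction.\<close>

lemma measurable_minorants_bound:
  assumes q: "sublinear_family M l q" and "\<xi> \<in> measurable_minorants M q" "\<alpha> \<in> space M"
  shows "norm (\<xi> \<alpha>) \<le> l \<alpha>"
proof -
  have "\<xi> \<alpha> \<bullet> \<xi> \<alpha> \<le> l \<alpha> * norm (\<xi> \<alpha>)"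
    using assms sublinear_boundedD(4)[OF sublinear_familyD(1)[OF q assms(3)], of "\<xi> \<alpha>"]
    by (fastforce simp: measurable_minorants_def intro: order_trans)
  then have "norm (\<xi> \<alpha>) * norm (\<xi> \<alpha>) \<le> l \<alpha> * norm (\<xi> \<alpha>)"
    by (simp add: power2_norm_eq_inner[symmetric] power2_eq_square)
  then show ?thesis
    using sublinear_boundedD(1)[OF sublinear_familyD(1)[OF q assms(3)]]
    by (cases "norm (\<xi> \<alpha>) = 0") (auto simp: mult_le_cancel_right)
qed

text \<open>The difference quotients are dominated by \<open>l \<alpha> * norm d\<close>, so the
  limit h to 0 may be taken under the integral. This is used twice: to pass to a face in the
  disintegration, and to linearise the inequalities that describe \<open>F\<close>.\<close>

lemma integral_dir_deriv_ge:
  fixes q :: "'b \<Rightarrow> 'a::euclidean_space \<Rightarrow> real"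
  assumes f: "\<And>\<alpha>. \<alpha> \<in> space M \<Longrightarrow> convex_on UNIV (f \<alpha>)"
    "\<And>\<alpha>. \<alpha> \<in> space M \<Longrightarrow> lipschitz_on (l \<alpha>) UNIV (f \<alpha>)"
    "\<And>y. (\<lambda>\<alpha>. f \<alpha> y) \<in> borel_measurable M"
    and w: "w \<in> borel_measurable M" "\<And>\<alpha>. \<alpha> \<in> space M \<Longrightarrow> 0 \<le> w \<alpha>"
    and wl: "integrable M (\<lambda>\<alpha>. w \<alpha> * l \<alpha>)"
    and le: "\<And>h. 0 < h \<Longrightarrow> c * h \<le> (\<integral>\<alpha>. w \<alpha> * (f \<alpha> (x + h *\<^sub>R d) - f \<alpha> x) \<partial>M)"
  shows "c \<le> (\<integral>\<alpha>. w \<alpha> * dir_deriv (f \<alpha>) x d \<partial>M)"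
proof -
  define h where "h n = inverse (real (Suc n))" for n
  have h: "h n > 0" for n by (simp add: h_def)
  have "(\<lambda>n. \<integral>\<alpha>. w \<alpha> * ((f \<alpha> (x + h n *\<^sub>R d) - f \<alpha> x) / h n) \<partial>M)
      \<longlonglongrightarrow> (\<integral>\<alpha>. w \<alpha> * dir_deriv (f \<alpha>) x d \<partial>M)"
  proof (rule integral_dominated_convergence)
    show "(\<lambda>\<alpha>. w \<alpha> * dir_deriv (f \<alpha>) x d) \<in> borel_measurable M"
      using w sublinear_familyD(2)[OF sublinear_family_dir_deriv_convex[where f=f and l=l, OF f]] by measurable
    show "(\<lambda>\<alpha>. w \<alpha> * ((f \<alpha> (x + h n *\<^sub>R d) - f \<alpha> x) / h n)) \<in> borel_measurable M" for n
      using w f(3) by measurable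
    show "integrable M (\<lambda>\<alpha>. w \<alpha> * l \<alpha> * norm d)" using wl by simp
    show "AE \<alpha> in M. (\<lambda>n. w \<alpha> * ((f \<alpha> (x + h n *\<^sub>R d) - f \<alpha> x) / h n)) \<longlonglongrightarrow> w \<alpha> * dir_deriv (f \<alpha>) x d"
      unfolding h_def using f by (intro AE_I2 tendsto_mult_left dir_deriv_LIMSEQ) auto
    fix n
    show "AE \<alpha> in M. norm (w \<alpha> * ((f \<alpha> (x + h n *\<^sub>R d) - f \<alpha> x) / h n)) \<le> w \<alpha> * l \<alpha> * norm d"
    proof (rule AE_I2)
      fix \<alpha> assume \<alpha>: "\<alpha> \<in> space M"
      show "norm (w \<alpha> * ((f \<alpha> (x + h n *\<^sub>R d) - f \<alpha> x) / h n)) \<le> w \<alpha> * l \<alpha> * norm d"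
        using mult_left_mono[OF diff_quot_bound[OF f(1)[OF \<alpha>] f(2)[OF \<alpha>] h[of n], of x d] w(2)[OF \<alpha>]] w(2)[OF \<alpha>]
        by (simp add: abs_mult mult.assoc)
    qed
  qed
  moreover have "c \<le> (\<integral>\<alpha>. w \<alpha> * ((f \<alpha> (x + h n *\<^sub>R d) - f \<alpha> x) / h n) \<partial>M)" for n
    using le[OF h, of n] h[of n] by (simp add: pos_le_divide_eq)
  ultimately show ?thesis by (intro LIMSEQ_le_const) auto
qed

text \<open>Strassen-type disintegration: a linear minorant of an integral of sublinear functions is an
  integral of linear minorants. The set of such integrals is convex but not obviously closed, so
  one argues by faces: a point outside is separated in a direction \<open>p\<close> along which the
  family is not yet linear, and the directional derivatives at \<open>p\<close> have a larger lineality
  space.\<close>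

lemma linear_minorant_of_integral:
  fixes q :: "'b \<Rightarrow> 'a::euclidean_space \<Rightarrow> real"
  assumes w: "w \<in> borel_measurable M" "\<And>\<alpha>. \<alpha> \<in> space M \<Longrightarrow> 0 \<le> w \<alpha>"
    and wl: "integrable M (\<lambda>\<alpha>. w \<alpha> * l \<alpha>)"
    and "sublinear_family M l q"
    and "\<And>d. v \<bullet> d \<le> (\<integral>\<alpha>. w \<alpha> * q \<alpha> d \<partial>M)"
  shows "\<exists>\<xi>\<in>measurable_minorants M q. v = (\<integral>\<alpha>. w \<alpha> *\<^sub>R \<xi> \<alpha> \<partial>M)"
  using assms(4,5)
proof (induction "DIM('a) - dim (lineality M q)" arbitrary: q rule: less_induct)
  case (less q)
  \<comment> \<open>The induction runs over the codimension of the lineality space. No base case is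
    needed: if that space is everything, the direction \<open>p\<close> found below cannot
    exist.\<close>
  note q = less.prems(1) and v = less.prems(2)
  define I where "I \<xi> = (\<integral>\<alpha>. w \<alpha> *\<^sub>R \<xi> \<alpha> \<partial>M)" for \<xi> :: "'b \<Rightarrow> 'a"
  have int: "integrable M (\<lambda>\<alpha>. w \<alpha> *\<^sub>R \<xi> \<alpha>)" if "\<xi> \<in> measurable_minorants M q'" "sublinear_family M l q'" for \<xi> q'
  proof (rule Bochner_Integration.integrable_bound[OF wl])
    show "(\<lambda>\<alpha>. w \<alpha> *\<^sub>R \<xi> \<alpha>) \<in> borel_measurable M"
      using w that by (auto simp: measurable_minorants_def)
    show "AE \<alpha> in M. norm (w \<alpha> *\<^sub>R \<xi> \<alpha>) \<le> norm (w \<alpha> * l \<alpha>)"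
    proof (rule AE_I2)
      fix \<alpha> assume "\<alpha> \<in> space M"
      then show "norm (w \<alpha> *\<^sub>R \<xi> \<alpha>) \<le> norm (w \<alpha> * l \<alpha>)"
        using measurable_minorants_bound[OF that(2,1)] w(2)[of \<alpha>]
        by (fastforce simp: abs_mult intro!: mult_left_mono intro: order_trans)
    qed
  qed
  have intq: "integrable M (\<lambda>\<alpha>. w \<alpha> * q' \<alpha> d)" if "sublinear_family M l q'" for q' d
  proof (rule Bochner_Integration.integrable_bound)
    show "integrable M (\<lambda>\<alpha>. w \<alpha> * l \<alpha> * norm d)" using wl by simp
    show "(\<lambda>\<alpha>. w \<alpha> * q' \<alpha> d) \<in> borel_measurable M" using w sublinear_familyD(2)[OF that] by measurable
    show "AE \<alpha> in M. norm (w \<alpha> * q' \<alpha> d) \<le> norm (w \<alpha> * l \<alpha> * norm d)"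
    proof (rule AE_I2)
      fix \<alpha> assume \<alpha>: "\<alpha> \<in> space M"
      show "norm (w \<alpha> * q' \<alpha> d) \<le> norm (w \<alpha> * l \<alpha> * norm d)"
        using mult_left_mono[OF sublinear_boundedD(4)[OF sublinear_familyD(1)[OF that \<alpha>], of d] w(2)[OF \<alpha>]] w(2)[OF \<alpha>]
          sublinear_boundedD(1)[OF sublinear_familyD(1)[OF that \<alpha>]]
        by (simp add: abs_mult mult.assoc)
    qed
  qed
  have Id: "I \<xi> \<bullet> d = (\<integral>\<alpha>. w \<alpha> * (\<xi> \<alpha> \<bullet> d) \<partial>M)" "integrable M (\<lambda>\<alpha>. w \<alpha> * (\<xi> \<alpha> \<bullet> d))"
    if "\<xi> \<in> measurable_minorants M q'" "sublinear_family M l q'" for \<xi> q' d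
    using integral_inner_left[OF int[OF that], of d] integrable_inner_left[OF int[OF that], of d]
    by (auto simp: I_def)
  have I_le: "I \<xi> \<bullet> d \<le> (\<integral>\<alpha>. w \<alpha> * q' \<alpha> d \<partial>M)"
    if "\<xi> \<in> measurable_minorants M q'" "sublinear_family M l q'" for \<xi> q' d
    unfolding Id(1)[OF that] using that w(2)
    by (intro integral_mono Id(2)[OF that] intq mult_left_mono) (auto simp: measurable_minorants_def)
  define S where "S = I ` measurable_minorants M q"
  show ?case
  proof (rule ccontr)
    assume "\<not> ?case"
    then have vS: "v \<notin> S" by (auto simp: S_def I_def)
    have "convex S"
    proof (rule convexI)
      fix x y and a b :: real
      assume "x \<in> S" "y \<in> S" and ab: "0 \<le> a" "0 \<le> b" "a + b = 1"
      then obtain \<xi> \<eta> where \<xi>: "\<xi> \<in> measurable_minorants M q" "x = I \<xi>"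
        and \<eta>: "\<eta> \<in> measurable_minorants M q" "y = I \<eta>" by (auto simp: S_def)
      have "(\<lambda>\<alpha>. a *\<^sub>R \<xi> \<alpha> + b *\<^sub>R \<eta> \<alpha>) \<in> measurable_minorants M q"
      proof -
        have "a * (\<xi> \<alpha> \<bullet> d) + b * (\<eta> \<alpha> \<bullet> d) \<le> q \<alpha> d" if "\<alpha> \<in> space M" for \<alpha> d
          using \<xi>(1) \<eta>(1) that ab by (intro convex_bound_le) (auto simp: measurable_minorants_def)
        then show ?thesis using \<xi>(1) \<eta>(1)
          by (auto simp: measurable_minorants_def inner_add_left)
      qed
      moreover have "I (\<lambda>\<alpha>. a *\<^sub>R \<xi> \<alpha> + b *\<^sub>R \<eta> \<alpha>) = a *\<^sub>R x + b *\<^sub>R y"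
      proof -
        have "I (\<lambda>\<alpha>. a *\<^sub>R \<xi> \<alpha> + b *\<^sub>R \<eta> \<alpha>) = (\<integral>\<alpha>. a *\<^sub>R (w \<alpha> *\<^sub>R \<xi> \<alpha>) + b *\<^sub>R (w \<alpha> *\<^sub>R \<eta> \<alpha>) \<partial>M)"
          unfolding I_def by (intro Bochner_Integration.integral_cong) (auto simp: algebra_simps)
        also have "\<dots> = a *\<^sub>R x + b *\<^sub>R y"
          using int[OF \<xi>(1) q] int[OF \<eta>(1) q] by (simp add: \<xi>(2) \<eta>(2) I_def del: scaleR_scaleR)
        finally show ?thesis .
      qed
      ultimately show "a *\<^sub>R x + b *\<^sub>R y \<in> S" unfolding S_def by (intro rev_image_eqI) auto
    qed
    have "convex ((\<lambda>s. s - v) ` S)"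
      using \<open>convex S\<close> convex_translation_subtract by blast
    moreover have "(\<lambda>s. s - v) ` S \<noteq> {}" using measurable_minorants_nonempty[OF q] by (simp add: S_def)
    moreover have "0 \<notin> (\<lambda>s. s - v) ` S" using vS by auto
    \<comment> \<open>Weak separation would be useless if S - v were contained in the separating
      hyperplane. Taking \<open>a\<close> in the span of S - v excludes this, and it is what shows
      that \<open>p\<close> is a new direction.\<close>
    ultimately obtain a where a: "a \<in> span ((\<lambda>s. s - v) ` S)" "a \<noteq> 0"
      and a': "\<And>x. x \<in> (\<lambda>s. s - v) ` S \<Longrightarrow> 0 \<le> a \<bullet> x"
      by (rule separating_hyperplane_set_0_inspan) blast
    have a3: "0 \<le> a \<bullet> (s - v)" if "s \<in> S" for s using a' that by blast
    define p where "p = - a"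
    \<comment> \<open>Along a lineality direction the bounds for d and - d are opposite numbers, so
      v and all elements of S have the same inner product with d.\<close>
    have orth: "(s - v) \<bullet> d = 0" if "s \<in> S" "d \<in> lineality M q" for s d
    proof -
      obtain \<xi> where \<xi>: "\<xi> \<in> measurable_minorants M q" "s = I \<xi>"
        using \<open>s \<in> S\<close> by (auto simp: S_def)
      have neg: "(\<integral>\<alpha>. w \<alpha> * q \<alpha> (- d) \<partial>M) = - (\<integral>\<alpha>. w \<alpha> * q \<alpha> d \<partial>M)"
        using that(2) by (subst integral_minus[symmetric], intro Bochner_Integration.integral_cong) (auto simp: lineality_def)
      show ?thesis
        using v[of d] v[of "-d"] I_le[OF \<xi>(1) q, of d] I_le[OF \<xi>(1) q, of "-d"] neg
        by (simp add: \<xi>(2) inner_diff_left)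
    qed
    have "p \<notin> lineality M q"
    proof
      assume p: "p \<in> lineality M q"
      have "orthogonal p a"
      proof (rule orthogonal_to_span[OF a(1)])
        fix y assume "y \<in> (\<lambda>s. s - v) ` S"
        then show "orthogonal p y" using orth[OF _ p] by (auto simp: orthogonal_def inner_commute)
      qed
      then show False using a(2) by (simp add: orthogonal_def p_def)
    qed
    define q' where "q' \<alpha> = dir_deriv (q \<alpha>) p" for \<alpha>
    have q': "sublinear_family M l q'" unfolding q'_def by (rule sublinear_family_dir_deriv[OF q])
    have sub: "measurable_minorants M q' \<subseteq> measurable_minorants M q"
      using sublinear_dir_deriv_le[OF sublinear_familyD(1)[OF q], of _ p]
      unfolding measurable_minorants_def q'_def by auto (meson order_trans)
    have ins: "insert p (lineality M q) \<subseteq> lineality M q'" unfolding q'_def by (rule lineality_dir_deriv[OF q])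
    have "span (lineality M q) = lineality M q"
      using subspace_family_lineality[OF q] by (rule span_eq_iff[THEN iffD2])
    then have "p \<notin> span (lineality M q)" using \<open>p \<notin> lineality M q\<close> by (simp only:) simp
    then have "dim (lineality M q) < dim (insert p (lineality M q))" by (simp add: dim_insert)
    also have "\<dots> \<le> dim (lineality M q')" by (rule dim_subset[OF ins])
    finally have dim: "DIM('a) - dim (lineality M q') < DIM('a) - dim (lineality M q)"
      using dim_subset_UNIV[of "lineality M q'"] by linarith
    obtain \<eta> where \<eta>: "\<eta> \<in> measurable_minorants M q'"
      using measurable_minorants_nonempty[OF q'] by blast
    \<comment> \<open>A minorant of the derivatives at \<open>p\<close> attains \<open>q\<close> at
      \<open>p\<close>. Its integral belongs to S, so separation from one side and the assumption on
      v from the other force equality: v lies on the face exposed by \<open>p\<close>.\<close>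
    have "\<eta> \<alpha> \<bullet> p = q \<alpha> p" if \<alpha>: "\<alpha> \<in> space M" for \<alpha>
    proof -
      have "\<eta> \<alpha> \<bullet> p \<le> q' \<alpha> p" "\<eta> \<alpha> \<bullet> (- p) \<le> q' \<alpha> (- p)"
        using \<eta> \<alpha> unfolding measurable_minorants_def by blast+
      then show ?thesis
        using sublinear_dir_deriv_self[OF sublinear_familyD(1)[OF q \<alpha>], of p] by (simp add: q'_def)
    qed
    then have "I \<eta> \<bullet> p = (\<integral>\<alpha>. w \<alpha> * q \<alpha> p \<partial>M)"
      unfolding Id(1)[OF \<eta> q'] by (intro Bochner_Integration.integral_cong) auto
    moreover have "I \<eta> \<in> S" using \<eta> sub by (auto simp: S_def)
    ultimately have vp: "v \<bullet> p = (\<integral>\<alpha>. w \<alpha> * q \<alpha> p \<partial>M)"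
      using a3[of "I \<eta>"] v[of p] by (simp add: p_def inner_diff_right inner_commute)
    \<comment> \<open>Because equality holds at \<open>p\<close>, the assumed inequality may be
      differentiated there, which is the induction hypothesis' premise for
      \<open>q'\<close>.\<close>
    have "v \<bullet> d \<le> (\<integral>\<alpha>. w \<alpha> * q' \<alpha> d \<partial>M)" for d
      unfolding q'_def
    proof (rule integral_dir_deriv_ge[OF _ _ _ w wl])
      fix h :: real assume "0 < h"
      have "(v \<bullet> d) * h = v \<bullet> (p + h *\<^sub>R d) - v \<bullet> p" by (simp add: inner_add_right)
      also have "\<dots> \<le> (\<integral>\<alpha>. w \<alpha> * q \<alpha> (p + h *\<^sub>R d) \<partial>M) - (\<integral>\<alpha>. w \<alpha> * q \<alpha> p \<partial>M)"
        using v[of "p + h *\<^sub>R d"] vp by simp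
      also have "\<dots> = (\<integral>\<alpha>. w \<alpha> * (q \<alpha> (p + h *\<^sub>R d) - q \<alpha> p) \<partial>M)"
        using intq[OF q] by (simp add: right_diff_distrib)
      finally show "(v \<bullet> d) * h \<le> (\<integral>\<alpha>. w \<alpha> * (q \<alpha> (p + h *\<^sub>R d) - q \<alpha> p) \<partial>M)" .
    qed (use sublinear_familyD[OF q] in \<open>auto intro: sublinear_bounded_convex sublinear_bounded_lipschitz\<close>)
    from less.hyps[OF dim q' this] obtain \<xi> where "\<xi> \<in> measurable_minorants M q'" "v = I \<xi>"
      by (auto simp: I_def)
    then show False using vS sub by (auto simp: S_def)
  qed
qed

section \<open>One-sided Lipschitz differential inclusions\<close>

lemma AE_lebesgue_on_iff_negligible:
  fixes S :: "'a::euclidean_space set"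
  assumes S: "S \<in> sets lebesgue"
  shows "(AE t in lebesgue_on S. P t) \<longleftrightarrow> (\<exists>N. negligible N \<and> (\<forall>t\<in>S - N. P t))"
proof -
  have "(AE t in lebesgue_on S. P t) \<longleftrightarrow> (AE t in lebesgue. t \<in> S \<longrightarrow> P t)"
    using S by (intro AE_restrict_space_iff) auto
  also have "\<dots> \<longleftrightarrow> (\<exists>N. negligible N \<and> (\<forall>t\<in>S - N. P t))"
    unfolding eventually_ae_filter negligible_iff_null_sets by auto
  finally show ?thesis .
qed

lemma abs_continuous_on_diff:
  fixes f g :: "real \<Rightarrow> 'a::real_normed_vector"
  assumes f: "abs_continuous_on S f" and g: "abs_continuous_on S g"
  shows "abs_continuous_on S (\<lambda>t. f t - g t)"
  unfolding abs_continuous_on_def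
proof (intro allI impI)
  fix e :: real assume "e > 0"
  obtain d1 where d1: "d1 > 0" "\<And>\<D>. \<D> division_of \<Union>\<D> \<Longrightarrow> \<Union>\<D> \<subseteq> S \<Longrightarrow> (\<Sum>I\<in>\<D>. Sup I - Inf I) < d1
     \<Longrightarrow> (\<Sum>I\<in>\<D>. norm (f (Sup I) - f (Inf I))) < e / 2"
    using f[unfolded abs_continuous_on_def, rule_format, of "e / 2"] \<open>e > 0\<close> by auto
  obtain d2 where d2: "d2 > 0" "\<And>\<D>. \<D> division_of \<Union>\<D> \<Longrightarrow> \<Union>\<D> \<subseteq> S \<Longrightarrow> (\<Sum>I\<in>\<D>. Sup I - Inf I) < d2
     \<Longrightarrow> (\<Sum>I\<in>\<D>. norm (g (Sup I) - g (Inf I))) < e / 2"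
    using g[unfolded abs_continuous_on_def, rule_format, of "e / 2"] \<open>e > 0\<close> by auto
  show "\<exists>\<delta>>0. \<forall>\<D>. \<D> division_of \<Union>\<D> \<and> \<Union>\<D> \<subseteq> S \<and> (\<Sum>I\<in>\<D>. Sup I - Inf I) < \<delta>
        \<longrightarrow> (\<Sum>I\<in>\<D>. norm (f (Sup I) - g (Sup I) - (f (Inf I) - g (Inf I)))) < e"
  proof (intro exI[of _ "min d1 d2"] conjI allI impI; (elim conjE)?)
    fix \<D> :: "real set set"
    assume D: "\<D> division_of \<Union>\<D>" "\<Union>\<D> \<subseteq> S" "(\<Sum>I\<in>\<D>. Sup I - Inf I) < min d1 d2"
    have "(\<Sum>I\<in>\<D>. norm (f (Sup I) - g (Sup I) - (f (Inf I) - g (Inf I))))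
        \<le> (\<Sum>I\<in>\<D>. norm (f (Sup I) - f (Inf I)) + norm (g (Sup I) - g (Inf I)))"
    proof (rule sum_mono)
      fix I
      have "f (Sup I) - g (Sup I) - (f (Inf I) - g (Inf I)) = (f (Sup I) - f (Inf I)) - (g (Sup I) - g (Inf I))"
        by simp
      then show "norm (f (Sup I) - g (Sup I) - (f (Inf I) - g (Inf I)))
          \<le> norm (f (Sup I) - f (Inf I)) + norm (g (Sup I) - g (Inf I))"
        by (simp only: norm_triangle_ineq4)
    qed
    also have "\<dots> < e" using d1(2)[OF D(1,2)] d2(2)[OF D(1,2)] D(3) by (simp add: sum.distrib)
    finally show "(\<Sum>I\<in>\<D>. norm (f (Sup I) - g (Sup I) - (f (Inf I) - g (Inf I)))) < e" .
  qed (use d1 d2 in simp)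
qed

lemma abs_continuous_on_inner_self:
  fixes f :: "real \<Rightarrow> 'a::real_inner"
  assumes f: "abs_continuous_on {a..b} f"
  shows "abs_continuous_on {a..b} (\<lambda>t. f t \<bullet> f t)"
proof -
  have "compact (f ` {a..b})"
    using abs_continuous_on_imp_continuous_on[OF f] by (intro compact_continuous_image) auto
  then have "bounded (f ` {a..b})" by (rule compact_imp_bounded)
  then obtain B where "\<forall>y\<in>f ` {a..b}. norm y \<le> B" unfolding bounded_iff ..
  then have B: "norm (f t) \<le> B" if "t \<in> {a..b}" for t using that by simp
  show ?thesis
  proof (rule abs_continuous_on_transfer[OF f, where K = "2 * B"])
    fix r s assume rs: "r \<in> {a..b}" "s \<in> {a..b}"
    have "0 \<le> B" using B[OF rs(1)] norm_ge_zero order_trans by blast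
    have "f s \<bullet> f s - f r \<bullet> f r = (f s + f r) \<bullet> (f s - f r)"
      by (simp add: inner_add_left inner_diff_right inner_commute[of "f r" "f s"])
    then have "\<bar>f s \<bullet> f s - f r \<bullet> f r\<bar> \<le> norm (f s + f r) * norm (f s - f r)"
      by (simp only: Cauchy_Schwarz_ineq2)
    also have "\<dots> \<le> (2 * B) * norm (f s - f r)"
      using B[OF rs(1)] B[OF rs(2)] norm_triangle_ineq[of "f s" "f r"] by (intro mult_right_mono) auto
    also have "\<dots> \<le> (2 * B) * (norm (f s - f r) + \<bar>s - r\<bar>)"
      using \<open>0 \<le> B\<close> by (intro mult_left_mono) auto
    finally show "norm (f s \<bullet> f s - f r \<bullet> f r) \<le> (2 * B) * (norm (f s - f r) + \<bar>s - r\<bar>)" by simp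
  qed
qed

lemma has_vector_derivative_inner_self:
  fixes f :: "real \<Rightarrow> 'a::real_inner"
  assumes "(f has_vector_derivative v) (at t within S)"
  shows "((\<lambda>s. f s \<bullet> f s) has_vector_derivative 2 * (f t \<bullet> v)) (at t within S)"
  using has_derivative_inner[OF assms[unfolded has_vector_derivative_def] assms[unfolded has_vector_derivative_def]]
  by (simp add: has_vector_derivative_def inner_commute algebra_simps)

text \<open>Extension by 0 to the left of \<open>t0\<close> gives integrability on every interval,
  the form in which the differentiation of indefinite integrals asks for it.\<close>

lemma integrable_on_Icc_locally_bounded:
  fixes f :: "real \<Rightarrow> 'a::euclidean_space"
  assumes f: "f \<in> borel_measurable (lebesgue_on {t0..})"
    and bd: "\<And>T. \<exists>K. \<forall>t\<in>{t0..T}. norm (f t) \<le> K"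
  shows "(\<lambda>t. if t0 \<le> t then f t else 0) integrable_on {a..b}"
proof -
  obtain K where K: "\<forall>t\<in>{t0..b}. norm (f t) \<le> K" using bd by blast
  have "(\<lambda>t. if t \<in> {t0..} then f t else 0) \<in> borel_measurable lebesgue"
    using f by (intro borel_measurable_if_I) auto
  then have m: "(\<lambda>t. if t0 \<le> t then f t else 0) \<in> borel_measurable (lebesgue_on {a..b})"
    by (simp add: measurable_restrict_space1)
  show ?thesis
  proof (rule measurable_bounded_by_integrable_imp_integrable[OF m, where g = "\<lambda>_. \<bar>K\<bar>"])
    fix t assume "t \<in> {a..b}"
    then show "norm (if t0 \<le> t then f t else 0) \<le> \<bar>K\<bar>" using K by force
  qed auto
qed

lemma indefinite_integral_lipschitz:
  fixes f :: "real \<Rightarrow> 'a::euclidean_space"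
  assumes f: "\<And>a b. f integrable_on {a..b}" and bd: "\<And>t. t \<in> {a..b} \<Longrightarrow> norm (f t) \<le> K"
    and rs: "r \<in> {a..b}" "s \<in> {a..b}"
  shows "norm (integral {a..s} f - integral {a..r} f) \<le> K * \<bar>s - r\<bar>"
proof -
  have *: "norm (integral {a..s} f - integral {a..r} f) \<le> K * (s - r)"
    if "r \<le> s" "r \<in> {a..b}" "s \<in> {a..b}" for r s
  proof -
    have "integral {a..r} f + integral {r..s} f = integral {a..s} f"
      using that f by (intro Henstock_Kurzweil_Integration.integral_combine) auto
    then have "integral {a..s} f - integral {a..r} f = integral {r..s} f" by (simp add: algebra_simps)
    moreover have "norm (integral {r..s} f) \<le> integral {r..s} (\<lambda>_. K)"
      using f that bd by (intro integral_norm_bound_integral) auto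
    ultimately show ?thesis using that by (simp add: mult.commute)
  qed
  show ?thesis
  proof (cases "r \<le> s")
    case True
    then show ?thesis using *[of r s] rs by simp
  next
    case False
    then show ?thesis using *[of s r] rs by (simp add: norm_minus_commute)
  qed
qed

text \<open>\<open>R\<close> encodes the right-hand side by linear inequalities (see \<open>rhs\<close>); the hypothesis on
  \<open>R t x y + R t y x\<close> is a one-sided Lipschitz condition.\<close>

locale one_sided_inclusion =
  fixes t0 :: real and x0 :: "'a::euclidean_space"
    and s :: "real \<Rightarrow> 'a \<Rightarrow> 'a" and R :: "real \<Rightarrow> 'a \<Rightarrow> 'a \<Rightarrow> real" and c :: real
  assumes c: "0 \<le> c"
    and s_meas: "\<And>z. (\<lambda>t. s t z) \<in> borel_measurable (lebesgue_on {t0..})"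
    and s_sel: "\<And>t y z. t0 \<le> t \<Longrightarrow> s t z \<bullet> (z - y) \<le> R t z y"
    and s_bound: "\<And>t z. t0 \<le> t \<Longrightarrow> norm (s t z) \<le> c * (1 + norm z)"
    and R_meas: "\<And>z y. z \<in> borel_measurable (lebesgue_on {t0..}) \<Longrightarrow>
        (\<lambda>t. R t (z t) y) \<in> borel_measurable (lebesgue_on {t0..})"
    and R_cont1: "\<And>t y. t0 \<le> t \<Longrightarrow> continuous_on UNIV (\<lambda>z. R t z y)"
    and R_cont2: "\<And>t z. t0 \<le> t \<Longrightarrow> continuous_on UNIV (\<lambda>y. R t z y)"
    and R_bound: "\<And>t y z. t0 \<le> t \<Longrightarrow> \<bar>R t z y\<bar> \<le> c * (1 + norm z) * norm (y - z)"
    and R_mono: "\<And>T B. \<exists>C\<ge>0. \<forall>t\<in>{t0..T}. \<forall>x y. norm x \<le> B \<longrightarrow> norm y \<le> B \<longrightarrow>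
        R t x y + R t y x \<le> C * (norm (x - y))\<^sup>2"
begin

definition rhs :: "real \<Rightarrow> 'a \<Rightarrow> 'a set" where
  "rhs t x = {v. \<forall>y. v \<bullet> (x - y) \<le> R t x y}"

lemma rhs_one_sided:
  assumes "v \<in> rhs t x" "w \<in> rhs t y"
  shows "(v - w) \<bullet> (x - y) \<le> R t x y + R t y x"
proof -
  have "v \<bullet> (x - y) \<le> R t x y" "w \<bullet> (y - x) \<le> R t y x" using assms by (auto simp: rhs_def)
  then show ?thesis by (simp add: inner_diff_left inner_diff_right)
qed

lemma solution_unique:
  assumes x: "solves_inclusion rhs t0 x0 x" and y: "solves_inclusion rhs t0 x0 y" and T: "t0 \<le> T"
  shows "x T = y T"
proof -
  have ac: "abs_continuous_on {t0..T} x" "abs_continuous_on {t0..T} y"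
    using x y T by (auto simp: solves_inclusion_def loc_abs_continuous_on_def)
  have "compact (x ` {t0..T} \<union> y ` {t0..T})"
    using ac by (intro compact_Un compact_continuous_image abs_continuous_on_imp_continuous_on) auto
  then have "bounded (x ` {t0..T} \<union> y ` {t0..T})" by (rule compact_imp_bounded)
  then obtain B where "\<forall>z\<in>x ` {t0..T} \<union> y ` {t0..T}. norm z \<le> B" unfolding bounded_iff ..
  then have B: "norm (x t) \<le> B" "norm (y t) \<le> B" if "t \<in> {t0..T}" for t using that by auto
  obtain C where C: "C \<ge> 0" "\<forall>t\<in>{t0..T}. \<forall>x y. norm x \<le> B \<longrightarrow> norm y \<le> B \<longrightarrow>
        R t x y + R t y x \<le> C * (norm (x - y))\<^sup>2"
    using R_mono by meson
  obtain N1 where N1: "negligible N1" "\<forall>t\<in>{t0..} - N1. \<exists>v. (x has_vector_derivative v) (at t within {t0..}) \<and> v \<in> rhs t (x t)"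
    using x by (auto simp: solves_inclusion_def AE_lebesgue_on_iff_negligible)
  obtain N2 where N2: "negligible N2" "\<forall>t\<in>{t0..} - N2. \<exists>v. (y has_vector_derivative v) (at t within {t0..}) \<and> v \<in> rhs t (y t)"
    using y by (auto simp: solves_inclusion_def AE_lebesgue_on_iff_negligible)
  define f where "f t = (x t - y t) \<bullet> (x t - y t)" for t
  \<comment> \<open>One constant C serves along both solutions since both stay in the ball of radius
    B. The additive term is 0, so equal initial values leave no positive bound.\<close>
  have "f T \<le> 0 * (T - t0) * exp (2 * C * (T - t0))"
  proof (rule abs_continuous_gronwall[OF T])
    show "abs_continuous_on {t0..T} f"
      unfolding f_def by (intro abs_continuous_on_inner_self abs_continuous_on_diff ac)
    show "negligible (N1 \<union> N2)" using N1 N2 by simp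
    show "f t0 \<le> 0" using x y by (simp add: f_def solves_inclusion_def)
    fix t assume t: "t \<in> {t0..T} - (N1 \<union> N2)"
    then obtain v w where v: "(x has_vector_derivative v) (at t within {t0..})" "v \<in> rhs t (x t)"
      and w: "(y has_vector_derivative w) (at t within {t0..})" "w \<in> rhs t (y t)"
      using N1(2) N2(2) by fastforce
    have "((\<lambda>t. x t - y t) has_vector_derivative v - w) (at t within {t0..T})"
      using v(1) w(1) by (intro has_vector_derivative_diff) (auto intro: has_vector_derivative_within_subset)
    then have "(f has_vector_derivative 2 * ((x t - y t) \<bullet> (v - w))) (at t within {t0..T})"
      unfolding f_def by (rule has_vector_derivative_inner_self)
    moreover have "2 * ((x t - y t) \<bullet> (v - w)) \<le> 2 * C * f t + 0"
      using rhs_one_sided[OF v(2) w(2)] C(2) B[of t] t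
      by (fastforce simp: f_def inner_commute power2_norm_eq_inner)
    ultimately show "\<exists>D\<le>2 * C * f t + 0. (f has_vector_derivative D) (at t within {t0..T})" by blast
  qed (use C in auto)
  then have "f T = 0" using inner_ge_zero[of "x T - y T"] by (simp add: f_def)
  then show ?thesis by (simp add: f_def)
qed

text \<open>Euler polygons with step \<open>h\<close>; the control enters only through measurability, so the increment
  over a step is an integral of the selection with frozen state.\<close>

primrec euler :: "real \<Rightarrow> nat \<Rightarrow> 'a" where
  "euler h 0 = x0"
| "euler h (Suc i) = euler h i + integral {t0 + real i * h..t0 + real (Suc i) * h} (\<lambda>t. s t (euler h i))"

section \<open>Euler polygons and their a priori bounds\<close>

definition idx :: "real \<Rightarrow> real \<Rightarrow> nat" where "idx h t = nat \<lfloor>(t - t0) / h\<rfloor>"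
definition frozen :: "real \<Rightarrow> real \<Rightarrow> 'a" where "frozen h t = euler h (idx h t)"
definition velocity :: "real \<Rightarrow> real \<Rightarrow> 'a" where
  "velocity h t = (if t0 \<le> t then s t (frozen h t) else 0)"
definition polygon :: "real \<Rightarrow> real \<Rightarrow> 'a" where "polygon h t = x0 + integral {t0..t} (velocity h)"

text \<open>Linear growth multiplies \<open>1 + norm x\<close> by at most \<open>1 + c * h\<close>
  in one Euler step. The exponential dominates the resulting power uniformly in h.\<close>

definition radius :: "real \<Rightarrow> real" where "radius T = exp (c * (T - t0)) * (1 + norm x0)"

lemma radius_mono: "S \<le> T \<Longrightarrow> radius S \<le> radius T"
  unfolding radius_def using c by (intro mult_right_mono) (auto intro: mult_left_mono)

lemma radius_pos: "0 < radius T" unfolding radius_def by (intro mult_pos_pos) (auto simp: add_pos_nonneg)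

lemma idx_bounds:
  fixes h :: real
  assumes "0 < h" "t0 \<le> t"
  shows "t0 + idx h t * h \<le> t" "t < t0 + (idx h t + 1) * h"
proof -
  have "real (idx h t) = of_int \<lfloor>(t - t0) / h\<rfloor>" using assms by (simp add: idx_def)
  then have "real (idx h t) \<le> (t - t0) / h" "(t - t0) / h < real (idx h t) + 1" by linarith+
  then show "t0 + idx h t * h \<le> t" "t < t0 + (idx h t + 1) * h"
    using assms by (auto simp: field_simps)
qed

lemma idx_eq:
  fixes h :: real
  assumes "0 < h" "t0 + i * h \<le> t" "t < t0 + Suc i * h"
  shows "idx h t = i"
proof -
  have "real i \<le> (t - t0) / h" "(t - t0) / h < real i + 1" using assms by (auto simp: field_simps)
  then have "\<lfloor>(t - t0) / h\<rfloor> = int i" by (simp add: floor_eq_iff)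
  then show ?thesis by (simp add: idx_def)
qed

lemma euler_bound:
  fixes h :: real
  assumes h: "0 < h"
  shows "1 + norm (euler h i) \<le> radius (t0 + i * h)"
proof -
  have "1 + norm (euler h i) \<le> (1 + c * h) ^ i * (1 + norm x0)"
  proof (induction i)
    case (Suc i)
    let ?I = "{t0 + i * h..t0 + Suc i * h}"
    have ih: "0 \<le> i * h" using h by simp
    have ti: "t0 \<le> t" if "t \<in> ?I" for t
    proof -
      have "t0 + i * h \<le> t" using that by simp
      then show ?thesis using ih by linarith
    qed
    have m: "(\<lambda>t. s t (euler h i)) \<in> borel_measurable (lebesgue_on ?I)"
      by (rule measurable_restrict_mono[OF s_meas]) (use ti in blast)
    have int: "(\<lambda>t. s t (euler h i)) integrable_on ?I"
      by (rule measurable_bounded_by_integrable_imp_integrable[OF m, where g = "\<lambda>_. c * (1 + norm (euler h i))"])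
        (use ti s_bound in auto)
    have "norm (integral ?I (\<lambda>t. s t (euler h i))) \<le> integral ?I (\<lambda>_. c * (1 + norm (euler h i)))"
      by (intro integral_norm_bound_integral int) (use ti s_bound in auto)
    also have "\<dots> = h * (c * (1 + norm (euler h i)))"
      using h by (simp add: algebra_simps)
    finally have "1 + norm (euler h (Suc i)) \<le> (1 + c * h) * (1 + norm (euler h i))"
      using norm_triangle_ineq[of "euler h i" "integral ?I (\<lambda>t. s t (euler h i))"]
      by (simp add: algebra_simps)
    also have "\<dots> \<le> (1 + c * h) * ((1 + c * h) ^ i * (1 + norm x0))"
      using Suc c h by (intro mult_left_mono) auto
    finally show ?case by (simp add: mult.assoc)
  qed simp
  also have "\<dots> \<le> exp (c * h) ^ i * (1 + norm x0)"
    using c h by (intro mult_right_mono power_mono exp_ge_add_one_self) auto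
  also have "\<dots> = radius (t0 + i * h)" by (simp add: radius_def exp_of_nat_mult[symmetric] algebra_simps)
  finally show ?thesis .
qed

lemma frozen_bound:
  fixes h :: real
  assumes "0 < h" "t \<in> {t0..T}"
  shows "1 + norm (frozen h t) \<le> radius T"
  using euler_bound[OF assms(1), of "idx h t"] radius_mono[of "t0 + idx h t * h" T] idx_bounds[of h t] assms
  by (auto simp: frozen_def)

lemma velocity_bound:
  fixes h :: real
  assumes "0 < h" "t \<in> {t0..T}"
  shows "norm (velocity h t) \<le> c * radius T"
  using s_bound[of t "frozen h t"] mult_left_mono[OF frozen_bound[OF assms] c] assms
  by (auto simp: velocity_def)

lemma idx_measurable: "idx h \<in> measurable (lebesgue_on {t0..}) (count_space UNIV)"
proof -
  have "idx h \<in> measurable borel (count_space UNIV)"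
    unfolding idx_def by measurable
  then have "idx h \<in> measurable lebesgue (count_space UNIV)"
    by (intro measurable_completion) simp
  then show ?thesis by (rule measurable_restrict_space1)
qed

lemma frozen_measurable: "frozen h \<in> borel_measurable (lebesgue_on {t0..})"
  unfolding frozen_def by (rule measurable_compose[OF idx_measurable]) simp

lemma velocity_integrable:
  assumes "0 < h" shows "velocity h integrable_on {a..b}"
  unfolding velocity_def
proof (rule integrable_on_Icc_locally_bounded)
  show "(\<lambda>t. s t (frozen h t)) \<in> borel_measurable (lebesgue_on {t0..})"
    unfolding frozen_def
    by (rule measurable_compose_countable[OF s_meas idx_measurable])
  show "\<exists>K. \<forall>t\<in>{t0..T}. norm (s t (frozen h t)) \<le> K" for T
    using velocity_bound[OF assms, of _ T] unfolding velocity_def by (intro exI[of _ "c * radius T"]) auto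
qed

lemma polygon_lipschitz:
  assumes "0 < h" "r \<in> {t0..T}" "t \<in> {t0..T}"
  shows "norm (polygon h t - polygon h r) \<le> c * radius T * \<bar>t - r\<bar>"
  using indefinite_integral_lipschitz[OF velocity_integrable[OF assms(1)] velocity_bound[OF assms(1)] assms(2,3)]
  by (simp add: polygon_def)

lemma polygon_node:
  fixes h :: real
  assumes h: "0 < h"
  shows "polygon h (t0 + i * h) = euler h i"
proof (induction i)
  case (Suc i)
  have le: "t0 \<le> t0 + i * h" "t0 + i * h \<le> t0 + Suc i * h" using h by (auto simp: algebra_simps)
  have "integral {t0 + i * h..t0 + Suc i * h} (velocity h)
      = integral {t0 + i * h..t0 + Suc i * h} (\<lambda>t. s t (euler h i))"
  \<comment> \<open>At the right endpoint the index has already jumped to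
    \<open>Suc i\<close>.\<close>
  proof (rule integral_spike[of "{t0 + Suc i * h}"])
    fix t assume t: "t \<in> {t0 + i * h..t0 + Suc i * h} - {t0 + Suc i * h}"
    then have "idx h t = i" using h by (intro idx_eq) auto
    then show "s t (euler h i) = velocity h t" using t le(1) by (simp add: velocity_def frozen_def)
  qed auto
  moreover have "integral {t0..t0 + i * h} (velocity h) + integral {t0 + i * h..t0 + Suc i * h} (velocity h)
      = integral {t0..t0 + Suc i * h} (velocity h)"
    using le velocity_integrable[OF h] by (intro Henstock_Kurzweil_Integration.integral_combine) auto
  ultimately show ?case using Suc unfolding polygon_def euler.simps by (metis add.assoc)
qed (simp add: polygon_def)

lemma polygon_near_frozen:
  fixes h :: real
  assumes h: "0 < h" and t: "t \<in> {t0..T}"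
  shows "norm (polygon h t - frozen h t) \<le> c * radius T * h"
proof -
  have b: "t0 + idx h t * h \<le> t" "t < t0 + (idx h t + 1) * h" using idx_bounds[OF h] t by auto
  then have "t0 + idx h t * h \<in> {t0..T}" using t h by auto
  from polygon_lipschitz[OF h this t]
  have "norm (polygon h t - frozen h t) \<le> c * radius T * \<bar>t - (t0 + idx h t * h)\<bar>"
    by (simp add: polygon_node[OF h] frozen_def)
  also have "\<dots> \<le> c * radius T * h"
    using b c radius_pos[of T] by (intro mult_left_mono) (auto simp: algebra_simps)
  finally show ?thesis .
qed

lemma polygon_derivative:
  assumes h: "0 < h"
  obtains N where "negligible N"
    "\<And>t S. t \<notin> N \<Longrightarrow> t0 < t \<Longrightarrow> (polygon h has_vector_derivative velocity h t) (at t within S)"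
proof -
  obtain N where N: "negligible N" "\<And>a t. t \<notin> N \<Longrightarrow> a < t \<Longrightarrow>
      ((\<lambda>s. integral {a..s} (velocity h)) has_vector_derivative velocity h t) (at t)"
    using indefinite_integral_AE_vector_derivative[OF velocity_integrable[OF h]] by metis
  show thesis
  proof (rule that[OF N(1)])
    fix t S assume "t \<notin> N" "t0 < t"
    from has_vector_derivative_add[OF has_vector_derivative_const[of x0] N(2)[OF this]]
    show "(polygon h has_vector_derivative velocity h t) (at t within S)"
      unfolding polygon_def[abs_def] by (simp add: has_vector_derivative_at_within)
  qed
qed

section \<open>Cauchy property of the polygons and the limit curve\<close>

lemma velocity_in_rhs:
  assumes "t0 \<le> t" shows "velocity h t \<in> rhs t (frozen h t)"
  using s_sel assms by (simp add: rhs_def velocity_def)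

lemma polygon_abs_continuous:
  assumes "0 < h" shows "abs_continuous_on {t0..T} (polygon h)"
  by (rule lipschitz_imp_abs_continuous_on[OF polygon_lipschitz[OF assms]])

lemma polygon_cauchy_estimate:
  assumes T: "t0 \<le> T"
  obtains K where "0 \<le> K" "\<And>h k. 0 < h \<Longrightarrow> h \<le> 1 \<Longrightarrow> 0 < k \<Longrightarrow> k \<le> 1 \<Longrightarrow>
    (norm (polygon h T - polygon k T))\<^sup>2 \<le> K * (h + k)"
proof -
  obtain C where C: "C \<ge> 0" "\<forall>t\<in>{t0..T}. \<forall>x y. norm x \<le> radius T \<longrightarrow> norm y \<le> radius T \<longrightarrow>
        R t x y + R t y x \<le> C * (norm (x - y))\<^sup>2"
    using R_mono by meson
  define M where "M = c * radius T"
  have M: "0 \<le> M" using c radius_pos[of T] by (simp add: M_def)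
  \<comment> \<open>The first summand comes from replacing \<delta> by w in the one-sided term, with
    (a + b)^2 \<le> 2 a^2 + 2 b^2 and (h + k)^2 \<le> 2 (h + k) for steps up to 1; the second is
    twice the bound \<open>2 * M * (M * (h + k))\<close> of the mixed term.\<close>
  define K where "K = 8 * C * M\<^sup>2 + 4 * M\<^sup>2"
  show thesis
  proof (rule that[of "K * (T - t0) * exp (4 * C * (T - t0))"])
    show "0 \<le> K * (T - t0) * exp (4 * C * (T - t0))" using C(1) T by (simp add: K_def)
    fix h k :: real assume h: "0 < h" "h \<le> 1" and k: "0 < k" "k \<le> 1"
    define w where "w t = polygon h t - polygon k t" for t
    obtain N1 where N1: "negligible N1"
      "\<And>t S. t \<notin> N1 \<Longrightarrow> t0 < t \<Longrightarrow> (polygon h has_vector_derivative velocity h t) (at t within S)"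
      using polygon_derivative[OF h(1)] by metis
    obtain N2 where N2: "negligible N2"
      "\<And>t S. t \<notin> N2 \<Longrightarrow> t0 < t \<Longrightarrow> (polygon k has_vector_derivative velocity k t) (at t within S)"
      using polygon_derivative[OF k(1)] by metis
    have "w T \<bullet> w T \<le> (K * (h + k)) * (T - t0) * exp ((4 * C) * (T - t0))"
    proof (rule abs_continuous_gronwall[OF T, where f = "\<lambda>t. w t \<bullet> w t"])
      show "abs_continuous_on {t0..T} (\<lambda>t. w t \<bullet> w t)"
        unfolding w_def
        by (intro abs_continuous_on_inner_self abs_continuous_on_diff polygon_abs_continuous h k)
      show "negligible (N1 \<union> N2 \<union> {t0})" using N1 N2 by simp
      show "w t0 \<bullet> w t0 \<le> 0" by (simp add: w_def polygon_def)
      show "0 \<le> 4 * C" "0 \<le> K * (h + k)" using C h k by (auto simp: K_def)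
      fix t assume t: "t \<in> {t0..T} - (N1 \<union> N2 \<union> {t0})"
      then have t': "t \<in> {t0..T}" "t0 < t" by auto
      define \<delta> where "\<delta> = frozen h t - frozen k t"
      define u where "u = velocity h t - velocity k t"
      have "(w has_vector_derivative u) (at t within {t0..T})"
        unfolding w_def u_def using N1(2) N2(2) t t' by (intro has_vector_derivative_diff) auto
      then have der: "((\<lambda>t. w t \<bullet> w t) has_vector_derivative 2 * (w t \<bullet> u)) (at t within {t0..T})"
        by (rule has_vector_derivative_inner_self)
      have "u \<bullet> \<delta> \<le> R t (frozen h t) (frozen k t) + R t (frozen k t) (frozen h t)"
        unfolding u_def \<delta>_def using t' by (intro rhs_one_sided velocity_in_rhs) auto
      also have "\<dots> \<le> C * (norm \<delta>)\<^sup>2"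
      proof -
        have "norm (frozen h t) \<le> radius T" "norm (frozen k t) \<le> radius T"
          using frozen_bound[OF h(1) t'(1)] frozen_bound[OF k(1) t'(1)] by auto
        then show ?thesis using C(2) t'(1) unfolding \<delta>_def by blast
      qed
      finally have 1: "u \<bullet> \<delta> \<le> C * (norm \<delta>)\<^sup>2" .
      have w\<delta>: "norm (w t - \<delta>) \<le> M * (h + k)"
      proof -
        have "w t - \<delta> = (polygon h t - frozen h t) - (polygon k t - frozen k t)"
          by (simp add: w_def \<delta>_def)
        then have "norm (w t - \<delta>) \<le> norm (polygon h t - frozen h t) + norm (polygon k t - frozen k t)"
          by (simp only: norm_triangle_ineq4)
        then show ?thesis
          using polygon_near_frozen[OF h(1) t'(1)] polygon_near_frozen[OF k(1) t'(1)]
          by (simp add: M_def algebra_simps)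
      qed
      have "norm u \<le> 2 * M"
        using velocity_bound[OF h(1) t'(1)] velocity_bound[OF k(1) t'(1)]
          norm_triangle_ineq4[of "velocity h t" "velocity k t"] by (simp add: u_def M_def)
      then have "u \<bullet> (w t - \<delta>) \<le> (2 * M) * (M * (h + k))"
        using Cauchy_Schwarz_ineq2[of u "w t - \<delta>"] w\<delta> M
          mult_mono[of "norm u" "2 * M" "norm (w t - \<delta>)" "M * (h + k)"] by fastforce
      then have 2: "u \<bullet> (w t - \<delta>) \<le> 2 * M\<^sup>2 * (h + k)" by (simp add: power2_eq_square mult.assoc)
      have "norm \<delta> \<le> norm (w t) + M * (h + k)"
        using norm_triangle_ineq4[of "w t" "w t - \<delta>"] w\<delta> by simp
      then have "(norm \<delta>)\<^sup>2 \<le> (norm (w t) + M * (h + k))\<^sup>2" by (intro power_mono) auto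
      also have "\<dots> \<le> 2 * (norm (w t))\<^sup>2 + 2 * (M * (h + k))\<^sup>2"
        using sum_squares_ge_zero[of "norm (w t) - M * (h + k)" 0] by (simp add: power2_eq_square algebra_simps)
      also have "(M * (h + k))\<^sup>2 \<le> M\<^sup>2 * (2 * (h + k))"
        unfolding power_mult_distrib power2_eq_square[of "h + k"] using h k
        by (intro mult_left_mono mult_right_mono) auto
      finally have "C * (norm \<delta>)\<^sup>2 \<le> C * (2 * (norm (w t))\<^sup>2 + 2 * (M\<^sup>2 * (2 * (h + k))))"
        using C(1) by (intro mult_left_mono) auto
      then have "u \<bullet> \<delta> \<le> C * (2 * (norm (w t))\<^sup>2 + 2 * (M\<^sup>2 * (2 * (h + k))))" using 1 by linarith
      moreover have "w t \<bullet> u = u \<bullet> \<delta> + u \<bullet> (w t - \<delta>)" by (simp add: inner_diff_right inner_commute)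
      ultimately have "2 * (w t \<bullet> u) \<le> 4 * C * (w t \<bullet> w t) + K * (h + k)"
        using 2 by (simp add: K_def power2_norm_eq_inner algebra_simps)
      then show "\<exists>D\<le>4 * C * (w t \<bullet> w t) + K * (h + k). ((\<lambda>t. w t \<bullet> w t) has_vector_derivative D) (at t within {t0..T})"
        using der by blast
    qed
    then show "(norm (polygon h T - polygon k T))\<^sup>2 \<le> K * (T - t0) * exp (4 * C * (T - t0)) * (h + k)"
      by (simp add: w_def power2_norm_eq_inner mult_ac)
  qed
qed

definition step :: "nat \<Rightarrow> real" where "step n = inverse (Suc n)"

lemma step_props: "0 < step n" "step n \<le> 1" "step \<longlonglongrightarrow> 0"
  unfolding step_def using LIMSEQ_inverse_real_of_nat by (auto simp: inverse_le_1_iff)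

definition limit :: "real \<Rightarrow> 'a" where "limit t = lim (\<lambda>n. polygon (step n) t)"

lemma polygon_LIMSEQ:
  assumes T: "t0 \<le> T" shows "(\<lambda>n. polygon (step n) T) \<longlonglongrightarrow> limit T"
proof -
  obtain K where K: "0 \<le> K" "\<And>h k. 0 < h \<Longrightarrow> h \<le> 1 \<Longrightarrow> 0 < k \<Longrightarrow> k \<le> 1 \<Longrightarrow>
    (norm (polygon h T - polygon k T))\<^sup>2 \<le> K * (h + k)"
    by (rule polygon_cauchy_estimate[OF T]) blast
  have "Cauchy (\<lambda>n. polygon (step n) T)"
  proof (rule CauchyI)
    fix e :: real assume "e > 0"
    have "(\<lambda>n. 2 * K * step n) \<longlonglongrightarrow> 2 * K * 0" by (intro tendsto_mult_left step_props)
    then have "\<forall>\<^sub>F n in sequentially. 2 * K * step n < e\<^sup>2"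
      using \<open>e > 0\<close> by (intro order_tendstoD(2)) auto
    then obtain m where m: "\<And>n. m \<le> n \<Longrightarrow> 2 * K * step n < e\<^sup>2"
      unfolding eventually_sequentially by blast
    show "\<exists>M. \<forall>m\<ge>M. \<forall>n\<ge>M. norm (polygon (step m) T - polygon (step n) T) < e"
    proof (intro exI[of _ m] allI impI)
      fix i j assume "m \<le> i" "m \<le> j"
      have "(norm (polygon (step i) T - polygon (step j) T))\<^sup>2 \<le> K * (step i + step j)"
        by (intro K(2) step_props)
      also have "\<dots> < e\<^sup>2" using m[OF \<open>m \<le> i\<close>] m[OF \<open>m \<le> j\<close>] by (simp add: algebra_simps)
      finally show "norm (polygon (step i) T - polygon (step j) T) < e"
        using \<open>e > 0\<close> by (simp add: power_less_imp_less_base)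
    qed
  qed
  then show ?thesis unfolding limit_def by (simp add: Cauchy_convergent convergent_LIMSEQ_iff[symmetric])
qed

lemma frozen_LIMSEQ:
  assumes T: "t0 \<le> T" shows "(\<lambda>n. frozen (step n) T) \<longlonglongrightarrow> limit T"
proof -
  have "(\<lambda>n. polygon (step n) T - frozen (step n) T) \<longlonglongrightarrow> 0"
  proof (rule Lim_null_comparison)
    show "\<forall>\<^sub>F n in sequentially. norm (polygon (step n) T - frozen (step n) T) \<le> c * radius T * step n"
      using T step_props by (intro always_eventually allI polygon_near_frozen) auto
    show "(\<lambda>n. c * radius T * step n) \<longlonglongrightarrow> 0" using tendsto_mult_left[OF step_props(3), of "c * radius T"] by simp
  qed
  from tendsto_diff[OF polygon_LIMSEQ[OF T] this] show ?thesis by simp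
qed

lemma limit_lipschitz:
  assumes "r \<in> {t0..T}" "t \<in> {t0..T}"
  shows "norm (limit t - limit r) \<le> c * radius T * \<bar>t - r\<bar>"
proof (rule tendsto_upperbound)
  show "(\<lambda>n. norm (polygon (step n) t - polygon (step n) r)) \<longlonglongrightarrow> norm (limit t - limit r)"
    using assms by (intro tendsto_intros polygon_LIMSEQ) auto
  show "\<forall>\<^sub>F n in sequentially. norm (polygon (step n) t - polygon (step n) r) \<le> c * radius T * \<bar>t - r\<bar>"
    using assms step_props by (intro always_eventually allI polygon_lipschitz) auto
qed simp

lemma limit_measurable: "limit \<in> borel_measurable (lebesgue_on {t0..})"
  by (rule borel_measurable_LIMSEQ_metric[OF frozen_measurable]) (auto intro: frozen_LIMSEQ)

lemma limit_bound:
  assumes "t \<in> {t0..T}" shows "1 + norm (limit t) \<le> radius T"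
proof (rule tendsto_upperbound)
  show "(\<lambda>n. 1 + norm (frozen (step n) t)) \<longlonglongrightarrow> 1 + norm (limit t)"
    using assms by (intro tendsto_intros frozen_LIMSEQ) auto
  show "\<forall>\<^sub>F n in sequentially. 1 + norm (frozen (step n) t) \<le> radius T"
    using assms step_props by (intro always_eventually allI frozen_bound) auto
qed simp

text \<open>Testing the inclusion for the polygons with a fixed \<open>y\<close> and integrating produces a nonincreasing
  function, because \<open>v \<bullet> x\<close> integrates to half the squared norm. In this form the inequality
  passes to the limit although the velocities converge only weakly.\<close>

definition energy :: "(real \<Rightarrow> 'a) \<Rightarrow> (real \<Rightarrow> 'a) \<Rightarrow> 'a \<Rightarrow> real \<Rightarrow> real" where
  "energy x z y t = x t \<bullet> x t / 2 - x t \<bullet> y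
     - integral {t0..t} (\<lambda>t. if t0 \<le> t then R t (z t) y else 0)"

section \<open>The energy inequality for the polygons and for the limit\<close>

lemma R_locally_bounded:
  assumes t: "t \<in> {t0..T}" and z: "1 + norm z \<le> radius T"
  shows "\<bar>R t z y\<bar> \<le> c * radius T * (norm y + radius T)"
proof -
  have "\<bar>R t z y\<bar> \<le> c * (1 + norm z) * norm (y - z)" using R_bound t by auto
  also have "\<dots> \<le> c * radius T * (norm y + radius T)"
    using z c radius_pos[of T] norm_triangle_ineq4[of y z] by (intro mult_mono mult_left_mono) auto
  finally show ?thesis .
qed

lemma R_integrable:
  assumes "z \<in> borel_measurable (lebesgue_on {t0..})"
    "\<And>t T. t \<in> {t0..T} \<Longrightarrow> 1 + norm (z t) \<le> radius T"
  shows "(\<lambda>t. if t0 \<le> t then R t (z t) y else 0) integrable_on {a..b}"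
proof (rule integrable_on_Icc_locally_bounded[OF R_meas[OF assms(1)]])
  show "\<exists>K. \<forall>t\<in>{t0..T}. norm (R t (z t) y) \<le> K" for T
    using R_locally_bounded[OF _ assms(2)] unfolding real_norm_def by blast
qed

text \<open>The inclusion bounds v \<bullet> (frozen state - y), whereas the derivative of the
  energy contains v \<bullet> (polygon - y). The mismatch is at most the speed bound times the
  distance between polygon and frozen state, hence the factor
  \<open>(c * radius b)\<^sup>2 * h\<close>.\<close>

lemma energy_polygon_decreasing:
  fixes h :: real
  assumes h: "0 < h" and ab: "t0 \<le> a" "a \<le> b"
  shows "energy (polygon h) (frozen h) y b - energy (polygon h) (frozen h) y a
    \<le> (c * radius b)\<^sup>2 * h * (b - a)"
proof -
  let ?\<rho> = "\<lambda>t. if t0 \<le> t then R t (frozen h t) y else 0"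
  define M where "M = c * radius b"
  have M: "0 \<le> M" using c radius_pos[of b] by (simp add: M_def)
  have \<rho>int: "?\<rho> integrable_on {p..q}" for p q
    by (intro R_integrable frozen_measurable frozen_bound[OF h])
  obtain N1 where N1: "negligible N1"
    "\<And>t S. t \<notin> N1 \<Longrightarrow> t0 < t \<Longrightarrow> (polygon h has_vector_derivative velocity h t) (at t within S)"
    by (rule polygon_derivative[OF h]) blast
  obtain N2 where N2: "negligible N2" "\<And>a t. t \<notin> N2 \<Longrightarrow> a < t \<Longrightarrow>
      ((\<lambda>s. integral {a..s} ?\<rho>) has_vector_derivative ?\<rho> t) (at t)"
    by (rule indefinite_integral_AE_vector_derivative[OF \<rho>int]) blast
  \<comment> \<open>Subtracting the value at \<open>a\<close> provides the nonpositive initial value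
    for Gronwall's inequality, applied with C = 0.\<close>
  define e where "e = energy (polygon h) (frozen h) y a"
  let ?f = "\<lambda>t. energy (polygon h) (frozen h) y t - e"
  have "?f b \<le> (M\<^sup>2 * h) * (b - a) * exp (0 * (b - a))"
  proof (rule abs_continuous_gronwall[OF ab(2), where f = ?f])
    show "negligible (N1 \<union> N2 \<union> {t0})" using N1 N2 by simp
    have pac: "abs_continuous_on {a..b} (polygon h)"
      using polygon_abs_continuous[OF h, of b] ab by (rule_tac abs_continuous_on_subset) auto
    have "abs_continuous_on {a..b} (\<lambda>t. polygon h t \<bullet> polygon h t / 2)"
      by (rule abs_continuous_on_transfer[OF abs_continuous_on_inner_self[OF pac], where K = 1])
        (simp add: diff_divide_distrib[symmetric])
    moreover have "abs_continuous_on {a..b} (\<lambda>t. polygon h t \<bullet> y)"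
    proof (rule abs_continuous_on_transfer[OF pac, where K = "norm y"])
      fix r s
      have "norm (polygon h s \<bullet> y - polygon h r \<bullet> y) \<le> norm y * norm (polygon h s - polygon h r)"
        using Cauchy_Schwarz_ineq2[of "polygon h s - polygon h r" y] by (simp add: inner_diff_left mult.commute)
      also have "\<dots> \<le> norm y * (norm (polygon h s - polygon h r) + \<bar>s - r\<bar>)" by (intro mult_left_mono) auto
      finally show "norm (polygon h s \<bullet> y - polygon h r \<bullet> y) \<le> norm y * (norm (polygon h s - polygon h r) + \<bar>s - r\<bar>)" .
    qed
    moreover have "abs_continuous_on {a..b} (\<lambda>t. integral {t0..t} ?\<rho>)"
    proof (rule lipschitz_imp_abs_continuous_on)
      have bd: "norm (?\<rho> t) \<le> c * radius b * (norm y + radius b)" if "t \<in> {t0..b}" for t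
        using R_locally_bounded[OF that frozen_bound[OF h that], of y] that by simp
      fix r s assume "r \<in> {a..b}" "s \<in> {a..b}"
      then show "norm (integral {t0..s} ?\<rho> - integral {t0..r} ?\<rho>) \<le> (c * radius b * (norm y + radius b)) * \<bar>s - r\<bar>"
        using ab by (intro indefinite_integral_lipschitz[OF \<rho>int bd]) auto
    qed
    moreover have "abs_continuous_on {a..b} (\<lambda>t. e)"
      by (rule lipschitz_imp_abs_continuous_on[where K = 0]) simp
    ultimately show "abs_continuous_on {a..b} ?f"
      unfolding energy_def by (intro abs_continuous_on_diff)
    fix t assume t: "t \<in> {a..b} - (N1 \<union> N2 \<union> {t0})"
    then have t': "t \<in> {t0..b}" "t0 < t" using ab by auto
    let ?x = "polygon h t" and ?v = "velocity h t" and ?z = "frozen h t"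
    have p: "(polygon h has_vector_derivative ?v) (at t within {a..b})" using N1(2) t t' by auto
    have p1: "((\<lambda>t. polygon h t \<bullet> polygon h t / 2) has_vector_derivative ?x \<bullet> ?v) (at t within {a..b})"
      using has_vector_derivative_divide[OF has_vector_derivative_inner_self[OF p], of 2] by simp
    have p2: "((\<lambda>t. polygon h t \<bullet> y) has_vector_derivative ?v \<bullet> y) (at t within {a..b})"
      using bounded_linear.has_vector_derivative[OF bounded_linear_inner_left p] .
    have p3: "((\<lambda>s. integral {t0..s} ?\<rho>) has_vector_derivative ?\<rho> t) (at t within {a..b})"
      using t by (intro has_vector_derivative_at_within[OF N2(2)[OF _ t'(2)]]) simp
    have "(?f has_vector_derivative ?x \<bullet> ?v - ?v \<bullet> y - ?\<rho> t - 0) (at t within {a..b})"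
      unfolding energy_def by (intro has_vector_derivative_diff p1 p2 p3 has_vector_derivative_const)
    moreover have "?x \<bullet> ?v - ?v \<bullet> y - ?\<rho> t - 0 \<le> 0 * ?f t + M\<^sup>2 * h"
    proof -
      have "?v \<bullet> (?z - y) \<le> ?\<rho> t" using velocity_in_rhs[of t h] t' by (simp add: rhs_def)
      moreover have "?v \<bullet> (?x - ?z) \<le> M * (M * h)"
        using Cauchy_Schwarz_ineq2[of ?v "?x - ?z"] polygon_near_frozen[OF h t'(1)] velocity_bound[OF h t'(1)] M
          mult_mono[of "norm ?v" M "norm (?x - ?z)" "M * h"] unfolding M_def by fastforce
      ultimately show ?thesis by (simp add: inner_diff_right inner_commute power2_eq_square mult.assoc)
    qed
    ultimately show "\<exists>D\<le>0 * ?f t + M\<^sup>2 * h. (?f has_vector_derivative D) (at t within {a..b})" by blast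
  qed (use h in \<open>auto simp: e_def\<close>)
  then show ?thesis by (simp add: M_def e_def)
qed

text \<open>No velocity occurs in the energy, so pointwise convergence of the states, continuity of
  \<open>R\<close> in its base point and dominated convergence suffice.\<close>

lemma energy_LIMSEQ:
  assumes T: "t0 \<le> T"
  shows "(\<lambda>n. energy (polygon (step n)) (frozen (step n)) y T) \<longlonglongrightarrow> energy limit limit y T"
proof -
  have "(\<lambda>n. integral {t0..T} (\<lambda>t. if t0 \<le> t then R t (frozen (step n) t) y else 0))
    \<longlonglongrightarrow> integral {t0..T} (\<lambda>t. if t0 \<le> t then R t (limit t) y else 0)"
  proof (rule dominated_convergence(2)[where h = "\<lambda>_. c * radius T * (norm y + radius T)"])
    show "(\<lambda>t. if t0 \<le> t then R t (frozen (step n) t) y else 0) integrable_on {t0..T}" for n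
      by (intro R_integrable frozen_measurable frozen_bound step_props)
    show "norm (if t0 \<le> t then R t (frozen (step n) t) y else 0) \<le> c * radius T * (norm y + radius T)"
      if "t \<in> {t0..T}" for n t
      using R_locally_bounded[OF that frozen_bound[OF step_props(1)[of n] that], of y] that by simp
    show "(\<lambda>n. if t0 \<le> t then R t (frozen (step n) t) y else 0) \<longlonglongrightarrow> (if t0 \<le> t then R t (limit t) y else 0)"
      if "t \<in> {t0..T}" for t
      using continuous_on_tendsto_compose[OF R_cont1 frozen_LIMSEQ, of t t] that by simp
  qed auto
  then show ?thesis
    unfolding energy_def by (intro tendsto_intros polygon_LIMSEQ[OF T]) auto
qed

lemma energy_limit_antimono:
  assumes ab: "t0 \<le> a" "a \<le> b"
  shows "energy limit limit y b \<le> energy limit limit y a"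
proof -
  let ?E = "\<lambda>n. energy (polygon (step n)) (frozen (step n)) y"
  have "(\<lambda>n. ?E n b - ?E n a) \<longlonglongrightarrow> energy limit limit y b - energy limit limit y a"
    using ab by (intro tendsto_diff energy_LIMSEQ) auto
  moreover have "(\<lambda>n. (c * radius b)\<^sup>2 * step n * (b - a)) \<longlonglongrightarrow> (c * radius b)\<^sup>2 * 0 * (b - a)"
    by (intro tendsto_intros step_props)
  ultimately have "energy limit limit y b - energy limit limit y a \<le> (c * radius b)\<^sup>2 * 0 * (b - a)"
    using energy_polygon_decreasing[OF step_props(1) ab] by (intro LIMSEQ_le) auto
  then show ?thesis by simp
qed

text \<open>The limit is Lipschitz only on bounded intervals. Clamping time to
  \<open>[t0, T]\<close> gives a globally Lipschitz curve, the added 1 keeps its constant positive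
  when c = 0, and countably many T exhaust the half-line.\<close>

lemma limit_AE_differentiable:
  obtains N where "negligible N" "\<And>t. t0 < t \<Longrightarrow> t \<notin> N \<Longrightarrow> \<exists>v. (limit has_vector_derivative v) (at t)"
proof -
  have "\<exists>N. negligible N \<and> (\<forall>t. t0 < t \<and> t < T \<and> t \<notin> N \<longrightarrow> (\<exists>v. (limit has_vector_derivative v) (at t)))"
    if T: "t0 \<le> T" for T
  proof -
    define x where "x t = limit (max t0 (min T t))" for t
    have "norm (x p - x q) \<le> (c * radius T + 1) * \<bar>p - q\<bar>" for p q
    proof -
      have "norm (x p - x q) \<le> c * radius T * \<bar>max t0 (min T p) - max t0 (min T q)\<bar>"
        unfolding x_def using T by (intro limit_lipschitz) auto
      also have "\<dots> \<le> (c * radius T + 1) * \<bar>p - q\<bar>"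
        using c radius_pos[of T] by (intro mult_mono) auto
      finally show ?thesis .
    qed
    moreover have "0 < c * radius T + 1" using c radius_pos[of T] by (simp add: add_nonneg_pos)
    ultimately obtain N where N: "negligible N" "\<And>t. t \<notin> N \<Longrightarrow> \<exists>v. (x has_vector_derivative v) (at t)"
      using lipschitz_AE_differentiable[of "c * radius T + 1" x] by metis
    show ?thesis
    proof (intro exI[of _ N] conjI allI impI N(1))
      fix t assume t: "t0 < t \<and> t < T \<and> t \<notin> N"
      then obtain v where "(x has_vector_derivative v) (at t)" using N(2) by blast
      then have "(limit has_vector_derivative v) (at t)"
        by (rule has_vector_derivative_transform_within_open[where S = "{t0<..<T}"])
          (use t in \<open>auto simp: x_def\<close>)
      then show "\<exists>v. (limit has_vector_derivative v) (at t)" ..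
    qed
  qed
  then have "\<forall>n::nat. \<exists>N. negligible N \<and> (\<forall>t. t0 < t \<and> t < t0 + n \<and> t \<notin> N \<longrightarrow> (\<exists>v. (limit has_vector_derivative v) (at t)))"
    by simp
  then obtain N where N: "\<And>n::nat. negligible (N n)"
    "\<And>n t. t0 < t \<Longrightarrow> t < t0 + real n \<Longrightarrow> t \<notin> N n \<Longrightarrow> \<exists>v. (limit has_vector_derivative v) (at t)"
    by metis
  show thesis
  proof (rule that)
    show "negligible (\<Union>n. N n)" using N(1) by (rule negligible_Union_nat)
    fix t assume t: "t0 < t" "t \<notin> (\<Union>n. N n)"
    obtain n :: nat where "t - t0 < n" using reals_Archimedean2 by blast
    then show "\<exists>v. (limit has_vector_derivative v) (at t)" using N(2)[of t n] t by auto
  qed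
qed

text \<open>At almost every t the decreasing energy has a derivative \<le> 0, which is the
  inequality tested with y. The null set depends on y, so only a countable dense set of test points
  is used; continuity of \<open>R\<close> in y makes the set of violated tests open, hence
  empty.\<close>

lemma limit_derivative_in_rhs:
  obtains N where "negligible N"
    "\<And>t. t0 < t \<Longrightarrow> t \<notin> N \<Longrightarrow> \<exists>v\<in>rhs t (limit t). (limit has_vector_derivative v) (at t)"
proof -
  obtain D :: "'a set" where D: "countable D" "\<And>X. open X \<Longrightarrow> X \<noteq> {} \<Longrightarrow> \<exists>d\<in>D. d \<in> X"
    using countable_dense_exists by blast
  obtain N0 where N0: "negligible N0"
    "\<And>t. t0 < t \<Longrightarrow> t \<notin> N0 \<Longrightarrow> \<exists>v. (limit has_vector_derivative v) (at t)"
    by (rule limit_AE_differentiable) blast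
  let ?\<rho> = "\<lambda>y t. if t0 \<le> t then R t (limit t) y else 0"
  have int: "?\<rho> y integrable_on {p..q}" for y p q
    by (intro R_integrable limit_measurable limit_bound)
  have "\<forall>y. \<exists>N. negligible N \<and> (\<forall>a t. t \<notin> N \<longrightarrow> a < t \<longrightarrow>
      ((\<lambda>s. integral {a..s} (?\<rho> y)) has_vector_derivative ?\<rho> y t) (at t))"
    by (intro allI, rule indefinite_integral_AE_vector_derivative[OF int]) blast
  from choice[OF this] obtain N where N: "\<forall>y. negligible (N y) \<and> (\<forall>a t. t \<notin> N y \<longrightarrow> a < t \<longrightarrow>
      ((\<lambda>s. integral {a..s} (?\<rho> y)) has_vector_derivative ?\<rho> y t) (at t))"
    ..
  show thesis
  proof (rule that)
    have "negligible (\<Union>y\<in>D. N y)"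
      using D(1) N by (intro negligible_countable_Union) auto
    then show "negligible (N0 \<union> (\<Union>y\<in>D. N y))" using N0 by simp
    fix t assume t: "t0 < t" "t \<notin> N0 \<union> (\<Union>y\<in>D. N y)"
    then obtain v where v: "(limit has_vector_derivative v) (at t)" using N0(2) by blast
    have le: "v \<bullet> (limit t - y) \<le> R t (limit t) y" if "y \<in> D" for y
    proof -
      have p1: "((\<lambda>t. limit t \<bullet> limit t / 2) has_vector_derivative limit t \<bullet> v) (at t)"
        using has_vector_derivative_divide[OF has_vector_derivative_inner_self[OF v], of 2] by simp
      have p2: "((\<lambda>t. limit t \<bullet> y) has_vector_derivative v \<bullet> y) (at t)"
        using bounded_linear.has_vector_derivative[OF bounded_linear_inner_left v] .
      have p3: "((\<lambda>s. integral {t0..s} (?\<rho> y)) has_vector_derivative ?\<rho> y t) (at t)"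
        using N t that by blast
      have "(energy limit limit y has_vector_derivative limit t \<bullet> v - v \<bullet> y - ?\<rho> y t) (at t)"
        unfolding energy_def[abs_def] by (intro has_vector_derivative_diff p1 p2 p3)
      then have der: "(energy limit limit y has_real_derivative limit t \<bullet> v - v \<bullet> y - ?\<rho> y t) (at t)"
        by (simp add: has_real_derivative_iff_has_vector_derivative)
      have "limit t \<bullet> v - v \<bullet> y - ?\<rho> y t \<le> 0"
      proof (rule ccontr)
        assume "\<not> ?thesis"
        then obtain d where "0 < d" "\<And>h. 0 < h \<Longrightarrow> h < d \<Longrightarrow> energy limit limit y t < energy limit limit y (t + h)"
          using DERIV_pos_inc_right[OF der] by auto
        from this(2)[of "d / 2"] this(1) show False
          using energy_limit_antimono[of t "t + d / 2" y] t by simp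
      qed
      then show ?thesis using t by (simp add: inner_diff_right inner_commute)
    qed
    have "v \<in> rhs t (limit t)"
      unfolding rhs_def
    proof (intro CollectI allI, rule ccontr)
      fix y assume y: "\<not> v \<bullet> (limit t - y) \<le> R t (limit t) y"
      define X where "X = {y. R t (limit t) y < v \<bullet> (limit t - y)}"
      have "open X"
        unfolding X_def using t by (intro open_Collect_less R_cont2 continuous_intros) auto
      moreover have "y \<in> X" using y by (simp add: X_def not_le)
      then have "X \<noteq> {}" by blast
      ultimately obtain d where "d \<in> D" "d \<in> X" using D(2) by blast
      then show False using le[of d] by (simp add: X_def)
    qed
    then show "\<exists>v\<in>rhs t (limit t). (limit has_vector_derivative v) (at t)" using v by blast
  qed
qed

lemma limit_solves: "solves_inclusion rhs t0 x0 limit"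
  unfolding solves_inclusion_def
proof (intro conjI)
  show "loc_abs_continuous_on {t0..} limit"
    unfolding loc_abs_continuous_on_def
  proof (intro allI impI)
    fix a b assume ab: "{a..b} \<subseteq> {t0..}"
    show "abs_continuous_on {a..b} limit"
    proof (rule lipschitz_imp_abs_continuous_on)
      fix r s assume "r \<in> {a..b}" "s \<in> {a..b}"
      then show "norm (limit s - limit r) \<le> c * radius b * \<bar>s - r\<bar>"
        using ab by (intro limit_lipschitz) auto
    qed
  qed
  have "polygon (step n) t0 = x0" for n by (simp add: polygon_def)
  then show "limit t0 = x0" using LIMSEQ_unique[OF polygon_LIMSEQ[of t0]] by simp
  obtain N where N: "negligible N"
    "\<And>t. t0 < t \<Longrightarrow> t \<notin> N \<Longrightarrow> \<exists>v\<in>rhs t (limit t). (limit has_vector_derivative v) (at t)"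
    by (rule limit_derivative_in_rhs) blast
  show "AE t in lebesgue_on {t0..}. \<exists>v. (limit has_vector_derivative v) (at t within {t0..}) \<and> v \<in> rhs t (limit t)"
    unfolding AE_lebesgue_on_iff_negligible[of "{t0..}", simplified]
  proof (intro exI[of _ "insert t0 N"] conjI ballI)
    fix t assume "t \<in> {t0..} - insert t0 N"
    then show "\<exists>v. (limit has_vector_derivative v) (at t within {t0..}) \<and> v \<in> rhs t (limit t)"
      using N(2)[of t] by (fastforce intro: has_vector_derivative_at_within)
  qed (use N in simp)
qed

lemma unique_solution:
  "\<exists>x. solves_inclusion rhs t0 x0 x \<and> (\<forall>y. solves_inclusion rhs t0 x0 y \<longrightarrow> (\<forall>t\<ge>t0. y t = x t))"
  using limit_solves solution_unique by blast

end

section \<open>Controlled inclusions with an integral of subdifferentials\<close>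

lemma integral_norm_le_integral:
  fixes f :: "'b \<Rightarrow> 'c::{banach, second_countable_topology}"
  assumes "integrable M f" "integrable M b" "\<And>\<alpha>. \<alpha> \<in> space M \<Longrightarrow> norm (f \<alpha>) \<le> b \<alpha>"
  shows "norm (\<integral>\<alpha>. f \<alpha> \<partial>M) \<le> (\<integral>\<alpha>. b \<alpha> \<partial>M)"
proof -
  have "norm (\<integral>\<alpha>. f \<alpha> \<partial>M) \<le> (\<integral>\<alpha>. norm (f \<alpha>) \<partial>M)" by (rule integral_norm_bound)
  also have "\<dots> \<le> (\<integral>\<alpha>. b \<alpha> \<partial>M)"
    using assms by (intro integral_mono) auto
  finally show ?thesis .
qed

text \<open>The bound varies with the parameter. Along a convergent sequence the continuous factor
  \<open>b\<close> is bounded, so a single multiple of \<open>l\<close> dominates.\<close>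

lemma continuous_on_integral_dominated:
  fixes f :: "'p::metric_space \<Rightarrow> 'b \<Rightarrow> 'c::{banach, second_countable_topology}"
  assumes meas: "\<And>p. p \<in> S \<Longrightarrow> f p \<in> borel_measurable M"
    and cont: "\<And>\<alpha>. \<alpha> \<in> space M \<Longrightarrow> continuous_on S (\<lambda>p. f p \<alpha>)"
    and bound: "\<And>p \<alpha>. p \<in> S \<Longrightarrow> \<alpha> \<in> space M \<Longrightarrow> norm (f p \<alpha>) \<le> b p * l \<alpha>"
    and b: "continuous_on S b"
    and l: "integrable M l" "\<And>\<alpha>. \<alpha> \<in> space M \<Longrightarrow> 0 \<le> l \<alpha>"
  shows "continuous_on S (\<lambda>p. \<integral>\<alpha>. f p \<alpha> \<partial>M)"
  unfolding continuous_on_sequentially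
proof (intro allI ballI impI, elim conjE)
  fix x p assume p: "p \<in> S" and x: "\<forall>n. x n \<in> S" "x \<longlonglongrightarrow> p"
  have "(\<lambda>n. b (x n)) \<longlonglongrightarrow> b p"
    using continuous_on_tendsto_compose[OF b x(2) p] x(1) by simp
  then have "Bseq (\<lambda>n. b (x n))" by (intro convergent_imp_Bseq convergentI)
  then obtain K where K: "\<And>n. norm (b (x n)) \<le> K" by (rule BseqE) blast
  have "(\<lambda>n. \<integral>\<alpha>. f (x n) \<alpha> \<partial>M) \<longlonglongrightarrow> (\<integral>\<alpha>. f p \<alpha> \<partial>M)"
  proof (rule integral_dominated_convergence[where w = "\<lambda>\<alpha>. K * l \<alpha>"])
    show "AE \<alpha> in M. (\<lambda>n. f (x n) \<alpha>) \<longlonglongrightarrow> f p \<alpha>"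
      using x p by (intro AE_I2 continuous_on_tendsto_compose[OF cont]) auto
    fix n
    show "AE \<alpha> in M. norm (f (x n) \<alpha>) \<le> K * l \<alpha>"
    proof (rule AE_I2)
      fix \<alpha> assume \<alpha>: "\<alpha> \<in> space M"
      have "norm (f (x n) \<alpha>) \<le> b (x n) * l \<alpha>" using bound x(1) \<alpha> by blast
      also have "\<dots> \<le> K * l \<alpha>" using K[of n] l(2)[OF \<alpha>] by (intro mult_right_mono) auto
      finally show "norm (f (x n) \<alpha>) \<le> K * l \<alpha>" .
    qed
  qed (use meas p x l in auto)
  then show "((\<lambda>p. \<integral>\<alpha>. f p \<alpha> \<partial>M) \<circ> x) \<longlonglongrightarrow> (\<integral>\<alpha>. f p \<alpha> \<partial>M)" by (simp add: o_def)
qed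

lemma borel_measurable_continuous_on_compose:
  assumes F: "continuous_on S F" and p: "p \<in> borel_measurable N" "\<And>t. t \<in> space N \<Longrightarrow> p t \<in> S"
  shows "(\<lambda>t. F (p t)) \<in> borel_measurable N"
proof (rule measurable_compose[OF _ borel_measurable_continuous_on_restrict[OF F]])
  show "p \<in> measurable N (restrict_space borel S)"
    using p by (intro measurable_restrict_space2) auto
qed

locale subdifferential_control =
  fixes M :: "'b measure" and U :: "'u::euclidean_space set"
    and g :: "real \<Rightarrow> 'a::euclidean_space \<Rightarrow> 'u \<Rightarrow> 'a"
    and k :: "real \<Rightarrow> 'a \<Rightarrow> 'u \<Rightarrow> 'b \<Rightarrow> real"
    and \<phi> :: "'a \<Rightarrow> 'b \<Rightarrow> real" and C1 C2 :: real and l :: "'b \<Rightarrow> real"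
  assumes k_meas: "\<And>t x w. w \<in> U \<Longrightarrow> k t x w \<in> borel_measurable M"
    and \<phi>_meas: "\<And>x. \<phi> x \<in> borel_measurable M"
    and k_cont: "\<And>\<alpha>. \<alpha> \<in> space M \<Longrightarrow> continuous_on (UNIV \<times> UNIV \<times> U) (\<lambda>(t, x, w). k t x w \<alpha>)"
    and g_cont: "continuous_on (UNIV \<times> UNIV \<times> U) (\<lambda>(t, x, w). g t x w)"
    and C: "0 \<le> C1" "0 \<le> C2"
    and k_bound: "\<And>t x w \<alpha>. w \<in> U \<Longrightarrow> \<alpha> \<in> space M \<Longrightarrow> 0 \<le> k t x w \<alpha> \<and> k t x w \<alpha> \<le> C1 + C2 * norm x"
    and g_bound: "\<And>t x w. w \<in> U \<Longrightarrow> norm (g t x w) \<le> C1 + C2 * norm x"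
    and \<phi>_convex: "\<And>\<alpha>. \<alpha> \<in> space M \<Longrightarrow> convex_on UNIV (\<lambda>x. \<phi> x \<alpha>)"
    and \<phi>_lipschitz: "\<And>\<alpha>. \<alpha> \<in> space M \<Longrightarrow> lipschitz_on (l \<alpha>) UNIV (\<lambda>x. \<phi> x \<alpha>)"
    and l_int: "integrable M l"
    and lipschitz: "\<And>a T B. \<exists>L\<ge>0. \<forall>t\<in>{a..T}. \<forall>x y. \<forall>w\<in>U. norm x \<le> B \<longrightarrow> norm y \<le> B \<longrightarrow>
        norm (g t x w - g t y w) \<le> L * norm (x - y) \<and>
        (\<forall>\<alpha>\<in>space M. \<bar>k t x w \<alpha> - k t y w \<alpha>\<bar> \<le> L * norm (x - y))"
begin

definition F :: "real \<Rightarrow> 'a \<Rightarrow> 'u \<Rightarrow> 'a set" where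
  "F t x w = (\<lambda>v. g t x w - v) ` weighted_set_integral M (k t x w) (\<lambda>\<alpha>. subdifferential (\<lambda>y. \<phi> y \<alpha>) x)"

text \<open>This is the inequality \<open>(g t x w - v) \<bullet> (y - x) \<le> \<dots>\<close>
  solved for \<open>v \<bullet> (x - y)\<close>. The weight stays at the base point x while the test
  point y varies.\<close>

definition R :: "real \<Rightarrow> 'a \<Rightarrow> 'u \<Rightarrow> 'a \<Rightarrow> real" where
  "R t x w y = (\<integral>\<alpha>. k t x w \<alpha> * (\<phi> y \<alpha> - \<phi> x \<alpha>) \<partial>M) - g t x w \<bullet> (y - x)"

definition \<Lambda> :: real where "\<Lambda> = (\<integral>\<alpha>. l \<alpha> \<partial>M)"

abbreviation q :: "'a \<Rightarrow> 'b \<Rightarrow> 'a \<Rightarrow> real" where "q x \<alpha> \<equiv> dir_deriv (\<lambda>y. \<phi> y \<alpha>) x"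

section \<open>Measurable selections and the description of \<open>F\<close> by inequalities\<close>

lemma l_nonneg: "\<alpha> \<in> space M \<Longrightarrow> 0 \<le> l \<alpha>"
  using \<phi>_lipschitz lipschitz_on_nonneg by blast

lemma \<Lambda>_nonneg: "0 \<le> \<Lambda>"
  unfolding \<Lambda>_def by (intro integral_nonneg_AE AE_I2 l_nonneg)

lemma \<phi>_diff: "\<alpha> \<in> space M \<Longrightarrow> \<bar>\<phi> y \<alpha> - \<phi> x \<alpha>\<bar> \<le> l \<alpha> * norm (y - x)"
  using lipschitz_onD[OF \<phi>_lipschitz, of \<alpha> y x] by (simp add: dist_norm)

lemma k_\<phi>_bound:
  assumes "w \<in> U" "\<alpha> \<in> space M"
  shows "\<bar>k t x w \<alpha> * (\<phi> y \<alpha> - \<phi> z \<alpha>)\<bar> \<le> ((C1 + C2 * norm x) * norm (y - z)) * l \<alpha>"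
proof -
  have "\<bar>k t x w \<alpha> * (\<phi> y \<alpha> - \<phi> z \<alpha>)\<bar> \<le> (C1 + C2 * norm x) * (l \<alpha> * norm (y - z))"
    unfolding abs_mult using k_bound[OF assms, of t x] \<phi>_diff[OF assms(2), of y z] by (intro mult_mono) auto
  then show ?thesis by (simp add: mult_ac)
qed

lemma k_\<phi>_integrable:
  assumes "w \<in> U" shows "integrable M (\<lambda>\<alpha>. k t x w \<alpha> * (\<phi> y \<alpha> - \<phi> z \<alpha>))"
proof (rule Bochner_Integration.integrable_bound)
  show "integrable M (\<lambda>\<alpha>. ((C1 + C2 * norm x) * norm (y - z)) * l \<alpha>)" using l_int by simp
  show "(\<lambda>\<alpha>. k t x w \<alpha> * (\<phi> y \<alpha> - \<phi> z \<alpha>)) \<in> borel_measurable M"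
    using k_meas[OF assms] \<phi>_meas by measurable
  show "AE \<alpha> in M. norm (k t x w \<alpha> * (\<phi> y \<alpha> - \<phi> z \<alpha>)) \<le> norm (((C1 + C2 * norm x) * norm (y - z)) * l \<alpha>)"
  proof (rule AE_I2)
    fix \<alpha> assume "\<alpha> \<in> space M"
    from k_\<phi>_bound[OF assms this, of t x y z]
    show "norm (k t x w \<alpha> * (\<phi> y \<alpha> - \<phi> z \<alpha>)) \<le> norm (((C1 + C2 * norm x) * norm (y - z)) * l \<alpha>)"
      by simp
  qed
qed

lemma q_sublinear: "sublinear_family M l (q x)"
  using \<phi>_convex \<phi>_lipschitz \<phi>_meas by (intro sublinear_family_dir_deriv_convex) auto

lemma kl_integrable:
  assumes "w \<in> U" shows "integrable M (\<lambda>\<alpha>. k t x w \<alpha> * l \<alpha>)"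
proof (rule Bochner_Integration.integrable_bound)
  show "integrable M (\<lambda>\<alpha>. (C1 + C2 * norm x) * l \<alpha>)" using l_int by simp
  show "(\<lambda>\<alpha>. k t x w \<alpha> * l \<alpha>) \<in> borel_measurable M"
    using k_meas[OF assms] borel_measurable_integrable[OF l_int] by measurable
  show "AE \<alpha> in M. norm (k t x w \<alpha> * l \<alpha>) \<le> norm ((C1 + C2 * norm x) * l \<alpha>)"
  proof (rule AE_I2)
    fix \<alpha> assume \<alpha>: "\<alpha> \<in> space M"
    show "norm (k t x w \<alpha> * l \<alpha>) \<le> norm ((C1 + C2 * norm x) * l \<alpha>)"
      using k_bound[OF assms \<alpha>, of t x] unfolding norm_mult by (intro mult_right_mono) auto
  qed
qed

lemma minorant_bound:
  assumes w: "w \<in> U" and \<xi>: "\<xi> \<in> measurable_minorants M (q x)" and \<alpha>: "\<alpha> \<in> space M"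
  shows "norm (k t x w \<alpha> *\<^sub>R \<xi> \<alpha>) \<le> k t x w \<alpha> * l \<alpha>"
  using measurable_minorants_bound[OF q_sublinear \<xi> \<alpha>] k_bound[OF w \<alpha>, of t x]
  by (auto intro: mult_left_mono)

lemma minorant_integrable:
  assumes w: "w \<in> U" and \<xi>: "\<xi> \<in> measurable_minorants M (q x)"
  shows "integrable M (\<lambda>\<alpha>. k t x w \<alpha> *\<^sub>R \<xi> \<alpha>)"
proof (rule Bochner_Integration.integrable_bound[OF kl_integrable[OF w]])
  show "(\<lambda>\<alpha>. k t x w \<alpha> *\<^sub>R \<xi> \<alpha>) \<in> borel_measurable M"
    using \<xi> k_meas[OF w] by (auto simp: measurable_minorants_def)
  show "AE \<alpha> in M. norm (k t x w \<alpha> *\<^sub>R \<xi> \<alpha>) \<le> norm (k t x w \<alpha> * l \<alpha>)"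
    using minorant_bound[OF w \<xi>] by (intro AE_I2) (fastforce intro: order_trans)
qed

lemma minorant_subdifferential:
  assumes \<xi>: "\<xi> \<in> measurable_minorants M (q x)" and \<alpha>: "\<alpha> \<in> space M"
  shows "\<xi> \<alpha> \<in> subdifferential (\<lambda>y. \<phi> y \<alpha>) x"
  unfolding subdifferential_def
proof (intro CollectI allI)
  fix y
  have "\<xi> \<alpha> \<bullet> (y - x) \<le> q x \<alpha> (y - x)" using \<xi> \<alpha> by (simp add: measurable_minorants_def)
  also have "\<dots> \<le> \<phi> y \<alpha> - \<phi> x \<alpha>"
    using dir_deriv_le_quot[OF \<phi>_convex[OF \<alpha>] \<phi>_lipschitz[OF \<alpha>], of 1 x "y - x"] by simp
  finally show "\<phi> x \<alpha> + \<xi> \<alpha> \<bullet> (y - x) \<le> \<phi> y \<alpha>" by simp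
qed

lemma minorant_in_F:
  assumes w: "w \<in> U" and \<xi>: "\<xi> \<in> measurable_minorants M (q x)"
  shows "g t x w - (\<integral>\<alpha>. k t x w \<alpha> *\<^sub>R \<xi> \<alpha> \<partial>M) \<in> F t x w"
proof -
  have "\<xi> \<in> borel_measurable M" using \<xi> by (simp add: measurable_minorants_def)
  then show ?thesis
    unfolding F_def weighted_set_integral_def
    using minorant_subdifferential[OF \<xi>] minorant_integrable[OF w \<xi>] by blast
qed

text \<open>From left to right the subgradient inequality is integrated against the nonnegative
  weight. Conversely, the inequalities at y = x + h d, with h tending to 0, make g - v a linear
  minorant of the integrated directional derivatives, and disintegration returns a measurable
  selection.\<close>

lemma F_eq:
  assumes w: "w \<in> U"
  shows "F t x w = {v. \<forall>y. v \<bullet> (x - y) \<le> R t x w y}"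
proof (intro equalityI subsetI CollectI allI)
  fix v y assume "v \<in> F t x w"
  then obtain \<xi> where \<xi>: "v = g t x w - (\<integral>\<alpha>. k t x w \<alpha> *\<^sub>R \<xi> \<alpha> \<partial>M)"
    "\<forall>\<alpha>\<in>space M. \<xi> \<alpha> \<in> subdifferential (\<lambda>y. \<phi> y \<alpha>) x" "integrable M (\<lambda>\<alpha>. k t x w \<alpha> *\<^sub>R \<xi> \<alpha>)"
    by (auto simp: F_def weighted_set_integral_def)
  have "(\<integral>\<alpha>. k t x w \<alpha> *\<^sub>R \<xi> \<alpha> \<partial>M) \<bullet> (y - x) = (\<integral>\<alpha>. (k t x w \<alpha> *\<^sub>R \<xi> \<alpha>) \<bullet> (y - x) \<partial>M)"
    by (rule integral_inner_left[OF \<xi>(3), symmetric])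
  also have "\<dots> \<le> (\<integral>\<alpha>. k t x w \<alpha> * (\<phi> y \<alpha> - \<phi> x \<alpha>) \<partial>M)"
  proof (rule integral_mono)
    show "integrable M (\<lambda>\<alpha>. (k t x w \<alpha> *\<^sub>R \<xi> \<alpha>) \<bullet> (y - x))" by (rule integrable_inner_left[OF \<xi>(3)])
    show "integrable M (\<lambda>\<alpha>. k t x w \<alpha> * (\<phi> y \<alpha> - \<phi> x \<alpha>))" by (rule k_\<phi>_integrable[OF w])
    fix \<alpha> assume \<alpha>: "\<alpha> \<in> space M"
    then have "\<phi> x \<alpha> + \<xi> \<alpha> \<bullet> (y - x) \<le> \<phi> y \<alpha>" using \<xi>(2) by (auto simp: subdifferential_def)
    then have "\<xi> \<alpha> \<bullet> (y - x) \<le> \<phi> y \<alpha> - \<phi> x \<alpha>" by simp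
    then show "(k t x w \<alpha> *\<^sub>R \<xi> \<alpha>) \<bullet> (y - x) \<le> k t x w \<alpha> * (\<phi> y \<alpha> - \<phi> x \<alpha>)"
      using k_bound[OF w \<alpha>, of t x] by (simp add: mult_left_mono)
  qed
  finally show "v \<bullet> (x - y) \<le> R t x w y" by (simp add: R_def \<xi>(1) inner_diff_left inner_diff_right)
next
  fix v assume "v \<in> {v. \<forall>y. v \<bullet> (x - y) \<le> R t x w y}"
  then have v: "v \<bullet> (x - y) \<le> R t x w y" for y by blast
  have "(g t x w - v) \<bullet> d \<le> (\<integral>\<alpha>. k t x w \<alpha> * q x \<alpha> d \<partial>M)" for d
  proof (rule integral_dir_deriv_ge[where f = "\<lambda>\<alpha> y. \<phi> y \<alpha>" and l = l])
    fix h :: real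
    show "((g t x w - v) \<bullet> d) * h \<le> (\<integral>\<alpha>. k t x w \<alpha> * (\<phi> (x + h *\<^sub>R d) \<alpha> - \<phi> x \<alpha>) \<partial>M)"
      using v[of "x + h *\<^sub>R d"] by (simp add: R_def inner_diff_left algebra_simps)
  qed (use \<phi>_convex \<phi>_lipschitz \<phi>_meas k_meas k_bound kl_integrable w in auto)
  then have "\<exists>\<xi>\<in>measurable_minorants M (q x). g t x w - v = (\<integral>\<alpha>. k t x w \<alpha> *\<^sub>R \<xi> \<alpha> \<partial>M)"
    using k_meas[OF w] k_bound[OF w] kl_integrable[OF w] q_sublinear
    by (intro linear_minorant_of_integral[where l = l]) auto
  then obtain \<xi> where \<xi>: "\<xi> \<in> measurable_minorants M (q x)" "g t x w - v = (\<integral>\<alpha>. k t x w \<alpha> *\<^sub>R \<xi> \<alpha> \<partial>M)" ..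
  have "v = g t x w - (g t x w - v)" by simp
  also have "\<dots> \<in> F t x w" unfolding \<xi>(2) by (rule minorant_in_F[OF w \<xi>(1)])
  finally show "v \<in> F t x w" .
qed

section \<open>Regularity, growth and the one-sided condition for \<open>R\<close>\<close>

lemma R_continuous: "continuous_on (UNIV \<times> UNIV \<times> U \<times> UNIV) (\<lambda>(t, x, w, y). R t x w y)"
proof -
  let ?S = "UNIV \<times> UNIV \<times> U \<times> UNIV :: (real \<times> 'a \<times> 'u \<times> 'a) set"
  have "continuous_on ?S (\<lambda>p. \<integral>\<alpha>. (case p of (t, x, w, y) \<Rightarrow> k t x w \<alpha> * (\<phi> y \<alpha> - \<phi> x \<alpha>)) \<partial>M)"
  proof (rule continuous_on_integral_dominated[where l = l
        and b = "\<lambda>(t, x, w, y). (C1 + C2 * norm x) * norm (y - x)"])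
    show "(\<lambda>\<alpha>. case p of (t, x, w, y) \<Rightarrow> k t x w \<alpha> * (\<phi> y \<alpha> - \<phi> x \<alpha>)) \<in> borel_measurable M"
      if "p \<in> ?S" for p
      using that k_meas \<phi>_meas by auto
    show "norm (case p of (t, x, w, y) \<Rightarrow> k t x w \<alpha> * (\<phi> y \<alpha> - \<phi> x \<alpha>))
        \<le> (case p of (t, x, w, y) \<Rightarrow> (C1 + C2 * norm x) * norm (y - x)) * l \<alpha>"
      if "p \<in> ?S" "\<alpha> \<in> space M" for p \<alpha>
      using that k_\<phi>_bound by (auto split: prod.split)
    show "continuous_on ?S (\<lambda>(t, x, w, y). (C1 + C2 * norm x) * norm (y - x))"
      unfolding split_def by (intro continuous_intros)
    fix \<alpha> assume \<alpha>: "\<alpha> \<in> space M"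
    have "continuous_on ?S (\<lambda>p. (\<lambda>(t, x, w). k t x w \<alpha>) (fst p, fst (snd p), fst (snd (snd p))))"
      by (rule continuous_on_compose2[OF k_cont[OF \<alpha>]]) (auto intro!: continuous_intros)
    moreover have "continuous_on ?S (\<lambda>p. \<phi> (h p) \<alpha>)" if "continuous_on ?S h" for h
      by (rule continuous_on_compose2[OF lipschitz_on_continuous_on[OF \<phi>_lipschitz[OF \<alpha>]] that]) auto
    ultimately show "continuous_on ?S (\<lambda>p. case p of (t, x, w, y) \<Rightarrow> k t x w \<alpha> * (\<phi> y \<alpha> - \<phi> x \<alpha>))"
      unfolding split_def by (intro continuous_on_mult continuous_on_diff) (simp_all add: continuous_on_fst continuous_on_snd continuous_on_id)
  qed (use l_int l_nonneg in auto)
  moreover have "continuous_on ?S (\<lambda>p. (\<lambda>(t, x, w). g t x w) (fst p, fst (snd p), fst (snd (snd p))))"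
    by (rule continuous_on_compose2[OF g_cont]) (auto intro!: continuous_intros)
  ultimately show ?thesis unfolding R_def split_def by (auto intro!: continuous_intros)
qed

text \<open>In the factor \<open>1 + \<Lambda>\<close> the 1 accounts for g and \<Lambda> for the
  integral term.\<close>

lemma R_abs_bound:
  assumes w: "w \<in> U"
  shows "\<bar>R t x w y\<bar> \<le> ((C1 + C2) * (1 + \<Lambda>)) * (1 + norm x) * norm (y - x)"
proof -
  let ?a = "C1 + C2 * norm x"
  have a: "0 \<le> ?a" "?a \<le> (C1 + C2) * (1 + norm x)" using C by (auto simp: algebra_simps)
  have "\<bar>\<integral>\<alpha>. k t x w \<alpha> * (\<phi> y \<alpha> - \<phi> x \<alpha>) \<partial>M\<bar> \<le> (\<integral>\<alpha>. (?a * norm (y - x)) * l \<alpha> \<partial>M)"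
    unfolding real_norm_def[symmetric]
    using k_\<phi>_bound[OF w] l_int k_\<phi>_integrable[OF w] by (intro integral_norm_le_integral) auto
  also have "\<dots> = ?a * norm (y - x) * \<Lambda>" by (simp add: \<Lambda>_def)
  finally have 1: "\<bar>\<integral>\<alpha>. k t x w \<alpha> * (\<phi> y \<alpha> - \<phi> x \<alpha>) \<partial>M\<bar> \<le> ?a * norm (y - x) * \<Lambda>" .
  have 2: "\<bar>g t x w \<bullet> (y - x)\<bar> \<le> ?a * norm (y - x)"
    using Cauchy_Schwarz_ineq2[of "g t x w" "y - x"] mult_right_mono[OF g_bound[OF w, of t x], of "norm (y - x)"]
    by simp
  have "\<bar>R t x w y\<bar> \<le> ?a * (norm (y - x) * (1 + \<Lambda>))"
    using 1 2 unfolding R_def by (simp add: algebra_simps abs_le_iff)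
  also have "\<dots> \<le> ((C1 + C2) * (1 + norm x)) * (norm (y - x) * (1 + \<Lambda>))"
    using a \<Lambda>_nonneg by (intro mult_right_mono) auto
  finally show ?thesis by (simp add: mult_ac)
qed

text \<open>The two integrands add up to (k(x) - k(y)) (\<phi>(y) - \<phi>(x)). With equal weights
  this is 0, which is monotonicity of the subdifferential; otherwise both factors are Lipschitz and
  the product is quadratic in the distance.\<close>

lemma R_one_sided:
  assumes w: "w \<in> U" and L: "0 \<le> L" "norm (g t x w - g t y w) \<le> L * norm (x - y)"
    "\<And>\<alpha>. \<alpha> \<in> space M \<Longrightarrow> \<bar>k t x w \<alpha> - k t y w \<alpha>\<bar> \<le> L * norm (x - y)"
  shows "R t x w y + R t y w x \<le> L * (1 + \<Lambda>) * (norm (x - y))\<^sup>2"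
proof -
  have "(\<integral>\<alpha>. k t x w \<alpha> * (\<phi> y \<alpha> - \<phi> x \<alpha>) \<partial>M) + (\<integral>\<alpha>. k t y w \<alpha> * (\<phi> x \<alpha> - \<phi> y \<alpha>) \<partial>M)
      = (\<integral>\<alpha>. k t x w \<alpha> * (\<phi> y \<alpha> - \<phi> x \<alpha>) + k t y w \<alpha> * (\<phi> x \<alpha> - \<phi> y \<alpha>) \<partial>M)"
    by (rule Bochner_Integration.integral_add[symmetric]) (rule k_\<phi>_integrable[OF w])+
  also have "\<dots> \<le> (\<integral>\<alpha>. (L * (norm (x - y))\<^sup>2) * l \<alpha> \<partial>M)"
  proof (rule integral_mono)
    show "integrable M (\<lambda>\<alpha>. k t x w \<alpha> * (\<phi> y \<alpha> - \<phi> x \<alpha>) + k t y w \<alpha> * (\<phi> x \<alpha> - \<phi> y \<alpha>))"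
      by (intro Bochner_Integration.integrable_add k_\<phi>_integrable[OF w])
    show "integrable M (\<lambda>\<alpha>. (L * (norm (x - y))\<^sup>2) * l \<alpha>)" using l_int by simp
    fix \<alpha> assume \<alpha>: "\<alpha> \<in> space M"
    have "(k t x w \<alpha> - k t y w \<alpha>) * (\<phi> y \<alpha> - \<phi> x \<alpha>) \<le> \<bar>k t x w \<alpha> - k t y w \<alpha>\<bar> * \<bar>\<phi> y \<alpha> - \<phi> x \<alpha>\<bar>"
      unfolding abs_mult[symmetric] by (rule abs_ge_self)
    also have "\<dots> \<le> (L * norm (x - y)) * (l \<alpha> * norm (x - y))"
      using L \<alpha> \<phi>_diff[OF \<alpha>, of y x] by (intro mult_mono) (auto simp: norm_minus_commute)
    finally show "k t x w \<alpha> * (\<phi> y \<alpha> - \<phi> x \<alpha>) + k t y w \<alpha> * (\<phi> x \<alpha> - \<phi> y \<alpha>) \<le> (L * (norm (x - y))\<^sup>2) * l \<alpha>"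
      by (simp add: algebra_simps power2_eq_square)
  qed
  also have "\<dots> = L * (norm (x - y))\<^sup>2 * \<Lambda>" by (simp add: \<Lambda>_def)
  finally have 1: "(\<integral>\<alpha>. k t x w \<alpha> * (\<phi> y \<alpha> - \<phi> x \<alpha>) \<partial>M) + (\<integral>\<alpha>. k t y w \<alpha> * (\<phi> x \<alpha> - \<phi> y \<alpha>) \<partial>M)
      \<le> L * (norm (x - y))\<^sup>2 * \<Lambda>" .
  have "(g t x w - g t y w) \<bullet> (x - y) \<le> norm (g t x w - g t y w) * norm (x - y)" by (rule norm_cauchy_schwarz)
  also have "\<dots> \<le> (L * norm (x - y)) * norm (x - y)" using L by (intro mult_right_mono) auto
  finally have 2: "(g t x w - g t y w) \<bullet> (x - y) \<le> L * (norm (x - y))\<^sup>2" by (simp add: power2_eq_square mult.assoc)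
  have "R t x w y + R t y w x = (\<integral>\<alpha>. k t x w \<alpha> * (\<phi> y \<alpha> - \<phi> x \<alpha>) \<partial>M)
      + (\<integral>\<alpha>. k t y w \<alpha> * (\<phi> x \<alpha> - \<phi> y \<alpha>) \<partial>M) + (g t x w - g t y w) \<bullet> (x - y)"
    by (simp add: R_def inner_diff_left inner_diff_right)
  also have "\<dots> \<le> L * (norm (x - y))\<^sup>2 * \<Lambda> + L * (norm (x - y))\<^sup>2" using 1 2 by linarith
  finally show ?thesis by (simp add: algebra_simps)
qed

lemma unique_controlled_solution:
  fixes u :: "real \<Rightarrow> 'u"
  assumes u: "u \<in> borel_measurable (lebesgue_on {t0..})" "\<And>t. t0 \<le> t \<Longrightarrow> u t \<in> U"
  shows "\<exists>x. solves_inclusion (\<lambda>t x. F t x (u t)) t0 x0 x \<and>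
    (\<forall>y. solves_inclusion (\<lambda>t x. F t x (u t)) t0 x0 y \<longrightarrow> (\<forall>t\<ge>t0. y t = x t))"
proof -
  \<comment> \<open>One minorant is fixed per state, with no regularity in the state. Since it does
    not involve time or control, the resulting velocity at a fixed state depends on them through
    \<open>k\<close> and \<open>g\<close> alone, hence continuously, and composing with u keeps it
    measurable.\<close>
  have "\<forall>x. \<exists>\<xi>. \<xi> \<in> measurable_minorants M (q x)"
    using measurable_minorants_nonempty[OF q_sublinear] by blast
  from choice[OF this] obtain \<xi> where \<xi>: "\<forall>x. \<xi> x \<in> measurable_minorants M (q x)" ..
  define I where "I t x w = (\<integral>\<alpha>. k t x w \<alpha> *\<^sub>R \<xi> x \<alpha> \<partial>M)" for t x w
  define c where "c = (C1 + C2) * (1 + \<Lambda>)"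
  have I_bound: "norm (I t x w) \<le> (C1 + C2 * norm x) * \<Lambda>" if "w \<in> U" for t x w
  proof -
    have "norm (I t x w) \<le> (\<integral>\<alpha>. (C1 + C2 * norm x) * l \<alpha> \<partial>M)"
      unfolding I_def
    proof (rule integral_norm_le_integral)
      show "integrable M (\<lambda>\<alpha>. k t x w \<alpha> *\<^sub>R \<xi> x \<alpha>)" using \<xi> that minorant_integrable by blast
      show "integrable M (\<lambda>\<alpha>. (C1 + C2 * norm x) * l \<alpha>)" using l_int by simp
      fix \<alpha> assume \<alpha>: "\<alpha> \<in> space M"
      have "norm (k t x w \<alpha> *\<^sub>R \<xi> x \<alpha>) \<le> k t x w \<alpha> * l \<alpha>" using minorant_bound \<xi> that \<alpha> by blast
      also have "\<dots> \<le> (C1 + C2 * norm x) * l \<alpha>"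
        using k_bound[OF that \<alpha>] l_nonneg[OF \<alpha>] by (intro mult_right_mono) auto
      finally show "norm (k t x w \<alpha> *\<^sub>R \<xi> x \<alpha>) \<le> (C1 + C2 * norm x) * l \<alpha>" .
    qed
    then show ?thesis by (simp add: \<Lambda>_def)
  qed
  have I_cont: "continuous_on (UNIV \<times> U) (\<lambda>(t, w). I t x w)" for x
    unfolding I_def split_def
  proof (rule continuous_on_integral_dominated[where l = l and b = "\<lambda>_. C1 + C2 * norm x"])
    fix p :: "real \<times> 'u" assume "p \<in> UNIV \<times> U"
    then have p: "snd p \<in> U" by auto
    have "\<xi> x \<in> borel_measurable M" using \<xi> by (simp add: measurable_minorants_def)
    then show "(\<lambda>\<alpha>. k (fst p) x (snd p) \<alpha> *\<^sub>R \<xi> x \<alpha>) \<in> borel_measurable M"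
      using k_meas[OF p] by measurable
    fix \<alpha> assume \<alpha>: "\<alpha> \<in> space M"
    have "norm (k (fst p) x (snd p) \<alpha> *\<^sub>R \<xi> x \<alpha>) \<le> k (fst p) x (snd p) \<alpha> * l \<alpha>"
      using minorant_bound \<xi> p \<alpha> by blast
    also have "\<dots> \<le> (C1 + C2 * norm x) * l \<alpha>"
      using k_bound[OF p \<alpha>] l_nonneg[OF \<alpha>] by (intro mult_right_mono) auto
    finally show "norm (k (fst p) x (snd p) \<alpha> *\<^sub>R \<xi> x \<alpha>) \<le> (C1 + C2 * norm x) * l \<alpha>" .
  next
    fix \<alpha> assume \<alpha>: "\<alpha> \<in> space M"
    have "continuous_on (UNIV \<times> U) (\<lambda>p. (\<lambda>(t, x, w). k t x w \<alpha>) (fst p, x, snd p))"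
      by (rule continuous_on_compose2[OF k_cont[OF \<alpha>]]) (auto intro!: continuous_intros)
    then show "continuous_on (UNIV \<times> U) (\<lambda>p. k (fst p) x (snd p) \<alpha> *\<^sub>R \<xi> x \<alpha>)"
      by (auto intro!: continuous_intros)
  qed (use l_int l_nonneg in auto)
  have t_meas: "(\<lambda>t. t) \<in> borel_measurable (lebesgue_on {t0..})"
    by (intro measurable_restrict_space1 measurable_completion) simp
  interpret one_sided_inclusion t0 x0 "\<lambda>t x. g t x (u t) - I t x (u t)" "\<lambda>t x y. R t x (u t) y" c
  proof
    show "0 \<le> c" using C \<Lambda>_nonneg by (simp add: c_def)
    show "(\<lambda>t. g t z (u t) - I t z (u t)) \<in> borel_measurable (lebesgue_on {t0..})" for z
    proof (rule borel_measurable_diff)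
      have "(\<lambda>t. (\<lambda>(t, w). I t z w) (t, u t)) \<in> borel_measurable (lebesgue_on {t0..})"
        using u t_meas by (intro borel_measurable_continuous_on_compose[OF I_cont] borel_measurable_Pair) auto
      then show "(\<lambda>t. I t z (u t)) \<in> borel_measurable (lebesgue_on {t0..})" by simp
      have "(\<lambda>t. (\<lambda>(t, x, w). g t x w) (t, z, u t)) \<in> borel_measurable (lebesgue_on {t0..})"
        using u t_meas by (intro borel_measurable_continuous_on_compose[OF g_cont] borel_measurable_Pair) auto
      then show "(\<lambda>t. g t z (u t)) \<in> borel_measurable (lebesgue_on {t0..})" by simp
    qed
    show "(\<lambda>t. R t (z t) (u t) y) \<in> borel_measurable (lebesgue_on {t0..})"
      if "z \<in> borel_measurable (lebesgue_on {t0..})" for z y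
    proof -
      have "(\<lambda>t. (\<lambda>(t, x, w, y). R t x w y) (t, z t, u t, y)) \<in> borel_measurable (lebesgue_on {t0..})"
        using u t_meas that
        by (intro borel_measurable_continuous_on_compose[OF R_continuous] borel_measurable_Pair) auto
      then show ?thesis by simp
    qed
    fix t assume t: "t0 \<le> t"
    note ut = u(2)[OF t]
    show "(g t z (u t) - I t z (u t)) \<bullet> (z - y) \<le> R t z (u t) y" for y z
      using minorant_in_F[OF ut] \<xi> unfolding F_eq[OF ut] I_def by blast
    show "norm (g t z (u t) - I t z (u t)) \<le> c * (1 + norm z)" for z
    proof -
      have "norm (g t z (u t) - I t z (u t)) \<le> (C1 + C2 * norm z) * (1 + \<Lambda>)"
        using norm_triangle_ineq4[of "g t z (u t)" "I t z (u t)"] g_bound[OF ut, of t z] I_bound[OF ut, of t z]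
        by (simp add: algebra_simps)
      also have "\<dots> \<le> ((C1 + C2) * (1 + norm z)) * (1 + \<Lambda>)"
        using C \<Lambda>_nonneg by (intro mult_right_mono) (auto simp: algebra_simps)
      finally show ?thesis by (simp add: c_def mult_ac)
    qed
    show "\<bar>R t z (u t) y\<bar> \<le> c * (1 + norm z) * norm (y - z)" for y z
      unfolding c_def by (rule R_abs_bound[OF ut])
    show "continuous_on UNIV (\<lambda>z. R t z (u t) y)" for y
    proof -
      have "continuous_on UNIV (\<lambda>z. (\<lambda>(t, x, w, y). R t x w y) (t, z, u t, y))"
        by (rule continuous_on_compose2[OF R_continuous]) (use ut in \<open>auto intro!: continuous_intros\<close>)
      then show ?thesis by simp
    qed
    show "continuous_on UNIV (\<lambda>y. R t z (u t) y)" for z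
    proof -
      have "continuous_on UNIV (\<lambda>y. (\<lambda>(t, x, w, y). R t x w y) (t, z, u t, y))"
        by (rule continuous_on_compose2[OF R_continuous]) (use ut in \<open>auto intro!: continuous_intros\<close>)
      then show ?thesis by simp
    qed
  next
    fix T B
    obtain L where L: "L \<ge> 0" "\<forall>t\<in>{t0..T}. \<forall>x y. \<forall>w\<in>U. norm x \<le> B \<longrightarrow> norm y \<le> B \<longrightarrow>
        norm (g t x w - g t y w) \<le> L * norm (x - y) \<and>
        (\<forall>\<alpha>\<in>space M. \<bar>k t x w \<alpha> - k t y w \<alpha>\<bar> \<le> L * norm (x - y))"
      using lipschitz by meson
    show "\<exists>C\<ge>0. \<forall>t\<in>{t0..T}. \<forall>x y. norm x \<le> B \<longrightarrow> norm y \<le> B \<longrightarrow>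
        R t x (u t) y + R t y (u t) x \<le> C * (norm (x - y))\<^sup>2"
    proof (intro exI[of _ "L * (1 + \<Lambda>)"] conjI ballI allI impI)
      fix t and x y :: 'a assume "t \<in> {t0..T}" "norm x \<le> B" "norm y \<le> B"
      then show "R t x (u t) y + R t y (u t) x \<le> L * (1 + \<Lambda>) * (norm (x - y))\<^sup>2"
        using L u(2)[of t] by (intro R_one_sided) auto
    qed (use L \<Lambda>_nonneg in simp)
  qed
  \<comment> \<open>The two right-hand sides are compared only where the control is known to lie in
    U, that is on \<open>[t0, \<infinity>)\<close>, which is the space of the restricted
    measure.\<close>
  have "solves_inclusion (\<lambda>t x. F t x (u t)) t0 x0 y \<longleftrightarrow> solves_inclusion rhs t0 x0 y" for y
    unfolding solves_inclusion_def
    by (intro conj_cong refl AE_cong) (use F_eq u(2) in \<open>auto simp: rhs_def\<close>)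
  then show ?thesis using unique_solution by simp
qed

end

theorem theorem1:
  fixes U :: "(real ^ 'm) set"
    and A :: "(real ^ 'nu) set"
    and \<mu> :: "(real ^ 'nu) measure"
    and g :: "real \<Rightarrow> real ^ 'n \<Rightarrow> real ^ 'm \<Rightarrow> real ^ 'n"
    and k :: "real \<Rightarrow> real ^ 'n \<Rightarrow> real ^ 'm \<Rightarrow> real ^ 'nu \<Rightarrow> real"
    and \<phi> :: "real ^ 'n \<Rightarrow> real ^ 'nu \<Rightarrow> real"
    and C1 C2 :: real
    and L\<phi> :: "real ^ 'nu \<Rightarrow> real"
    and t0 :: real
    and x0 :: "real ^ 'n"
    and u :: "real \<Rightarrow> real ^ 'm"
  assumes U: "U \<noteq> {}" "compact U"
    and A: "compact A"
    and \<mu>: "finite_radon_measure_on A \<mu>"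
    and H1: "continuous_on (UNIV \<times> UNIV \<times> U \<times> A) (\<lambda>(t, x, u, \<alpha>). k t x u \<alpha>)"
      "continuous_on (UNIV \<times> UNIV \<times> U) (\<lambda>(t, x, u). g t x u)"
      "continuous_on (UNIV \<times> A) (\<lambda>(x, \<alpha>). \<phi> x \<alpha>)"
    and H2: "\<And>(I :: real set) (K :: (real ^ 'n) set). compact I \<Longrightarrow> compact K \<Longrightarrow>
      \<exists>L>0. \<forall>t\<in>I. \<forall>x\<in>K. \<forall>s\<in>I. \<forall>y\<in>K. \<forall>u\<in>U.
        norm (g t x u - g s y u) \<le> L * (\<bar>t - s\<bar> + norm (x - y)) \<and>
        (\<forall>\<alpha>\<in>A. \<bar>k t x u \<alpha> - k s y u \<alpha>\<bar> \<le> L * (\<bar>t - s\<bar> + norm (x - y)))"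
    and H3: "0 \<le> C1" "0 \<le> C2"
      "\<And>t x u \<alpha>. u \<in> U \<Longrightarrow> \<alpha> \<in> A \<Longrightarrow> 0 \<le> k t x u \<alpha> \<and> k t x u \<alpha> \<le> C1 + C2 * norm x"
      "\<And>t x u. u \<in> U \<Longrightarrow> norm (g t x u) \<le> C1 + C2 * norm x"
    and H4: "\<And>\<alpha>. \<alpha> \<in> A \<Longrightarrow> convex_on UNIV (\<lambda>x. \<phi> x \<alpha>)"
      "\<And>\<alpha>. \<alpha> \<in> A \<Longrightarrow> lipschitz_on (L\<phi> \<alpha>) UNIV (\<lambda>x. \<phi> x \<alpha>)"
      "\<And>\<alpha>. \<alpha> \<in> A \<Longrightarrow> 0 \<le> L\<phi> \<alpha>"
      "integrable (completion \<mu>) L\<phi>"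
    and H5: "\<And>t x. convex (F_bar g k \<phi> \<mu> U t x)"
    and u: "u \<in> borel_measurable (lebesgue_on {t0..})" "\<And>t. t0 \<le> t \<Longrightarrow> u t \<in> U"
  shows "\<exists>x. solves_inclusion (\<lambda>t x. F_map g k \<phi> \<mu> t x (u t)) t0 x0 x \<and>
    (\<forall>y. solves_inclusion (\<lambda>t x. F_map g k \<phi> \<mu> t x (u t)) t0 x0 y \<longrightarrow>
      (\<forall>t\<ge>t0. y t = x t))"
proof -
  have sets: "sets \<mu> = sets (restrict_space borel A)"
    using \<mu> by (simp add: finite_radon_measure_on_def)
  have space: "space (completion \<mu>) = A" using sets_eq_imp_space_eq[OF sets] by (simp add: space_restrict_space)
  have meas: "f \<in> borel_measurable (completion \<mu>)" if "continuous_on A f" for f :: "real ^ 'nu \<Rightarrow> real"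
    using borel_measurable_continuous_on_restrict[OF that] measurable_cong_sets[OF sets refl, of borel]
    by (intro measurable_completion) auto
  interpret subdifferential_control "completion \<mu>" U g k \<phi> C1 C2 L\<phi>
  proof
    show "k t x w \<in> borel_measurable (completion \<mu>)" if "w \<in> U" for t x w
    proof -
      have "continuous_on A (\<lambda>\<alpha>. (\<lambda>(t, x, u, \<alpha>). k t x u \<alpha>) (t, x, w, \<alpha>))"
        by (rule continuous_on_compose2[OF H1(1)]) (use that in \<open>auto intro!: continuous_intros\<close>)
      then show ?thesis by (intro meas) simp
    qed
    show "\<phi> x \<in> borel_measurable (completion \<mu>)" for x
    proof -
      have "continuous_on A (\<lambda>\<alpha>. (\<lambda>(x, \<alpha>). \<phi> x \<alpha>) (x, \<alpha>))"
        by (rule continuous_on_compose2[OF H1(3)]) (auto intro!: continuous_intros)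
      then show ?thesis by (intro meas) simp
    qed
    show "continuous_on (UNIV \<times> UNIV \<times> U) (\<lambda>(t, x, w). k t x w \<alpha>)" if "\<alpha> \<in> space (completion \<mu>)" for \<alpha>
    proof -
      have "continuous_on (UNIV \<times> UNIV \<times> U)
          (\<lambda>p. (\<lambda>(t, x, u, \<alpha>). k t x u \<alpha>) (fst p, fst (snd p), snd (snd p), \<alpha>))"
        by (rule continuous_on_compose2[OF H1(1)]) (use that space in \<open>auto intro!: continuous_intros\<close>)
      then show ?thesis by (simp add: split_def)
    qed
    fix a T B :: real
    \<comment> \<open>Balls serve as the compact sets; the time increment disappears below by taking
      both times equal.\<close>
    obtain L where L: "L > 0" "\<forall>t\<in>{a..T}. \<forall>x\<in>cball 0 B. \<forall>s\<in>{a..T}. \<forall>y\<in>cball 0 B. \<forall>u\<in>U.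
        norm (g t x u - g s y u) \<le> L * (\<bar>t - s\<bar> + norm (x - y)) \<and>
        (\<forall>\<alpha>\<in>A. \<bar>k t x u \<alpha> - k s y u \<alpha>\<bar> \<le> L * (\<bar>t - s\<bar> + norm (x - y)))"
      using H2[of "{a..T}" "cball 0 B"] by (meson compact_Icc compact_cball)
    show "\<exists>L\<ge>0. \<forall>t\<in>{a..T}. \<forall>x y. \<forall>w\<in>U. norm x \<le> B \<longrightarrow> norm y \<le> B \<longrightarrow>
        norm (g t x w - g t y w) \<le> L * norm (x - y) \<and>
        (\<forall>\<alpha>\<in>space (completion \<mu>). \<bar>k t x w \<alpha> - k t y w \<alpha>\<bar> \<le> L * norm (x - y))"
    proof (intro exI[of _ L] conjI ballI allI impI)
      fix t w and x y :: "real ^ 'n" assume *: "t \<in> {a..T}" "w \<in> U" "norm x \<le> B" "norm y \<le> B"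
      have **: "x \<in> cball 0 B" "y \<in> cball 0 B" using * by auto
      have LL: "norm (g t x w - g t y w) \<le> L * (\<bar>t - t\<bar> + norm (x - y)) \<and>
          (\<forall>\<alpha>\<in>A. \<bar>k t x w \<alpha> - k t y w \<alpha>\<bar> \<le> L * (\<bar>t - t\<bar> + norm (x - y)))"
        using L(2) * ** by blast
      show "norm (g t x w - g t y w) \<le> L * norm (x - y)" using LL by simp
      show "\<bar>k t x w \<alpha> - k t y w \<alpha>\<bar> \<le> L * norm (x - y)" if "\<alpha> \<in> space (completion \<mu>)" for \<alpha>
        using LL that space by simp
    qed (use L in simp)
  qed (use H1(2) H3 H4 space in auto)
  have "F_map g k \<phi> \<mu> = F" by (intro ext) (simp add: F_map_def F_def)
  then show ?thesis using unique_controlled_solution[OF u] by simp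
qed

end
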